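(* Let $\Sigma$ be a finitely primitive Markov shift with alphabet $I\subset\mathbb{N}$ and left shift $\sigma$, let $G$ be a countable group with Haar (counting) measure $\lambda$, let $\Psi:I^{*}\to G$ be a semigroup homomorphism, and suppose that the group-extended Markov system $(\Sigma\times G,\sigma\rtimes\Psi)$ is topologically mixing. Let $\varphi:\Sigma\to\mathbb{R}$ be Hölder continuous with $\mathcal{P}(\varphi\circ\pi_1,\sigma\rtimes\Psi)<\infty$, and suppose that $\varphi\circ\pi_1$ is recurrent. Let $c:G\to(\mathbb{R}^{+},\cdot)$ be the unique group homomorphism such that, with $\varphi_c(x):=\varphi(x)-\log c(\Psi(x_1))$, one has $\mathcal{P}(\varphi_c,\sigma)<\infty$ and $\mu_{\varphi_c}\times\lambda$ is conservative. Let $h:\Sigma\times G\to\mathbb{R}^{+}$ be the unique (up to a constant multiple) continuous function which is fixed by $e^{-\mathcal{P}(\varphi\circ\pi_1,\sigma\rtimes\Psi)}\mathcal{L}_{\varphi\circ\pi_1}$ and bounded on cylindrical sets, and let $\nu$ be the unique (up to a constant multiple) measure on $\Sigma\times G$ which is fixed by $e^{-\mathcal{P}(\varphi\circ\pi_1,\sigma\rtimes\Psi)}\mathcal{L}_{\varphi\circ\pi_1}^{*}$ and positive and finite on cylindrical sets. Then the following statements are equivalent. (1) The group homomorphism $c$ is trivial. (2) $\mathcal{P}(\varphi\circ\pi_1,\sigma\rtimes\Psi)=\mathcal{P}(\varphi,\sigma)$. (3) The function $h$ is independent of the second coordinate. (4) The measure $\nu$ on $\Sigma\times G$ is a product measure.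 (5) $\mu_\varphi\times\lambda$ is the equilibrium measure of $\varphi\circ\pi_1$.
   Context: Markov shifts. For an at most countable alphabet $I$ and a matrix $A=(a(i,j))\in\{0,1\}^{I\times I}$, the Markov shift is $\Sigma=\{\omega\in I^{\mathbb{N}}: a(\omega_i,\omega_{i+1})=1\ \forall i\}$ with left shift $\sigma$; $\Sigma^n$ is the set of admissible words of length $n$ (words $\omega\in I^n$ with $a(\omega_i,\omega_{i+1})=1$ for $1\le i<n$), $\Sigma^*=\bigcup_{n\ge1}\Sigma^n$, and $[\omega]=\{\tau\in\Sigma:(\tau_1,\dots,\tau_n)=\omega\}$ for $\omega\in\Sigma^n$ is a cylindrical set. $\Sigma$ carries the subspace topology of the product of discrete topologies. $I^*$ is the free semigroup on $I$ (finite non-empty words under concatenation). $\Sigma$ is topologically mixing if for all $i,j\in I$ there is $n_0$ such that for every $n\ge n_0$ there is $\omega\in\Sigma^n$ with $i\omega j\in\Sigma^*$. $\Sigma$ is finitely primitive if there are $l\in\mathbb{N}$ and a finite set $\Lambda\subset\Sigma^l$ such that for all $i,j\in I$ there is $\omega\in\Lambda$ with $i\omega j\in\Sigma^*$. Hölder continuity. $f:\Sigma\to\mathbb{R}$ is Hölder continuous if for some $\alpha>0$ there is a finite constant $V$ with $|f(\omega)-f(\tau)|\le V e^{-\alpha|\omega\wedge\tau|}$ for all $\omega,\tau\in\Sigma$ with $\omega_1=\tau_1$, where $|\omega\wedge\tau|$ is the length of the longest common initial block. $S_nf=\sum_{k=0}^{n-1}f\circ\sigma^k$. Group extension. $\sigma\rtimes\Psi:\Sigma\times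 G\to\Sigma\times G$, $(\sigma\rtimes\Psi)(\omega,g)=(\sigma\omega,g\Psi(\omega_1))$. It is identified with the Markov shift with alphabet $I\times G$ and state space $\{((\omega_j,g_j))_j\in(I\times G)^{\mathbb{N}}:\omega\in\Sigma,\ g_j\Psi(\omega_j)=g_{j+1}\ \forall j\}$; topological mixing, Hölder continuity, pressure, cylindrical sets (the sets $[\omega]\times\{g\}$, $\omega\in\Sigma^*$, $g\in G$) and recurrence for $\Sigma\times G$ refer to this Markov shift. $\pi_1:\Sigma\times G\to\Sigma$ is the projection. Gurevich pressure and recurrence. For an irreducible Markov shift $(\Sigma,\sigma)$ (for all $i,j\in I$ there is $\omega\in\Sigma^*$ with $i\omega j\in\Sigma^*$) with alphabet $I$, Hölder continuous $f$ and $a\in I$, let $Z_n(f,a,\sigma)=\sum_{x\in\Sigma,\,x_1=a,\,\sigma^nx=x}e^{S_nf(x)}$ and $\mathcal{P}(f,\sigma)=\limsup_{n}\frac1n\log Z_n(f,a,\sigma)$ (independent of $a$). If $\mathcal{P}(f,\sigma)<\infty$, $f$ is recurrent if $\sum_{n}e^{-n\mathcal{P}(f,\sigma)}Z_n(f,a,\sigma)=\infty$ for some (hence all) $a\in I$. Transfer operator. $\mathcal{L}_f(u)(x)=\sum_{\sigma(y)=x}e^{f(y)}u(y)$, and $\mathcal{L}_{\varphi\circ\pi_1}$ is defined likewise with $\sigma\rtimes\Psi$ in place of $\sigma$. For a $\sigma$-finite Borel measure $\nu$ and $\rho>0$, $\mathcal{L}_f^*\nu=\rho\nu$ means $\nu(\mathcal{L}_f(u))=\rho\,\nu(u)$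 for all $u\in L^1(\nu)$. Existence and uniqueness facts used in the definitions: by results of Sarig, since $\Sigma\times G$ is topologically mixing and $\varphi\circ\pi_1$ is recurrent, $h$ and $\nu$ as in the claim exist and are unique up to constant multiples; the measure $h\,d\nu$ (determined up to a positive constant multiple) is called the equilibrium measure of $\varphi\circ\pi_1$. The homomorphism $c$ as in the claim exists and is unique whenever $\varphi\circ\pi_1$ is recurrent. Gibbs measures. For finitely primitive $\Sigma$ and Hölder continuous $f$ with $\mathcal{P}(f,\sigma)<\infty$, $\mu_f$ denotes the unique $\sigma$-invariant Gibbs measure for $f$, i.e. the unique $\sigma$-invariant Borel probability measure for which there is $C>0$ with $C^{-1}\le\mu_f([\omega])\,e^{-S_nf(\tau)+n\mathcal{P}(f,\sigma)}\le C$ for all $n$, $\omega\in\Sigma^n$, $\tau\in[\omega]$. Statement (5) is understood to include that $\mathcal{P}(\varphi,\sigma)<\infty$, so that $\mu_\varphi$ is defined. A measure $m$ on $\Sigma\times G$ is conservative (with respect to $T=\sigma\rtimes\Psi$) if every Borel set $W$ whose preimages $T^{-n}W$, $n\ge0$, are pairwise disjoint satisfies $m(W)=0$.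
   Formalization: In (4), "product measure" is taken to mean a product of a σ-finite measure on Σ with the Haar measure λ; with an arbitrary measure on G as second factor, ν can be a product although c is nontrivial, so the equivalence would fail. *)

theory Defs
  imports "HOL-Probability.Probability" "HOL-Algebra.Group"
begin

section \<open>Markov shifts\<close>

text \<open>Sequences are indexed from 0, so the first letter of \<open>x\<close> is \<open>x 0\<close>. The 0-1 matrix is a
  relation \<open>A\<close>, of which only the restriction to the alphabet \<open>I\<close> matters.\<close>

definition mshift :: "'a set \<Rightarrow> ('a \<Rightarrow> 'a \<Rightarrow> bool) \<Rightarrow> (nat \<Rightarrow> 'a) set" where
  "mshift I A = {x. (\<forall>n. x n \<in> I) \<and> (\<forall>n. A (x n) (x (Suc n)))}"

definition left_shift :: "(nat \<Rightarrow> 'a) \<Rightarrow> (nat \<Rightarrow> 'a)" where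
  "left_shift x = (\<lambda>n. x (Suc n))"

definition words_of_length :: "'a set \<Rightarrow> ('a \<Rightarrow> 'a \<Rightarrow> bool) \<Rightarrow> nat \<Rightarrow> 'a list set" where
  "words_of_length I A n = {w \<in> lists I. length w = n \<and> successively A w}"

definition adm_words :: "'a set \<Rightarrow> ('a \<Rightarrow> 'a \<Rightarrow> bool) \<Rightarrow> 'a list set" where
  "adm_words I A = (\<Union>n\<in>{1..}. words_of_length I A n)"

definition cylinder :: "'a set \<Rightarrow> ('a \<Rightarrow> 'a \<Rightarrow> bool) \<Rightarrow> 'a list \<Rightarrow> (nat \<Rightarrow> 'a) set" where
  "cylinder I A w = {x \<in> mshift I A. \<forall>k<length w. x k = w ! k}"

definition shift_topology :: "'a set \<Rightarrow> ('a \<Rightarrow> 'a \<Rightarrow> bool) \<Rightarrow> (nat \<Rightarrow> 'a) topology" where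
  "shift_topology I A =
     subtopology (product_topology (\<lambda>_. discrete_topology I) UNIV) (mshift I A)"

definition topologically_mixing :: "'a set \<Rightarrow> ('a \<Rightarrow> 'a \<Rightarrow> bool) \<Rightarrow> bool" where
  "topologically_mixing I A \<longleftrightarrow>
     (\<forall>i\<in>I. \<forall>j\<in>I. \<exists>n\<^sub>0. \<forall>n\<ge>n\<^sub>0. \<exists>w\<in>words_of_length I A n. i # w @ [j] \<in> adm_words I A)"

definition finitely_primitive :: "'a set \<Rightarrow> ('a \<Rightarrow> 'a \<Rightarrow> bool) \<Rightarrow> bool" where
  "finitely_primitive I A \<longleftrightarrow>
     (\<exists>l\<ge>1. \<exists>\<Lambda>. finite \<Lambda> \<and> \<Lambda> \<subseteq> words_of_length I A l \<and>
        (\<forall>i\<in>I. \<forall>j\<in>I. \<exists>w\<in>\<Lambda>. i # w @ [j] \<in> adm_words I A))"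

text \<open>Length of the longest common initial block; meaningful for distinct sequences only (for equal
  ones it is infinite, and the Hoelder inequality below is trivial).\<close>

definition common_length :: "(nat \<Rightarrow> 'a) \<Rightarrow> (nat \<Rightarrow> 'a) \<Rightarrow> nat" where
  "common_length x y = (LEAST n. x n \<noteq> y n)"

definition hoelder_continuous ::
    "'a set \<Rightarrow> ('a \<Rightarrow> 'a \<Rightarrow> bool) \<Rightarrow> ((nat \<Rightarrow> 'a) \<Rightarrow> real) \<Rightarrow> bool" where
  "hoelder_continuous I A f \<longleftrightarrow>
     (\<exists>\<alpha>>0. \<exists>V::real. \<forall>x\<in>mshift I A. \<forall>y\<in>mshift I A. x 0 = y 0 \<longrightarrow> x \<noteq> y \<longrightarrow>
        \<bar>f x - f y\<bar> \<le> V * exp (- \<alpha> * real (common_length x y)))"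

definition birkhoff_sum :: "nat \<Rightarrow> ((nat \<Rightarrow> 'a) \<Rightarrow> real) \<Rightarrow> (nat \<Rightarrow> 'a) \<Rightarrow> real" where
  "birkhoff_sum n f x = (\<Sum>k<n. f ((left_shift ^^ k) x))"


section \<open>Gurevich pressure and recurrence\<close>

definition ext_ln :: "ennreal \<Rightarrow> ereal" where
  "ext_ln z = (if z = 0 then - \<infinity> else if z = \<infinity> then \<infinity> else ereal (ln (enn2real z)))"

definition partition_fun ::
    "'a set \<Rightarrow> ('a \<Rightarrow> 'a \<Rightarrow> bool) \<Rightarrow> ((nat \<Rightarrow> 'a) \<Rightarrow> real) \<Rightarrow> 'a \<Rightarrow> nat \<Rightarrow> ennreal" where
  "partition_fun I A f a n =
     (\<Sum>\<^sub>\<infinity>x\<in>{x \<in> mshift I A. x 0 = a \<and> (left_shift ^^ n) x = x}. ennreal (exp (birkhoff_sum n f x)))"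

text \<open>For an irreducible shift and Hoelder continuous \<open>f\<close> the limit superior does not depend on
  the letter \<open>a\<close>, so an arbitrary one is chosen.\<close>

definition gurevich_pressure ::
    "'a set \<Rightarrow> ('a \<Rightarrow> 'a \<Rightarrow> bool) \<Rightarrow> ((nat \<Rightarrow> 'a) \<Rightarrow> real) \<Rightarrow> ereal" where
  "gurevich_pressure I A f =
     (let a = (SOME a. a \<in> I)
      in limsup (\<lambda>n. ext_ln (partition_fun I A f a n) / ereal (real n)))"

text \<open>The series starts at \<open>n = 1\<close>: for \<open>n = 0\<close> the partition function counts all points of a
  cylinder.\<close>

definition recurrent ::
    "'a set \<Rightarrow> ('a \<Rightarrow> 'a \<Rightarrow> bool) \<Rightarrow> ((nat \<Rightarrow> 'a) \<Rightarrow> real) \<Rightarrow> bool" where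
  "recurrent I A f \<longleftrightarrow> gurevich_pressure I A f < \<infinity> \<and>
     (\<exists>a\<in>I. (\<Sum>n. ennreal (exp (- real (Suc n) * real_of_ereal (gurevich_pressure I A f)))
                   * partition_fun I A f a (Suc n)) = \<infinity>)"


section \<open>Measures, transfer operators, conservativity\<close>

definition borel_of :: "'x topology \<Rightarrow> 'x measure" where
  "borel_of X = sigma (topspace X) {U. openin X U}"

definition invariant_gibbs_measure ::
    "'a set \<Rightarrow> ('a \<Rightarrow> 'a \<Rightarrow> bool) \<Rightarrow> ((nat \<Rightarrow> 'a) \<Rightarrow> real) \<Rightarrow> (nat \<Rightarrow> 'a) measure \<Rightarrow> bool" where
  "invariant_gibbs_measure I A f \<mu> \<longleftrightarrow>
     sets \<mu> = sets (borel_of (shift_topology I A)) \<and> prob_space \<mu> \<and>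
     (\<forall>B\<in>sets \<mu>. emeasure \<mu> (left_shift -` B \<inter> space \<mu>) = emeasure \<mu> B) \<and>
     (\<exists>C>0. \<forall>n\<ge>1. \<forall>w\<in>words_of_length I A n. \<forall>x\<in>cylinder I A w.
        let q = measure \<mu> (cylinder I A w) *
                exp (- birkhoff_sum n f x + real n * real_of_ereal (gurevich_pressure I A f))
        in inverse C \<le> q \<and> q \<le> C)"

text \<open>Points without convergence get the junk value 0. For a positive function fixed up to a
  positive factor this value is excluded.\<close>

definition transfer_op ::
    "'x set \<Rightarrow> ('x \<Rightarrow> 'x) \<Rightarrow> ('x \<Rightarrow> real) \<Rightarrow> ('x \<Rightarrow> real) \<Rightarrow> 'x \<Rightarrow> real" where
  "transfer_op X T f u x = (\<Sum>\<^sub>\<infinity>y\<in>{y \<in> X. T y = x}. exp (f y) * u y)"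

definition dual_eigenmeasure ::
    "('x \<Rightarrow> 'x) \<Rightarrow> ('x \<Rightarrow> real) \<Rightarrow> real \<Rightarrow> 'x measure \<Rightarrow> bool" where
  "dual_eigenmeasure T f \<rho> \<nu> \<longleftrightarrow> sigma_finite_measure \<nu> \<and>
     (\<forall>u. integrable \<nu> u \<longrightarrow>
        (AE x in \<nu>. (\<lambda>y. exp (f y) * u y) summable_on {y \<in> space \<nu>. T y = x}) \<and>
        integrable \<nu> (transfer_op (space \<nu>) T f u) \<and>
        integral\<^sup>L \<nu> (transfer_op (space \<nu>) T f u) = \<rho> * integral\<^sup>L \<nu> u)"

definition conservative :: "('x \<Rightarrow> 'x) \<Rightarrow> 'x measure \<Rightarrow> bool" where
  "conservative T m \<longleftrightarrow>
     (\<forall>W\<in>sets m. disjoint_family (\<lambda>n. (T ^^ n) -` W \<inter> space m) \<longrightarrow> emeasure m W = 0)"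


section \<open>Group extensions\<close>

text \<open>The free semigroup on \<open>I\<close> consists of the non-empty lists over \<open>I\<close>.\<close>

definition semigroup_hom :: "'a set \<Rightarrow> ('g, 'm) monoid_scheme \<Rightarrow> ('a list \<Rightarrow> 'g) \<Rightarrow> bool" where
  "semigroup_hom I G \<Psi> \<longleftrightarrow>
     (\<forall>u\<in>lists I - {[]}. \<Psi> u \<in> carrier G) \<and>
     (\<forall>u\<in>lists I - {[]}. \<forall>v\<in>lists I - {[]}. \<Psi> (u @ v) = \<Psi> u \<otimes>\<^bsub>G\<^esub> \<Psi> v)"

definition pos_reals :: "real monoid" where
  "pos_reals = \<lparr>carrier = {0<..}, mult = (*), one = 1\<rparr>"

definition ext_space ::
    "'a set \<Rightarrow> ('a \<Rightarrow> 'a \<Rightarrow> bool) \<Rightarrow> ('g, 'm) monoid_scheme \<Rightarrow> ((nat \<Rightarrow> 'a) \<times> 'g) set" where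
  "ext_space I A G = mshift I A \<times> carrier G"

definition ext_map ::
    "('g, 'm) monoid_scheme \<Rightarrow> ('a list \<Rightarrow> 'g) \<Rightarrow> (nat \<Rightarrow> 'a) \<times> 'g \<Rightarrow> (nat \<Rightarrow> 'a) \<times> 'g" where
  "ext_map G \<Psi> = (\<lambda>(x, g). (left_shift x, g \<otimes>\<^bsub>G\<^esub> \<Psi> [x 0]))"

definition ext_topology ::
    "'a set \<Rightarrow> ('a \<Rightarrow> 'a \<Rightarrow> bool) \<Rightarrow> ('g, 'm) monoid_scheme \<Rightarrow> ((nat \<Rightarrow> 'a) \<times> 'g) topology" where
  "ext_topology I A G = prod_topology (shift_topology I A) (discrete_topology (carrier G))"

definition ext_cylinder ::
    "'a set \<Rightarrow> ('a \<Rightarrow> 'a \<Rightarrow> bool) \<Rightarrow> 'a list \<Rightarrow> 'g \<Rightarrow> ((nat \<Rightarrow> 'a) \<times> 'g) set" where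
  "ext_cylinder I A w g = cylinder I A w \<times> {g}"

text \<open>The group extension as a Markov shift over \<open>I \<times> G\<close>. Its points are the sequences
  \<open>(x j, g j)\<close> with \<open>x\<close> in the base shift and \<open>g (j+1) = g j * \<Psi> [x j]\<close>; the map
  \<open>ext_decode\<close> identifies them with the pairs \<open>(x, g 0)\<close>, conjugating the left shift to
  \<open>ext_map\<close>.\<close>

definition ext_alphabet :: "'a set \<Rightarrow> ('g, 'm) monoid_scheme \<Rightarrow> ('a \<times> 'g) set" where
  "ext_alphabet I G = I \<times> carrier G"

definition ext_matrix ::
    "('a \<Rightarrow> 'a \<Rightarrow> bool) \<Rightarrow> ('g, 'm) monoid_scheme \<Rightarrow> ('a list \<Rightarrow> 'g) \<Rightarrow> 'a \<times> 'g \<Rightarrow> 'a \<times> 'g \<Rightarrow> bool" where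
  "ext_matrix A G \<Psi> = (\<lambda>(i, g) (j, g'). A i j \<and> g \<otimes>\<^bsub>G\<^esub> \<Psi> [i] = g')"

definition ext_decode :: "(nat \<Rightarrow> 'a \<times> 'g) \<Rightarrow> (nat \<Rightarrow> 'a) \<times> 'g" where
  "ext_decode z = (fst \<circ> z, snd (z 0))"

definition ext_mixing ::
    "'a set \<Rightarrow> ('a \<Rightarrow> 'a \<Rightarrow> bool) \<Rightarrow> ('g, 'm) monoid_scheme \<Rightarrow> ('a list \<Rightarrow> 'g) \<Rightarrow> bool" where
  "ext_mixing I A G \<Psi> \<longleftrightarrow> topologically_mixing (ext_alphabet I G) (ext_matrix A G \<Psi>)"

definition ext_pressure ::
    "'a set \<Rightarrow> ('a \<Rightarrow> 'a \<Rightarrow> bool) \<Rightarrow> ('g, 'm) monoid_scheme \<Rightarrow> ('a list \<Rightarrow> 'g) \<Rightarrow>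
     ((nat \<Rightarrow> 'a) \<times> 'g \<Rightarrow> real) \<Rightarrow> ereal" where
  "ext_pressure I A G \<Psi> f =
     gurevich_pressure (ext_alphabet I G) (ext_matrix A G \<Psi>) (f \<circ> ext_decode)"

definition ext_recurrent ::
    "'a set \<Rightarrow> ('a \<Rightarrow> 'a \<Rightarrow> bool) \<Rightarrow> ('g, 'm) monoid_scheme \<Rightarrow> ('a list \<Rightarrow> 'g) \<Rightarrow>
     ((nat \<Rightarrow> 'a) \<times> 'g \<Rightarrow> real) \<Rightarrow> bool" where
  "ext_recurrent I A G \<Psi> f \<longleftrightarrow>
     recurrent (ext_alphabet I G) (ext_matrix A G \<Psi>) (f \<circ> ext_decode)"

abbreviation haar :: "('g, 'm) monoid_scheme \<Rightarrow> 'g measure" where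
  "haar G \<equiv> count_space (carrier G)"

definition twisted_potential ::
    "('a list \<Rightarrow> 'g) \<Rightarrow> ('g \<Rightarrow> real) \<Rightarrow> ((nat \<Rightarrow> 'a) \<Rightarrow> real) \<Rightarrow> (nat \<Rightarrow> 'a) \<Rightarrow> real" where
  "twisted_potential \<Psi> c \<phi> x = \<phi> x - ln (c (\<Psi> [x 0]))"

definition conservative_twist ::
    "'a set \<Rightarrow> ('a \<Rightarrow> 'a \<Rightarrow> bool) \<Rightarrow> ('g, 'm) monoid_scheme \<Rightarrow> ('a list \<Rightarrow> 'g) \<Rightarrow>
     ((nat \<Rightarrow> 'a) \<Rightarrow> real) \<Rightarrow> ('g \<Rightarrow> real) \<Rightarrow> bool" where
  "conservative_twist I A G \<Psi> \<phi> c \<longleftrightarrow> c \<in> hom G pos_reals \<and>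
     gurevich_pressure I A (twisted_potential \<Psi> c \<phi>) < \<infinity> \<and>
     (\<exists>\<mu>. invariant_gibbs_measure I A (twisted_potential \<Psi> c \<phi>) \<mu> \<and>
          conservative (ext_map G \<Psi>) (\<mu> \<Otimes>\<^sub>M haar G))"

definition positive_eigenfunction ::
    "'a set \<Rightarrow> ('a \<Rightarrow> 'a \<Rightarrow> bool) \<Rightarrow> ('g, 'm) monoid_scheme \<Rightarrow> ('a list \<Rightarrow> 'g) \<Rightarrow>
     ((nat \<Rightarrow> 'a) \<times> 'g \<Rightarrow> real) \<Rightarrow> ((nat \<Rightarrow> 'a) \<times> 'g \<Rightarrow> real) \<Rightarrow> bool" where
  "positive_eigenfunction I A G \<Psi> f h \<longleftrightarrow>
     (\<forall>p\<in>ext_space I A G. h p > 0) \<and>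
     continuous_map (ext_topology I A G) euclideanreal h \<and>
     (\<forall>p\<in>ext_space I A G.
        exp (- real_of_ereal (ext_pressure I A G \<Psi> f)) *
          transfer_op (ext_space I A G) (ext_map G \<Psi>) f h p = h p) \<and>
     (\<forall>w\<in>adm_words I A. \<forall>g\<in>carrier G. bounded (h ` ext_cylinder I A w g))"

definition conformal_measure ::
    "'a set \<Rightarrow> ('a \<Rightarrow> 'a \<Rightarrow> bool) \<Rightarrow> ('g, 'm) monoid_scheme \<Rightarrow> ('a list \<Rightarrow> 'g) \<Rightarrow>
     ((nat \<Rightarrow> 'a) \<times> 'g \<Rightarrow> real) \<Rightarrow> ((nat \<Rightarrow> 'a) \<times> 'g) measure \<Rightarrow> bool" where
  "conformal_measure I A G \<Psi> f \<nu> \<longleftrightarrow>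
     sets \<nu> = sets (borel_of (ext_topology I A G)) \<and>
     dual_eigenmeasure (ext_map G \<Psi>) f (exp (real_of_ereal (ext_pressure I A G \<Psi> f))) \<nu> \<and>
     (\<forall>w\<in>adm_words I A. \<forall>g\<in>carrier G.
        0 < emeasure \<nu> (ext_cylinder I A w g) \<and> emeasure \<nu> (ext_cylinder I A w g) < \<infinity>)"

text \<open>Being a product measure on \<open>\<Sigma> \<times> G\<close> refers to the Haar measure on \<open>G\<close>. If an arbitrary
  measure on \<open>G\<close> were allowed as second factor, the condition would be void: writing \<open>\<mu>\<close> for the
  eigenmeasure of the dual transfer operator of the twisted potential on the base, the measure
  \<open>\<nu>\<close> is always a multiple of the product of \<open>\<mu>\<close> and \<open>(1/c) d\<lambda>\<close>.\<close>

definition haar_product_measure ::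
    "'a set \<Rightarrow> ('a \<Rightarrow> 'a \<Rightarrow> bool) \<Rightarrow> ('g, 'm) monoid_scheme \<Rightarrow> ((nat \<Rightarrow> 'a) \<times> 'g) measure \<Rightarrow> bool" where
  "haar_product_measure I A G \<nu> \<longleftrightarrow>
     (\<exists>\<mu>. sets \<mu> = sets (borel_of (shift_topology I A)) \<and> sigma_finite_measure \<mu> \<and>
          \<nu> = \<mu> \<Otimes>\<^sub>M haar G)"

text \<open>The measure \<open>h d\<nu>\<close> is determined up to a positive factor.\<close>

definition is_equilibrium_measure ::
    "('x \<Rightarrow> real) \<Rightarrow> 'x measure \<Rightarrow> 'x measure \<Rightarrow> bool" where
  "is_equilibrium_measure h \<nu> m \<longleftrightarrow> (\<exists>t>0. m = density \<nu> (\<lambda>p. ennreal (t * h p)))"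

end

theory Submission
  imports Defs
begin

text \<open>
  Write \<open>X\<close> for the product of the shift space with \<open>G\<close>, \<open>T\<close> for the skew product map, \<open>\<phi>_c\<close> for
  the twisted potential, \<open>P\<close> for its pressure, \<open>\<mu>\<close> for its invariant Gibbs measure and \<open>m\<close> for the
  product of \<open>\<mu>\<close> with counting measure. The measure \<open>m\<close> is \<open>T\<close>-invariant and conservative, and
  left translations of \<open>G\<close> preserve it. The proof compares \<open>m\<close> with the conformal measure \<open>\<nu>\<close>.

  The potentials \<open>\<phi> \<circ> fst\<close> and \<open>\<phi>_c \<circ> fst\<close> differ by the coboundary of \<open>log c\<close> of the group
  coordinate. So for every cylinder that ends in a fixed state of the Markov shift over \<open>I \<times> G\<close>, both
  \<open>m\<close> and \<open>\<nu>\<close> are, up to constants, given by \<open>exp (S_n \<phi> - n P)\<close>; for \<open>m\<close> there is the additional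
  factor \<open>c g\<close>, where \<open>g\<close> is the group coordinate of the initial point
  (\<open>quasi_conformal\<close>, \<open>m_nb_bounds\<close>, \<open>cylinder_bounds\<close>). Here \<open>P\<close> is also the pressure of the
  extension, because periodic points of the extension close up in \<open>G\<close> and do not see \<open>c\<close>, and
  conservativity forbids a smaller growth rate (\<open>ext_pressure_eq\<close>). If almost every orbit visits the
  fixed state infinitely often, then almost all of an open set is a disjoint union of such cylinders,
  and the estimate on cylinders becomes an inequality of measures (\<open>comparison\<close>). This
  argument is used again and again. Applied to a measure and its restriction to a set it shows that
  almost every orbit visits every state (\<open>visits_every_state\<close>), and that \<open>\<nu>\<close> is ergodic in the strong
  form \<open>zero_one\<close>; applied to \<open>m\<close> and \<open>\<nu>\<close> it gives \<open>m \<le> K c \<nu>\<close> (\<open>m_le_\<nu>\<close>).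

  Recurrence and ergodicity imply that every non-negative, finite function \<open>u\<close> that is superharmonic, in the sense
  that \<open>exp (-P)\<close> times its image under the transfer operator is at most \<open>u\<close>, is a multiple
  of \<open>h\<close> almost everywhere (\<open>superharmonic_unique\<close>). Three applications give most of the corollary.
  The density of the invariant measure \<open>m\<close> with respect to \<open>\<nu>\<close> is harmonic, so \<open>m\<close> is a multiple of
  \<open>h d\<nu>\<close> (\<open>m_eq_density\<close>) and \<open>h \<le> K c\<close> (\<open>h_le_c\<close>). Hence if \<open>h\<close> does not depend on \<open>G\<close>, then \<open>c\<close> is
  bounded away from \<open>0\<close> and therefore trivial; the same happens if \<open>\<nu>\<close> is a product, by \<open>m \<le> K c \<nu>\<close>.
  Conversely let \<open>c\<close> be trivial. A left translate of \<open>h\<close> is harmonic, hence a multiple of \<open>h\<close>, and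
  since \<open>h\<close> is now bounded, it equals \<open>h\<close>. So \<open>h\<close> does not depend on \<open>G\<close>, and \<open>\<nu>\<close>, having a constant
  multiple of \<open>1 / h\<close> as its density with respect to \<open>m\<close>, is a product; moreover \<open>m\<close>
  is the equilibrium measure, and \<open>P\<close> is the pressure of \<open>\<phi>\<close>. If the pressure of \<open>\<phi>\<close> is
  \<open>P\<close>, a limit of normalised Green functions is a superharmonic function that depends only on the base
  point (\<open>base_superharmonic\<close>), so along almost every fibre \<open>h\<close> is constant and \<open>c\<close> is trivial.
  Finally, if the equilibrium measure is the product of a Gibbs measure of \<open>\<phi>\<close> with counting measure,
  then that Gibbs measure is \<open>\<mu>\<close>, and comparing the two Gibbs properties bounds \<open>log c\<close> (\<open>c_trivial_of_gibbs\<close>).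
\<close>

section \<open>Distortion of Birkhoff sums\<close>

lemma left_shift_funpow: "(left_shift ^^ n) x k = x (n + k)"
  by (induction n arbitrary: x k) (simp_all add: left_shift_def funpow_swap1)

lemma left_shift_mshift: "x \<in> mshift I A \<Longrightarrow> left_shift x \<in> mshift I A"
  by (simp add: mshift_def left_shift_def)

lemma left_shift_funpow_mshift: "x \<in> mshift I A \<Longrightarrow> (left_shift ^^ n) x \<in> mshift I A"
  by (induction n) (simp_all add: left_shift_mshift)

lemma birkhoff_sum_0 [simp]: "birkhoff_sum 0 f x = 0"
  by (simp add: birkhoff_sum_def)

lemma birkhoff_sum_add:
  "birkhoff_sum (m + n) f x = birkhoff_sum m f x + birkhoff_sum n f ((left_shift ^^ m) x)"
proof -
  have "birkhoff_sum (m + n) f x = (\<Sum>k<m. f ((left_shift ^^ k) x)) + (\<Sum>k=m..<m+n. f ((left_shift ^^ k) x))"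
    unfolding birkhoff_sum_def lessThan_atLeast0
    by (rule sum.atLeastLessThan_concat[symmetric]) auto
  also have "(\<Sum>k=m..<m+n. f ((left_shift ^^ k) x)) = (\<Sum>k<n. f ((left_shift ^^ (k + m)) x))"
    using sum.shift_bounds_nat_ivl[of "\<lambda>k. f ((left_shift ^^ k) x)" 0 m n]
    by (simp add: lessThan_atLeast0 add.commute)
  finally show ?thesis
    by (simp add: birkhoff_sum_def funpow_add)
qed

lemma birkhoff_sum_Suc:
  "birkhoff_sum (Suc n) f x = f x + birkhoff_sum n f (left_shift x)"
  using birkhoff_sum_add[of 1 n f x] by (simp add: birkhoff_sum_def)

lemma birkhoff_sum_cong:
  assumes "\<And>x. x \<in> mshift I A \<Longrightarrow> f x = f' x" "x \<in> mshift I A"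
  shows "birkhoff_sum n f x = birkhoff_sum n f' x"
  unfolding birkhoff_sum_def using assms left_shift_funpow_mshift by (metis (no_types, lifting) sum.cong)

lemma common_length_ge:
  assumes "x \<noteq> y" "\<And>k. k < n \<Longrightarrow> x k = y k"
  shows "n \<le> common_length x y"
proof -
  obtain k where "x k \<noteq> y k" using assms(1) by auto
  then have "x (LEAST n. x n \<noteq> y n) \<noteq> y (LEAST n. x n \<noteq> y n)" by (rule LeastI)
  then show ?thesis unfolding common_length_def using assms(2) by (meson not_le)
qed

lemma hoelder_bound:
  assumes "hoelder_continuous I A f"
  obtains \<alpha> V :: real where "\<alpha> > 0" "V \<ge> 0"
    "\<And>n x y. x \<in> mshift I A \<Longrightarrow> y \<in> mshift I A \<Longrightarrow> (\<And>k. k < Suc n \<Longrightarrow> x k = y k) \<Longrightarrow>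
       \<bar>f x - f y\<bar> \<le> V * exp (- \<alpha> * real (Suc n))"
proof -
  obtain \<alpha> V where a: "\<alpha> > 0" and V: "\<forall>x\<in>mshift I A. \<forall>y\<in>mshift I A. x 0 = y 0 \<longrightarrow> x \<noteq> y \<longrightarrow>
        \<bar>f x - f y\<bar> \<le> V * exp (- \<alpha> * real (common_length x y))"
    using assms unfolding hoelder_continuous_def by blast
  have "\<bar>f x - f y\<bar> \<le> max V 0 * exp (- \<alpha> * real (Suc n))"
    if xy: "x \<in> mshift I A" "y \<in> mshift I A" "\<And>k. k < Suc n \<Longrightarrow> x k = y k" for x y n
  proof (cases "x = y")
    case False
    have "Suc n \<le> common_length x y" using common_length_ge False xy(3) by blast
    then have "exp (- \<alpha> * real (common_length x y)) \<le> exp (- \<alpha> * real (Suc n))"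
      using a by simp
    moreover have "\<bar>f x - f y\<bar> \<le> V * exp (- \<alpha> * real (common_length x y))"
      using V xy False by blast
    moreover have "\<dots> \<le> max V 0 * exp (- \<alpha> * real (common_length x y))"
      by (intro mult_right_mono) auto
    moreover have "\<dots> \<le> max V 0 * exp (- \<alpha> * real (Suc n))"
      using calculation(1) by (intro mult_left_mono) auto
    ultimately show ?thesis by linarith
  qed auto
  with a show ?thesis by (intro that[of \<alpha> "max V 0"]) auto
qed

text \<open>Two points that share their first \<open>n\<close> letters have \<open>k\<close>-th shifts sharing \<open>n - k\<close> letters, so
  the differences of the summands are dominated by a geometric series.\<close>

lemma bounded_distortion:
  assumes "hoelder_continuous I A f"
  obtains \<Delta> :: real where "\<Delta> \<ge> 0"
    "\<And>n x y. x \<in> mshift I A \<Longrightarrow> y \<in> mshift I A \<Longrightarrow> (\<And>k. k < n \<Longrightarrow> x k = y k) \<Longrightarrow>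
       \<bar>birkhoff_sum n f x - birkhoff_sum n f y\<bar> \<le> \<Delta>"
proof -
  obtain \<alpha> V :: real where a: "\<alpha> > 0" "V \<ge> 0"
    and V: "\<And>n x y. x \<in> mshift I A \<Longrightarrow> y \<in> mshift I A \<Longrightarrow> (\<And>k. k < Suc n \<Longrightarrow> x k = y k) \<Longrightarrow>
       \<bar>f x - f y\<bar> \<le> V * exp (- \<alpha> * real (Suc n))"
    using hoelder_bound[OF assms] by blast
  define r where "r = exp (- \<alpha>)"
  have r: "0 < r" "r < 1" using a by (auto simp: r_def)
  have pw: "exp (- \<alpha> * real n) = r ^ n" for n
    by (simp add: r_def exp_of_nat_mult[symmetric] mult.commute)
  have geo: "(\<Sum>k<n. r ^ Suc k) \<le> 1 / (1 - r)" for n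
  proof -
    have "(\<Sum>k<n. r ^ Suc k) \<le> (\<Sum>k<n. r ^ k)"
      using r by (intro sum_mono) (simp add: mult_left_le_one_le)
    also have "\<dots> \<le> 1 / (1 - r)"
      using r by (subst sum_gp_strict) (auto simp: divide_right_mono)
    finally show ?thesis .
  qed
  have main: "\<bar>birkhoff_sum n f x - birkhoff_sum n f y\<bar> \<le> V * (\<Sum>k<n. r ^ Suc k)"
    if "x \<in> mshift I A" "y \<in> mshift I A" "\<And>k. k < n \<Longrightarrow> x k = y k" for n x y
    using that
  proof (induction n arbitrary: x y)
    case (Suc n)
    have "\<bar>f x - f y\<bar> \<le> V * r ^ Suc n"
      using V[OF Suc.prems] unfolding pw by simp
    moreover have "\<bar>birkhoff_sum n f (left_shift x) - birkhoff_sum n f (left_shift y)\<bar> \<le> V * (\<Sum>k<n. r ^ Suc k)"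
      using Suc.prems by (intro Suc.IH left_shift_mshift) (auto simp: left_shift_def)
    ultimately show ?case by (simp add: birkhoff_sum_Suc distrib_left)
  qed auto
  have "\<bar>birkhoff_sum n f x - birkhoff_sum n f y\<bar> \<le> V * (1 / (1 - r))"
    if "x \<in> mshift I A" "y \<in> mshift I A" "\<And>k. k < n \<Longrightarrow> x k = y k" for n x y
    using main[OF that(1,2), of n] that(3) mult_left_mono[OF geo[of n] a(2)] by fastforce
  moreover have "V * (1 / (1 - r)) \<ge> 0" using a r by simp
  ultimately show ?thesis using that by blast
qed

section \<open>Symbolic dynamics of the group extension\<close>

locale group_extension =
  fixes I :: "nat set" and A :: "nat \<Rightarrow> nat \<Rightarrow> bool"
    and G :: "('g, 'm) monoid_scheme" (structure)
    and \<Psi> :: "nat list \<Rightarrow> 'g"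
  assumes group_G: "group G" and countable_G: "countable (carrier G)"
    and hom_\<Psi>: "semigroup_hom I G \<Psi>"
begin

sublocale G: group G by (rule group_G)

abbreviation "X \<equiv> ext_space I A G"
abbreviation "T \<equiv> ext_map G \<Psi>"
abbreviation "MX \<equiv> borel_of (ext_topology I A G)"

text \<open>The cylinder neighbourhoods of a point. In particular \<open>nb 1 s\<close> consists of the points that are in
  the same state, that is, have the same letter of \<open>I \<times> G\<close>, as \<open>s\<close>; a state is always represented by
  one of its points, and the orbit of \<open>p\<close> is in the state of \<open>s\<close> at time \<open>n\<close> if \<open>(T ^^ n) p \<in> nb 1 s\<close>.\<close>

definition nb :: "nat \<Rightarrow> (nat \<Rightarrow> nat) \<times> 'g \<Rightarrow> ((nat \<Rightarrow> nat) \<times> 'g) set" where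
  "nb n p = {q \<in> X. snd q = snd p \<and> (\<forall>k<n. fst q k = fst p k)}"

lemma \<Psi>_closed [simp]: "i \<in> I \<Longrightarrow> \<Psi> [i] \<in> carrier G"
  using hom_\<Psi> by (auto simp: semigroup_hom_def)

lemma in_X: "p \<in> X \<longleftrightarrow> fst p \<in> mshift I A \<and> snd p \<in> carrier G"
  by (auto simp: ext_space_def mem_Times_iff)

lemma letter_in_I: "p \<in> X \<Longrightarrow> fst p n \<in> I"
  by (auto simp: in_X mshift_def)

lemma T_X [simp]: "p \<in> X \<Longrightarrow> T p \<in> X"
  using letter_in_I[of p 0] by (simp add: in_X ext_map_def left_shift_mshift split_beta)

lemma fst_T: "fst (T p) = left_shift (fst p)"
  by (simp add: ext_map_def split_beta)

lemma snd_T: "snd (T p) = snd p \<otimes> \<Psi> [fst p 0]"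
  by (simp add: ext_map_def split_beta)

lemma Tn_X [simp]: "p \<in> X \<Longrightarrow> (T ^^ n) p \<in> X"
  by (induction n) auto

lemma fst_Tn: "fst ((T ^^ n) p) = (left_shift ^^ n) (fst p)"
  by (induction n) (auto simp: fst_T)

lemma fst_Tn_nth [simp]: "fst ((T ^^ n) p) k = fst p (n + k)"
  by (simp add: fst_Tn left_shift_funpow)

lemma nb_subset: "nb n p \<subseteq> X" by (auto simp: nb_def)

lemma nb_self [simp]: "p \<in> X \<Longrightarrow> p \<in> nb n p" by (auto simp: nb_def)

lemma nb_mono: "m \<le> n \<Longrightarrow> nb n p \<subseteq> nb m p" by (auto simp: nb_def)

lemma nb_eq: "q \<in> nb n p \<Longrightarrow> nb n q = nb n p" by (auto simp: nb_def)

lemma snd_Tn_cong: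
  assumes "snd q = snd p" "\<And>k. k < n \<Longrightarrow> fst q k = fst p k"
  shows "snd ((T ^^ n) q) = snd ((T ^^ n) p)"
  using assms(2) by (induction n) (auto simp: assms(1) snd_T)

lemma Tn_nb: "q \<in> nb (n + k) p \<Longrightarrow> (T ^^ n) q \<in> nb k ((T ^^ n) p)"
  unfolding nb_def using snd_Tn_cong[of q p n] by auto

lemma T_nb: "q \<in> nb (Suc n) p \<Longrightarrow> T q \<in> nb n (T p)"
  using Tn_nb[of q 1 n p] by simp

lemma nb_add: "q \<in> nb (n + k) p \<longleftrightarrow> q \<in> nb n p \<and> (T ^^ n) q \<in> nb k ((T ^^ n) p)"
proof
  assume "q \<in> nb (n + k) p"
  then show "q \<in> nb n p \<and> (T ^^ n) q \<in> nb k ((T ^^ n) p)"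
    using Tn_nb nb_mono[of n "n + k" p] by auto
next
  assume *: "q \<in> nb n p \<and> (T ^^ n) q \<in> nb k ((T ^^ n) p)"
  then have "fst q j = fst p j" if "j < n + k" for j
  proof (cases "j < n")
    case False
    have "j - n < k" using False that by simp
    then have "fst ((T ^^ n) q) (j - n) = fst ((T ^^ n) p) (j - n)"
      using * unfolding nb_def by blast
    then show ?thesis using False by simp
  qed (use * in \<open>auto simp: nb_def\<close>)
  then show "q \<in> nb (n + k) p" using * by (auto simp: nb_def)
qed

text \<open>The Markov property of the extension: what can follow depends on the current letter of \<open>I \<times> G\<close>
  alone.\<close>

lemma concatenate:
  assumes p: "p \<in> X" and r: "r \<in> nb 1 ((T ^^ n) p)"
  obtains q where "q \<in> nb (Suc n) p" "(T ^^ n) q = r"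
proof -
  define x where "x = (\<lambda>k. if k < n then fst p k else fst r (k - n))"
  define q where "q = (x, snd p)"
  have r0: "fst r 0 = fst p n" and rX: "r \<in> X" and sr: "snd r = snd ((T ^^ n) p)"
    using r by (auto simp: nb_def)
  have xk: "x k = fst p k" if "k \<le> n" for k
    using that r0 by (auto simp: x_def)
  have "x \<in> mshift I A"
    unfolding mshift_def
  proof (intro CollectI conjI allI)
    fix k
    show "x k \<in> I" using letter_in_I[OF p] letter_in_I[OF rX] by (auto simp: x_def)
    show "A (x k) (x (Suc k))"
    proof (cases "k < n")
      case True
      then show ?thesis using p xk[of k] xk[of "Suc k"] by (auto simp: in_X mshift_def)
    next
      case False
      then show ?thesis using rX by (auto simp: x_def in_X mshift_def Suc_diff_le)
    qed
  qed
  then have qX: "q \<in> X" using p by (auto simp: in_X q_def)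
  have q: "q \<in> nb (Suc n) p" using qX xk by (auto simp: nb_def q_def)
  have "fst ((T ^^ n) q) = fst r"
    by (rule ext) (simp add: q_def x_def)
  moreover have "snd ((T ^^ n) q) = snd r"
    using snd_Tn_cong[of q p n] xk sr by (simp add: q_def)
  ultimately show ?thesis using that q by (simp add: prod_eq_iff)
qed

text \<open>The inverse branches of \<open>T\<close>.\<close>

definition prepend :: "nat \<Rightarrow> (nat \<Rightarrow> nat) \<times> 'g \<Rightarrow> (nat \<Rightarrow> nat) \<times> 'g" where
  "prepend i p = (case_nat i (fst p), snd p \<otimes> inv (\<Psi> [i]))"

lemma fst_prepend [simp]: "fst (prepend i p) 0 = i" "fst (prepend i p) (Suc n) = fst p n"
  by (auto simp: prepend_def)

lemma prepend_X: "i \<in> I \<Longrightarrow> p \<in> X \<Longrightarrow> A i (fst p 0) \<Longrightarrow> prepend i p \<in> X"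
  by (auto simp: in_X prepend_def mshift_def split: nat.splits)

lemma T_prepend: "i \<in> I \<Longrightarrow> p \<in> X \<Longrightarrow> T (prepend i p) = p"
  by (auto simp: prod_eq_iff fst_T snd_T prepend_def left_shift_def in_X G.m_assoc)

lemma prepend_T: "p \<in> X \<Longrightarrow> prepend (fst p 0) (T p) = p"
  by (auto simp: prod_eq_iff prepend_def fst_T snd_T left_shift_def in_X G.m_assoc letter_in_I[of p]
       fun_eq_iff mshift_def split: nat.splits)

section \<open>The Borel structure\<close>

lemma openin_shift_topology:
  "openin (shift_topology I A) U \<longleftrightarrow>
     U \<subseteq> mshift I A \<and> (\<forall>x\<in>U. \<exists>n. \<forall>y\<in>mshift I A. (\<forall>k<n. y k = x k) \<longrightarrow> y \<in> U)"
proof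
  assume "openin (shift_topology I A) U"
  then obtain V where V: "openin (product_topology (\<lambda>_. discrete_topology I) UNIV) V" "U = V \<inter> mshift I A"
    by (auto simp: shift_topology_def openin_subtopology)
  have "\<exists>n. \<forall>y\<in>mshift I A. (\<forall>k<n. y k = x k) \<longrightarrow> y \<in> U" if "x \<in> U" for x
  proof -
    have "x \<in> V" using that V by auto
    then obtain B where B: "finite {i. B i \<noteq> I}" "x \<in> Pi\<^sub>E UNIV B" "Pi\<^sub>E UNIV B \<subseteq> V"
      using V(1) unfolding openin_product_topology_alt by auto
    obtain n where n: "\<And>i. B i \<noteq> I \<Longrightarrow> i < n"
      using B(1) finite_nat_set_iff_bounded by (metis (mono_tags, lifting) mem_Collect_eq)
    have "y \<in> U" if y: "y \<in> mshift I A" "\<forall>k<n. y k = x k" for y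
    proof -
      have "y i \<in> B i" for i
        using y n[of i] B(2) by (cases "B i = I") (auto simp: mshift_def PiE_iff)
      then show ?thesis using B(3) V y by (auto simp: PiE_iff)
    qed
    then show ?thesis by blast
  qed
  then show "U \<subseteq> mshift I A \<and> (\<forall>x\<in>U. \<exists>n. \<forall>y\<in>mshift I A. (\<forall>k<n. y k = x k) \<longrightarrow> y \<in> U)"
    using V by auto
next
  assume U: "U \<subseteq> mshift I A \<and> (\<forall>x\<in>U. \<exists>n. \<forall>y\<in>mshift I A. (\<forall>k<n. y k = x k) \<longrightarrow> y \<in> U)"
  then obtain n where n: "\<And>x y. x \<in> U \<Longrightarrow> y \<in> mshift I A \<Longrightarrow> (\<forall>k<n x. y k = x k) \<Longrightarrow> y \<in> U" by metis
  define C where "C x = Pi\<^sub>E UNIV (\<lambda>k. if k < n x then {x k} else I)" for x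
  have "openin (product_topology (\<lambda>_. discrete_topology I) UNIV) (C x)" if "x \<in> U" for x
    unfolding C_def using that U
    by (subst openin_PiE_gen) (auto simp: mshift_def intro!: finite_subset[of _ "{..<n x}"])
  then have "openin (product_topology (\<lambda>_. discrete_topology I) UNIV) (\<Union>x\<in>U. C x)" by blast
  moreover have "U = (\<Union>x\<in>U. C x) \<inter> mshift I A"
  proof (intro subset_antisym subsetI)
    fix x assume "x \<in> U"
    then show "x \<in> (\<Union>x\<in>U. C x) \<inter> mshift I A" using U
      by (auto simp: C_def PiE_iff mshift_def intro!: bexI[of _ x])
  next
    fix y assume "y \<in> (\<Union>x\<in>U. C x) \<inter> mshift I A"
    then obtain x where x: "x \<in> U" "y \<in> C x" "y \<in> mshift I A" by auto
    have "y k = x k" if "k < n x" for k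
      using x(2) that by (auto simp: C_def PiE_iff dest!: spec[of _ k])
    then show "y \<in> U" using n[OF x(1) x(3)] by auto
  qed
  ultimately show "openin (shift_topology I A) U"
    unfolding shift_topology_def openin_subtopology by blast
qed

text \<open>The sets \<open>nb n p\<close> form a base of the topology. It is countable, so the Borel sets are generated by
  it, and functions that are locally constant or continuous along it are measurable.\<close>

lemma openin_ext_topology:
  "openin (ext_topology I A G) U \<longleftrightarrow> U \<subseteq> X \<and> (\<forall>p\<in>U. \<exists>n. nb n p \<subseteq> U)"
proof
  assume U: "openin (ext_topology I A G) U"
  have "topspace (shift_topology I A) = mshift I A"
    by (auto simp: shift_topology_def PiE_iff mshift_def)
  then have "U \<subseteq> X"
    using openin_subset[OF U] by (simp add: ext_topology_def ext_space_def)
  moreover have "\<exists>n. nb n p \<subseteq> U" if "p \<in> U" for p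
  proof -
    have "\<forall>x y. (x, y) \<in> U \<longrightarrow> (\<exists>V W. openin (shift_topology I A) V \<and>
        openin (discrete_topology (carrier G)) W \<and> x \<in> V \<and> y \<in> W \<and> V \<times> W \<subseteq> U)"
      using U unfolding ext_topology_def openin_prod_topology_alt .
    moreover have "(fst p, snd p) \<in> U" using that by simp
    ultimately obtain V W where V: "openin (shift_topology I A) V" "fst p \<in> V" "snd p \<in> W" "V \<times> W \<subseteq> U"
      by metis
    then obtain n where "\<forall>y\<in>mshift I A. (\<forall>k<n. y k = fst p k) \<longrightarrow> y \<in> V"
      unfolding openin_shift_topology by blast
    then have "nb n p \<subseteq> V \<times> W" using V by (auto simp: nb_def in_X)
    then show ?thesis using V by blast
  qed
  ultimately show "U \<subseteq> X \<and> (\<forall>p\<in>U. \<exists>n. nb n p \<subseteq> U)" by blast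
next
  assume U: "U \<subseteq> X \<and> (\<forall>p\<in>U. \<exists>n. nb n p \<subseteq> U)"
  show "openin (ext_topology I A G) U"
    unfolding ext_topology_def openin_prod_topology_alt
  proof (intro allI impI)
    fix x g assume p: "(x, g) \<in> U"
    then obtain n where n: "nb n (x, g) \<subseteq> U" using U by blast
    define V where "V = {y \<in> mshift I A. \<forall>k<n. y k = x k}"
    have "openin (shift_topology I A) V"
      unfolding openin_shift_topology V_def by (auto intro!: exI[of _ n])
    moreover have "openin (discrete_topology (carrier G)) {g}" using U p by (auto simp: in_X)
    moreover have "V \<times> {g} \<subseteq> U" using n by (rule subset_trans[rotated]) (use U p in \<open>auto simp: nb_def V_def in_X\<close>)
    moreover have "x \<in> V" using U p by (auto simp: in_X V_def)
    ultimately show "\<exists>V W. openin (shift_topology I A) V \<and> openin (discrete_topology (carrier G)) W \<and> x \<in> V \<and> g \<in> W \<and> V \<times> W \<subseteq> U"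
      by blast
  qed
qed

lemma topspace_ext [simp]: "topspace (ext_topology I A G) = X"
  by (rule subset_antisym; metis openin_ext_topology openin_subset openin_topspace nb_subset subset_refl)

lemma sets_borel_of: "sets (borel_of Y) = sigma_sets (topspace Y) {U. openin Y U}"
  unfolding borel_of_def by (intro sets_measure_of) (auto dest: openin_subset)

lemma space_borel_of [simp]: "space (borel_of Y) = topspace Y"
  unfolding borel_of_def by (intro space_measure_of) (auto dest: openin_subset)

lemma open_sets_MX: "U \<subseteq> X \<Longrightarrow> (\<And>p. p \<in> U \<Longrightarrow> \<exists>n. nb n p \<subseteq> U) \<Longrightarrow> U \<in> sets MX"
  unfolding sets_borel_of by (intro sigma_sets.Basic) (auto simp: openin_ext_topology)

lemma nb_sets [measurable]: "nb n p \<in> sets MX"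
  by (rule open_sets_MX[OF nb_subset]) (use nb_eq in blast)

lemma countable_nbs: "countable {nb n p |n p. p \<in> X}"
proof -
  let ?F = "\<lambda>(v, g). {q \<in> X. snd q = g \<and> (\<forall>k<length v. fst q k = v ! k)}"
  have "{nb n p |n p. p \<in> X} \<subseteq> ?F ` ((UNIV :: nat list set) \<times> carrier G)"
  proof clarify
    fix n p assume p: "p \<in> X"
    show "nb n p \<in> ?F ` ((UNIV :: nat list set) \<times> carrier G)"
      by (rule image_eqI[of _ _ "(map (fst p) [0..<n], snd p)"]) (use p in \<open>auto simp: nb_def in_X\<close>)
  qed
  moreover have "countable (?F ` ((UNIV :: nat list set) \<times> carrier G))"
    using countable_G by blast
  ultimately show ?thesis by (rule countable_subset)
qed

lemma sets_MX_nb: "sets MX = sigma_sets X {nb (Suc n) p |n p. p \<in> X}" (is "_ = sigma_sets X ?N")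
proof
  have "U \<in> sigma_sets X ?N" if "openin (ext_topology I A G) U" for U
  proof -
    have U: "U \<subseteq> X" "\<forall>p\<in>U. \<exists>n. nb n p \<subseteq> U" using that unfolding openin_ext_topology by auto
    have "U = \<Union> {B \<in> ?N. B \<subseteq> U}"
    proof (intro subset_antisym subsetI)
      fix p assume p: "p \<in> U"
      then obtain n where n: "nb n p \<subseteq> U" using U by auto
      have "p \<in> X" using p U by blast
      moreover have "nb (Suc n) p \<subseteq> U" using n nb_mono[of n "Suc n" p] by simp
      ultimately show "p \<in> \<Union> {B \<in> ?N. B \<subseteq> U}" by (intro UnionI[of "nb (Suc n) p"] CollectI conjI nb_self) blast+
    qed auto
    moreover have "countable {B \<in> ?N. B \<subseteq> U}"
      by (rule countable_subset[OF _ countable_nbs]) auto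
    moreover have "\<Union> {B \<in> ?N. B \<subseteq> U} \<in> sigma_sets X ?N"
      by (rule sigma_sets_UNION[OF calculation(2)]) (auto intro: sigma_sets.Basic)
    ultimately show ?thesis by simp
  qed
  then show "sets MX \<subseteq> sigma_sets X ?N"
    unfolding sets_borel_of topspace_ext by (intro sigma_sets_mono) auto
  have "?N \<subseteq> sets MX" using nb_sets by blast
  then show "sigma_sets X ?N \<subseteq> sets MX"
    using sets.sigma_sets_subset[of ?N MX] by simp
qed

lemma measurable_T [measurable]: "T \<in> measurable MX MX"
proof (rule measurable_sigma_sets[OF sets_MX_nb])
  show "{nb (Suc n) p |n p. p \<in> X} \<subseteq> Pow X" using nb_subset by auto
  show "T \<in> space MX \<rightarrow> X" by auto
  fix B assume "B \<in> {nb (Suc n) p |n p. p \<in> X}"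
  then obtain n p where B: "B = nb (Suc n) p" "p \<in> X" by auto
  show "T -` B \<inter> space MX \<in> sets MX"
  proof (rule open_sets_MX)
    fix q assume q: "q \<in> T -` B \<inter> space MX"
    then have "nb (Suc (Suc n)) q \<subseteq> T -` B \<inter> space MX"
      using T_nb[of _ "Suc n" q] nb_eq[of "T q" "Suc n" p] nb_subset by (auto simp: B)
    then show "\<exists>n. nb n q \<subseteq> T -` B \<inter> space MX" by blast
  qed auto
qed

lemma measurable_Tn [measurable]: "(T ^^ n) \<in> measurable MX MX"
  by (rule measurable_compose_n) (rule measurable_T)

lemma measurable_locally:
  fixes f :: "(nat \<Rightarrow> nat) \<times> 'g \<Rightarrow> 'b"
  assumes "\<And>p. p \<in> X \<Longrightarrow> \<exists>n. \<forall>q\<in>nb n p. f q = f p"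
  shows "f \<in> measurable MX (count_space UNIV)"
proof (rule measurableI)
  fix B :: "'b set"
  show "f -` B \<inter> space MX \<in> sets MX"
  proof (rule open_sets_MX)
    fix p assume p: "p \<in> f -` B \<inter> space MX"
    then obtain n where n: "\<forall>q\<in>nb n p. f q = f p" using assms[of p] by auto
    then have "nb n p \<subseteq> f -` B \<inter> space MX" using p nb_subset[of n p] by auto
    then show "\<exists>n. nb n p \<subseteq> f -` B \<inter> space MX" by blast
  qed auto
qed auto

lemma measurable_letter [measurable]: "(\<lambda>p. fst p n) \<in> measurable MX (count_space UNIV)"
  by (rule measurable_locally) (auto simp: nb_def intro!: exI[of _ "Suc n"])

lemma measurable_snd' [measurable]: "snd \<in> measurable MX (count_space UNIV)"
  by (rule measurable_locally) (auto simp: nb_def)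

lemma continuous_measurable:
  fixes f :: "(nat \<Rightarrow> nat) \<times> 'g \<Rightarrow> real"
  assumes "\<And>p e. p \<in> X \<Longrightarrow> e > 0 \<Longrightarrow> \<exists>n. \<forall>q\<in>nb n p. \<bar>f q - f p\<bar> < e"
  shows "f \<in> borel_measurable MX"
proof (rule borel_measurableI)
  fix S :: "real set" assume S: "open S"
  show "f -` S \<inter> space MX \<in> sets MX"
  proof (rule open_sets_MX)
    fix p assume p: "p \<in> f -` S \<inter> space MX"
    then obtain e where e: "e > 0" "\<And>y. dist y (f p) < e \<Longrightarrow> y \<in> S"
      using S unfolding open_dist by auto
    then obtain n where n: "\<forall>q\<in>nb n p. \<bar>f q - f p\<bar> < e" using assms[of p e] p by auto
    then have "nb n p \<subseteq> f -` S \<inter> space MX" using nb_subset[of n p] e(2) by (auto simp: dist_real_def)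
    then show "\<exists>n. nb n p \<subseteq> f -` S \<inter> space MX" by blast
  qed auto
qed

end

section \<open>Comparison of measures along returns to a state\<close>

context group_extension
begin

lemma nb_Suc_step: "q \<in> nb (Suc n) p \<Longrightarrow> m \<le> n \<Longrightarrow> (T ^^ m) q \<in> nb 1 ((T ^^ m) p)"
  using Tn_nb[of q m 1 p] nb_mono[of "m + 1" "Suc n" p] by auto

lemma nb_sym: "p \<in> X \<Longrightarrow> q \<in> nb n p \<Longrightarrow> p \<in> nb n q"
  by (auto simp: nb_def)

lemma nb_Suc_visit:
  assumes "p \<in> X" "q \<in> nb (Suc n) p" "m \<le> n"
  shows "(T ^^ m) q \<in> nb 1 s \<longleftrightarrow> (T ^^ m) p \<in> nb 1 s"
proof -
  have *: "(T ^^ m) q \<in> nb 1 ((T ^^ m) p)" using assms by (intro nb_Suc_step)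
  have "(T ^^ m) p \<in> nb 1 ((T ^^ m) q)" using nb_sym[OF Tn_X[OF assms(1)] *] .
  with * show ?thesis using nb_eq[of "(T ^^ m) q" 1 s] nb_eq[of "(T ^^ m) p" 1 s] by metis
qed

text \<open>A set that is cut into cylinders by a stopping rule \<open>d\<close> inherits an inequality between two measures
  from the cylinders: there are only countably many of them, and two of them are equal or disjoint.\<close>

lemma nb_partition_le:
  fixes K :: ennreal
  assumes M: "sets \<theta>\<^sub>1 = sets MX" "sets \<theta>\<^sub>2 = sets MX" and V: "V \<subseteq> X"
    and d: "\<And>p q. p \<in> V \<Longrightarrow> q \<in> nb (d p) p \<Longrightarrow> q \<in> V \<and> d q = d p"
    and le: "\<And>p. p \<in> V \<Longrightarrow> emeasure \<theta>\<^sub>1 (nb (d p) p) \<le> K * emeasure \<theta>\<^sub>2 (nb (d p) p)"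
  shows "emeasure \<theta>\<^sub>1 V \<le> K * emeasure \<theta>\<^sub>2 V"
proof -
  define D where "D = (\<lambda>p. nb (d p) p) ` V"
  have eq: "V = (\<Union>B\<in>D. B)"
  proof (intro subset_antisym subsetI)
    fix p assume "p \<in> V"
    then show "p \<in> (\<Union>B\<in>D. B)" using V by (auto simp: D_def intro!: bexI[of _ p] nb_self)
  next
    fix z assume "z \<in> (\<Union>B\<in>D. B)"
    then obtain p where "p \<in> V" "z \<in> nb (d p) p" by (auto simp: D_def)
    then show "z \<in> V" using d by blast
  qed
  have "D \<subseteq> {nb n p |n p. p \<in> X}" using V by (auto simp: D_def)
  then have cnt: "countable D" by (rule countable_subset) (rule countable_nbs)
  have self: "B = nb (d z) z" if B: "B \<in> D" "z \<in> B" for B z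
  proof -
    obtain p where p: "p \<in> V" "B = nb (d p) p" using B(1) unfolding D_def by blast
    then show ?thesis using d[OF p(1), of z] nb_eq[of z "d p" p] B(2) by metis
  qed
  then have disj: "disjoint_family_on (\<lambda>B. B) D" unfolding disjoint_family_on_def by blast
  have D: "B \<in> sets MX" if "B \<in> D" for B using that by (auto simp: D_def)
  have "emeasure \<theta>\<^sub>1 (\<Union>B\<in>D. B) = (\<integral>\<^sup>+B. emeasure \<theta>\<^sub>1 B \<partial>count_space D)"
    using D M by (intro emeasure_UN_countable cnt disj) auto
  also have "\<dots> \<le> (\<integral>\<^sup>+B. K * emeasure \<theta>\<^sub>2 B \<partial>count_space D)"
    using le by (intro nn_integral_mono) (auto simp: D_def)
  also have "\<dots> = K * (\<integral>\<^sup>+B. emeasure \<theta>\<^sub>2 B \<partial>count_space D)"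
    by (rule nn_integral_cmult) auto
  also have "(\<integral>\<^sup>+B. emeasure \<theta>\<^sub>2 B \<partial>count_space D) = emeasure \<theta>\<^sub>2 (\<Union>B\<in>D. B)"
    using D M by (intro emeasure_UN_countable[symmetric] cnt disj) auto
  finally show ?thesis unfolding eq[symmetric] .
qed

abbreviation "opn \<equiv> openin (ext_topology I A G)"

lemma opn_sets: "opn U \<Longrightarrow> U \<in> sets MX"
  using openin_ext_topology by (intro open_sets_MX) blast+

lemma opn_nb: "opn (nb n p)"
  unfolding openin_ext_topology using nb_subset nb_eq by blast

lemma openin_Union_image: "(\<And>i. i \<in> J \<Longrightarrow> opn (U i)) \<Longrightarrow> opn (\<Union>i\<in>J. U i)"
  by (rule openin_Union) blast

lemma opn_Diff_nb: "opn U \<Longrightarrow> opn (U - nb n p)"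
  unfolding openin_ext_topology
proof (intro conjI ballI)
  assume U: "U \<subseteq> X \<and> (\<forall>p\<in>U. \<exists>n. nb n p \<subseteq> U)"
  show "U - nb n p \<subseteq> X" using U by auto
  fix q assume q: "q \<in> U - nb n p"
  then obtain m where m: "nb m q \<subseteq> U" using U by blast
  have "nb n q \<inter> nb n p = {}" using q U nb_eq[of _ n p] nb_eq[of _ n q] nb_self[of q n] by blast
  then have "nb (max m n) q \<subseteq> U - nb n p"
    using m nb_mono[of m "max m n" q] nb_mono[of n "max m n" q] by auto
  then show "\<exists>m. nb m q \<subseteq> U - nb n p" by blast
qed

text \<open>The sets that can be approximated from outside by open sets, together with their complements,
  form a \<open>\<sigma>\<close>-algebra; the pair \<open>U\<close>, \<open>V\<close> of open covers makes the condition symmetric under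
  complementation.\<close>

lemma open_approximation:
  assumes M: "sets \<theta> = sets MX" and F: "opn F" "emeasure \<theta> F < \<infinity>" and E: "E \<in> sets MX" and e: "(e::real) > 0"
  shows "\<exists>U V. opn U \<and> opn V \<and> E \<inter> F \<subseteq> U \<and> U \<subseteq> F \<and> F - E \<subseteq> V \<and> V \<subseteq> F \<and> emeasure \<theta> (U \<inter> V) < ennreal e"
  using E[unfolded sets_MX_nb] e
proof (induction E arbitrary: e rule: sigma_sets.induct)
  case (Basic B)
  then obtain n p where B: "B = nb n p" by auto
  have e0: "B \<inter> F \<inter> (F - B) = {}" by auto
  have "opn (B \<inter> F)" "opn (F - B)" using F by (auto simp: B opn_Diff_nb openin_Int opn_nb)
  then show ?case using Basic(2) by (intro exI[of _ "B \<inter> F"] exI[of _ "F - B"]) (auto simp: e0)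
next
  case Empty
  then show ?case using F by (intro exI[of _ "{}"] exI[of _ F]) (auto simp: openin_ext_topology)
next
  case (Compl E)
  obtain U V where "opn U" "opn V" "E \<inter> F \<subseteq> U" "U \<subseteq> F" "F - E \<subseteq> V" "V \<subseteq> F" "emeasure \<theta> (U \<inter> V) < ennreal e"
    using Compl.IH[OF Compl.prems] by blast
  then show ?case using F by (intro exI[of _ V] exI[of _ U]) (auto simp: Int_commute openin_ext_topology)
next
  case (Union E)
  define c where "c i = e / 2 * (1 / 2) ^ Suc i" for i :: nat
  have c: "c i > 0" for i using \<open>e > 0\<close> by (simp add: c_def)
  have "\<exists>U V. opn U \<and> opn V \<and> E i \<inter> F \<subseteq> U \<and> U \<subseteq> F \<and> F - E i \<subseteq> V \<and> V \<subseteq> F \<and> emeasure \<theta> (U \<inter> V) < ennreal (c i)" for i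
    using Union.IH[OF c] .
  then obtain U V where UV: "\<And>i. opn (U i)" "\<And>i. opn (V i)" "\<And>i. E i \<inter> F \<subseteq> U i" "\<And>i. U i \<subseteq> F"
    "\<And>i. F - E i \<subseteq> V i" "\<And>i. V i \<subseteq> F" "\<And>i. emeasure \<theta> (U i \<inter> V i) < ennreal (c i)"
    by metis
  have sb: "sets \<theta> = sets MX" by (rule M)
  define R where "R N = (\<Union>i. U i) - (\<Union>i<N. U i)" for N :: nat
  have Us: "U i \<in> sets MX" "V i \<in> sets MX" for i by (rule opn_sets[OF UV(1)] opn_sets[OF UV(2)])+
  have Rs: "R N \<in> sets \<theta>" for N
    unfolding R_def sb by (intro sets.Diff sets.countable_UN' image_subsetI Us) auto
  have "(\<lambda>N. emeasure \<theta> (R N)) \<longlonglongrightarrow> emeasure \<theta> (\<Inter>N. R N)"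
  proof (rule Lim_emeasure_decseq)
    show "range R \<subseteq> sets \<theta>" using Rs by blast
    show "decseq R" unfolding R_def by (rule decseq_SucI) (simp add: lessThan_Suc Diff_mono)
    fix N
    have "emeasure \<theta> (R N) \<le> emeasure \<theta> F"
      using UV(4) opn_sets[OF F(1)] unfolding R_def sb[symmetric] by (intro emeasure_mono) blast+
    then show "emeasure \<theta> (R N) \<noteq> \<infinity>" using F(2) by auto
  qed
  moreover have "(\<Inter>N. R N) = {}" by (auto simp: R_def)
  ultimately have "(\<lambda>N. emeasure \<theta> (R N)) \<longlonglongrightarrow> 0" by simp
  then have "\<forall>\<^sub>F N in sequentially. emeasure \<theta> (R N) < ennreal (e / 2)"
    using \<open>e > 0\<close> by (intro order_tendstoD(2)) auto
  then obtain N where N: "emeasure \<theta> (R N) < ennreal (e / 2)"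
    by (auto simp: eventually_sequentially)
  define UU where "UU = (\<Union>i. U i)"
  define VV where "VV = F \<inter> (\<Inter>i<N. V i)"
  have VVo: "opn (F \<inter> (\<Inter>i<n. V i))" for n
  proof (induction n)
    case (Suc n)
    then have "opn ((F \<inter> (\<Inter>i<n. V i)) \<inter> V n)" by (rule openin_Int) (rule UV)
    moreover have "(F \<inter> (\<Inter>i<n. V i)) \<inter> V n = F \<inter> (\<Inter>i<Suc n. V i)" by (auto simp: lessThan_Suc)
    ultimately show ?case by simp
  qed (use F in auto)
  have UUo: "opn UU" unfolding UU_def by (rule openin_Union_image) (rule UV)
  have UVs: "U i \<inter> V i \<in> sets \<theta>" for i unfolding sb using Us by (rule sets.Int)
  have UVs': "(\<Union>i. U i \<inter> V i) \<in> sets \<theta>" by (intro sets.countable_UN image_subsetI UVs)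
  have "UU \<inter> VV \<subseteq> (\<Union>i. U i \<inter> V i) \<union> R N" unfolding UU_def VV_def R_def by blast
  then have "emeasure \<theta> (UU \<inter> VV) \<le> emeasure \<theta> ((\<Union>i. U i \<inter> V i) \<union> R N)"
    using UVs' Rs by (intro emeasure_mono sets.Un)
  also have "\<dots> \<le> emeasure \<theta> (\<Union>i. U i \<inter> V i) + emeasure \<theta> (R N)"
    using UVs' Rs by (intro emeasure_subadditive)
  also have "emeasure \<theta> (\<Union>i. U i \<inter> V i) \<le> (\<Sum>i. emeasure \<theta> (U i \<inter> V i))"
    using UVs by (intro emeasure_subadditive_countably image_subsetI)
  also have "\<dots> \<le> (\<Sum>i. ennreal (c i))"
    using UV(7) by (intro suminf_le) (auto intro: less_imp_le)
  also have "\<dots> = ennreal (e / 2)"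
  proof (rule suminf_ennreal_eq)
    show "c sums (e / 2)" unfolding c_def using sums_mult[OF power_half_series, of "e / 2"] by simp
  qed (use c in \<open>auto intro: less_imp_le\<close>)
  finally have "emeasure \<theta> (UU \<inter> VV) \<le> ennreal (e / 2) + emeasure \<theta> (R N)" by (simp add: add_right_mono)
  also have "\<dots> < ennreal (e / 2) + ennreal (e / 2)"
    using N by (intro ennreal_add_left_cancel_less[THEN iffD2]) auto
  also have "\<dots> = ennreal e" using \<open>e > 0\<close> by (subst ennreal_plus[symmetric]) auto
  finally have fin: "emeasure \<theta> (UU \<inter> VV) < ennreal e" .
  have 1: "(\<Union>i. E i) \<inter> F \<subseteq> UU" unfolding UU_def using UV(3) by blast
  have 2: "UU \<subseteq> F" unfolding UU_def using UV(4) by blast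
  have 3: "F - (\<Union>i. E i) \<subseteq> VV" unfolding VV_def using UV(5) by blast
  have 4: "VV \<subseteq> F" unfolding VV_def by blast
  have 5: "opn VV" unfolding VV_def by (rule VVo)
  show ?case using 1 2 3 4 5 UUo fin by blast
qed

lemma outer_regular_MX:
  assumes M: "sets \<theta> = sets MX" and F: "opn F" "emeasure \<theta> F < \<infinity>" and E: "E \<in> sets MX" "E \<subseteq> F" and e: "(e::real) > 0"
  obtains U where "opn U" "E \<subseteq> U" "U \<subseteq> F" "emeasure \<theta> U \<le> emeasure \<theta> E + ennreal e"
proof -
  obtain U V where U: "opn U" "opn V" "E \<inter> F \<subseteq> U" "U \<subseteq> F" "F - E \<subseteq> V" "V \<subseteq> F" "emeasure \<theta> (U \<inter> V) < ennreal e"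
    using open_approximation[OF M F E(1) e] by blast
  note [measurable] = opn_sets[OF U(1)] opn_sets[OF U(2)] E(1)
  have "emeasure \<theta> U \<le> emeasure \<theta> (E \<union> (U \<inter> V))"
    using U E M by (intro emeasure_mono) auto
  also have "\<dots> \<le> emeasure \<theta> E + emeasure \<theta> (U \<inter> V)"
    using M by (intro emeasure_subadditive) auto
  also have "\<dots> \<le> emeasure \<theta> E + ennreal e" using U(7) by (intro add_left_mono) auto
  finally show ?thesis using that[of U] U E by blast
qed

text \<open>Up to a null set, an open set is the disjoint union of its maximal subcylinders that end in the
  recurrent state \<open>s\<close>; on those the measures are comparable, and outer regularity passes from open
  sets to Borel sets.\<close>

lemma comparison:
  fixes K :: real
  assumes M: "sets \<theta>\<^sub>1 = sets MX" "sets \<theta>\<^sub>2 = sets MX" and K: "K > 0"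
    and fin: "emeasure \<theta>\<^sub>2 (nb 1 r) < \<infinity>"
    and le: "\<And>p n. p \<in> nb 1 r \<Longrightarrow> (T ^^ n) p \<in> nb 1 s \<Longrightarrow>
      emeasure \<theta>\<^sub>1 (nb (Suc n) p) \<le> ennreal K * emeasure \<theta>\<^sub>2 (nb (Suc n) p)"
    and ae: "AE p in \<theta>\<^sub>1. p \<in> nb 1 r \<longrightarrow> (\<exists>\<^sub>\<infinity>n. (T ^^ n) p \<in> nb 1 s)"
    and E: "E \<in> sets MX" "E \<subseteq> nb 1 r"
  shows "emeasure \<theta>\<^sub>1 E \<le> ennreal K * emeasure \<theta>\<^sub>2 E"
proof -
  have opn_le: "emeasure \<theta>\<^sub>1 U \<le> ennreal K * emeasure \<theta>\<^sub>2 U" if U: "opn U" "U \<subseteq> nb 1 r" for U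
  proof -
    define Q where "Q p n \<longleftrightarrow> (T ^^ n) p \<in> nb 1 s \<and> nb (Suc n) p \<subseteq> U" for p n
    define V where "V = {p \<in> U. \<exists>n. Q p n}"
    define d where "d p = Suc (LEAST n. Q p n)" for p
    have VX: "V \<subseteq> X" using U by (auto simp: V_def openin_ext_topology)
    have QQ: "Q q m \<longleftrightarrow> Q p m" if pX: "p \<in> X" and that: "q \<in> nb (Suc n) p" "m \<le> n" for p q m n
    proof -
      have "nb (Suc m) q = nb (Suc m) p"
        using that nb_mono[of "Suc m" "Suc n" p] by (intro nb_eq) auto
      then show ?thesis unfolding Q_def using nb_Suc_visit[OF pX that] by simp
    qed
    have step: "q \<in> V \<and> d q = d p" if p: "p \<in> V" and q: "q \<in> nb (d p) p" for p q
    proof -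
      define n where "n = (LEAST n. Q p n)"
      have n: "Q p n" unfolding n_def using p by (auto simp: V_def intro: LeastI)
      have least: "\<not> Q p m" if "m < n" for m using that not_less_Least unfolding n_def by blast
      have q': "q \<in> nb (Suc n) p" using q by (simp add: d_def n_def)
      have pX: "p \<in> X" using p VX by auto
      have Qn: "Q q n" using QQ[OF pX q'] n by simp
      have "(LEAST n. Q q n) = n"
      proof (rule Least_equality)
        fix y assume "Q q y"
        then show "n \<le> y" using least QQ[OF pX q', of y] by (meson not_le less_imp_le)
      qed (rule Qn)
      moreover have "q \<in> U" using n q' by (auto simp: Q_def)
      ultimately show ?thesis using Qn by (auto simp: V_def d_def n_def)
    qed
    have "V = (\<Union>p\<in>V. nb (d p) p)" using step VX nb_self by blast
    then have "opn V" using openin_Union_image[of V "\<lambda>p. nb (d p) p"] opn_nb by metis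
    then have Vs: "V \<in> sets MX" by (rule opn_sets)
    have "AE p in \<theta>\<^sub>1. p \<in> U \<longrightarrow> p \<in> V"
      using ae
    proof eventually_elim
      case (elim p)
      show ?case
      proof
        assume p: "p \<in> U"
        then obtain m where m: "nb m p \<subseteq> U" using U by (auto simp: openin_ext_topology)
        have "\<exists>\<^sub>\<infinity>n. (T ^^ n) p \<in> nb 1 s" using elim p U by auto
        then obtain n where n: "n > m" "(T ^^ n) p \<in> nb 1 s" by (auto simp: INFM_nat)
        have "nb (Suc n) p \<subseteq> U" using m nb_mono[of m "Suc n" p] n by auto
        then show "p \<in> V" using n p by (auto simp: V_def Q_def)
      qed
    qed
    then have "emeasure \<theta>\<^sub>1 U \<le> emeasure \<theta>\<^sub>1 V" using Vs M by (intro emeasure_mono_AE) auto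
    also have "\<dots> \<le> ennreal K * emeasure \<theta>\<^sub>2 V"
    proof (rule nb_partition_le[OF M VX, of d])
      fix p assume p: "p \<in> V"
      define n where "n = (LEAST n. Q p n)"
      have n: "Q p n" unfolding n_def using p by (auto simp: V_def intro: LeastI)
      show "emeasure \<theta>\<^sub>1 (nb (d p) p) \<le> ennreal K * emeasure \<theta>\<^sub>2 (nb (d p) p)"
        unfolding d_def n_def[symmetric] using n p U by (intro le) (auto simp: Q_def V_def)
    qed (use step in blast)
    also have "\<dots> \<le> ennreal K * emeasure \<theta>\<^sub>2 U"
      using opn_sets[OF U(1)] M by (intro mult_left_mono emeasure_mono) (auto simp: V_def)
    finally show ?thesis .
  qed
  show ?thesis
  proof (rule ennreal_le_epsilon)
    fix e :: real assume e: "e > 0"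
    obtain U where U: "opn U" "E \<subseteq> U" "U \<subseteq> nb 1 r" "emeasure \<theta>\<^sub>2 U \<le> emeasure \<theta>\<^sub>2 E + ennreal (e / K)"
      using outer_regular_MX[OF M(2) opn_nb fin E, of "e / K"] e K by auto
    have "emeasure \<theta>\<^sub>1 E \<le> emeasure \<theta>\<^sub>1 U" using U opn_sets[OF U(1)] M by (intro emeasure_mono) auto
    also have "\<dots> \<le> ennreal K * emeasure \<theta>\<^sub>2 U" using U by (intro opn_le)
    also have "\<dots> \<le> ennreal K * (emeasure \<theta>\<^sub>2 E + ennreal (e / K))" using U by (intro mult_left_mono) auto
    also have "\<dots> = ennreal K * emeasure \<theta>\<^sub>2 E + ennreal e"
      using e K by (simp add: distrib_left ennreal_mult'[symmetric])
    finally show "emeasure \<theta>\<^sub>1 E \<le> ennreal K * emeasure \<theta>\<^sub>2 E + ennreal e" .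
  qed
qed

lemma AE_states:
  assumes M: "sets \<theta> = sets MX" and "\<And>s. s \<in> X \<Longrightarrow> AE p in \<theta>. p \<in> nb 1 s \<longrightarrow> Q p"
  shows "AE p in \<theta>. Q p"
proof -
  have "AE p in \<theta>. \<forall>B\<in>{nb 1 s |s. s \<in> X}. p \<in> B \<longrightarrow> Q p"
  proof (rule AE_ball_countable')
    show "countable {nb 1 s |s. s \<in> X}" by (rule countable_subset[OF _ countable_nbs]) auto
  qed (use assms in auto)
  moreover have "AE p in \<theta>. p \<in> X" using AE_space[of \<theta>] sets_eq_imp_space_eq[OF M] by simp
  ultimately show ?thesis by eventually_elim (use nb_self in blast)
qed

section \<open>Paths between states\<close>

text \<open>A word of the Markov shift over \<open>I \<times> G\<close> that leads from one state to another becomes a point of \<open>X\<close>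
  once it is continued by an infinite sequence that starts with its last letter.\<close>

lemma mixing_path:
  assumes mix: "ext_mixing I A G \<Psi>" and ne: "\<And>i. i \<in> I \<Longrightarrow> \<exists>x\<in>mshift I A. x 0 = i"
    and s: "s \<in> X" "t \<in> X"
  obtains k\<^sub>0 where "\<And>k. k \<ge> k\<^sub>0 \<Longrightarrow> \<exists>r\<in>nb 1 s. (T ^^ k) r \<in> nb 1 t"
proof -
  define a b where "a = (fst s 0, snd s)" and "b = (fst t 0, snd t)"
  have ab: "a \<in> ext_alphabet I G" "b \<in> ext_alphabet I G"
    using s letter_in_I by (auto simp: a_def b_def ext_alphabet_def in_X)
  obtain n\<^sub>0 where n\<^sub>0: "\<And>n. n \<ge> n\<^sub>0 \<Longrightarrow> \<exists>w\<in>words_of_length (ext_alphabet I G) (ext_matrix A G \<Psi>) n.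
      a # w @ [b] \<in> adm_words (ext_alphabet I G) (ext_matrix A G \<Psi>)"
    using mix ab unfolding ext_mixing_def topologically_mixing_def by meson
  have "\<exists>r\<in>nb 1 s. (T ^^ k) r \<in> nb 1 t" if "k \<ge> Suc n\<^sub>0" for k
  proof -
    define n where "n = k - 1"
    have n: "k = Suc n" "n \<ge> n\<^sub>0" using that by (auto simp: n_def)
    obtain w where w: "w \<in> words_of_length (ext_alphabet I G) (ext_matrix A G \<Psi>) n"
      "a # w @ [b] \<in> adm_words (ext_alphabet I G) (ext_matrix A G \<Psi>)"
      using n\<^sub>0[OF n(2)] by blast
    define v where "v = a # w @ [b]"
    have len: "length v = n + 2" using w by (simp add: v_def words_of_length_def)
    have vI: "set v \<subseteq> ext_alphabet I G" and vs: "successively (ext_matrix A G \<Psi>) v"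
      using w(2) by (auto simp: v_def adm_words_def words_of_length_def in_lists_conv_set)
    have vk: "fst (v ! m) \<in> I" if "m < n + 2" for m
      using subsetD[OF vI nth_mem[of m v]] that len by (auto simp: ext_alphabet_def)
    have vA: "A (fst (v ! m)) (fst (v ! Suc m))" "snd (v ! Suc m) = snd (v ! m) \<otimes> \<Psi> [fst (v ! m)]"
      if "m < n + 1" for m
      using vs that len unfolding successively_conv_nth by (auto simp: ext_matrix_def split_beta)
    have v0: "v ! 0 = a" by (simp add: v_def)
    have vn: "v ! Suc n = b" using w(1) by (simp add: v_def nth_append words_of_length_def)
    obtain x where x: "x \<in> mshift I A" "x 0 = fst b"
      using ne[of "fst b"] ab by (auto simp: ext_alphabet_def)
    define r where "r = ((\<lambda>m. if m \<le> n then fst (v ! m) else x (m - Suc n)), snd a)"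
    have rv: "fst r m = fst (v ! m)" if "m < n + 2" for m
      using that x vn by (auto simp: r_def not_le) (metis Suc_diff_Suc diff_self_eq_0 le_antisym less_Suc_eq_le Suc_leI)
    have "fst r \<in> mshift I A"
      unfolding mshift_def
    proof (intro CollectI conjI allI)
      fix m
      show "fst r m \<in> I" using vk x by (auto simp: r_def mshift_def)
      show "A (fst r m) (fst r (Suc m))"
      proof (cases "m \<le> n")
        case True
        then show ?thesis using rv[of m] rv[of "Suc m"] vA(1)[of m] by simp
      next
        case False
        then have "Suc m - Suc n = Suc (m - Suc n)" by simp
        with False x show ?thesis unfolding r_def mshift_def by simp
      qed
    qed
    then have rX: "r \<in> X" using ab by (auto simp: in_X r_def ext_alphabet_def)
    have "snd ((T ^^ m) r) = snd (v ! m)" if "m < n + 2" for m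
      using that
    proof (induction m)
      case 0
      then show ?case by (simp add: r_def v0)
    next
      case (Suc m)
      then show ?case using vA(2)[of m] rv[of m] by (simp add: snd_T)
    qed
    from this[of "Suc n"] have "snd ((T ^^ k) r) = snd b" by (simp add: n vn)
    moreover have "fst ((T ^^ k) r) 0 = fst b" unfolding fst_Tn_nth using rv[of "Suc n"] by (simp add: n vn)
    moreover have "fst r 0 = fst s 0" "snd r = snd s" using rv[of 0] v0 by (auto simp: a_def r_def)
    ultimately have "r \<in> nb 1 s" "(T ^^ k) r \<in> nb 1 t" using rX
      by (auto simp: nb_def b_def simp del: funpow.simps)
    then show ?thesis by blast
  qed
  then show ?thesis using that by blast
qed

end

section \<open>Quasi-conformal measures\<close>

locale group_extension_potential = group_extension I A G \<Psi>
  for I :: "nat set" and A :: "nat \<Rightarrow> nat \<Rightarrow> bool"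
    and G :: "('g, 'm) monoid_scheme" (structure) and \<Psi> :: "nat list \<Rightarrow> 'g" +
  fixes \<phi> :: "(nat \<Rightarrow> nat) \<Rightarrow> real" and P :: real
  assumes hoelder: "hoelder_continuous I A \<phi>"
    \<comment> \<open>what topological mixing says about points of \<open>X\<close>\<close>
    and path: "\<And>s t. s \<in> X \<Longrightarrow> t \<in> X \<Longrightarrow> \<exists>k\<^sub>0. \<forall>k\<ge>k\<^sub>0. \<exists>r\<in>nb 1 s. (T ^^ k) r \<in> nb 1 t"
begin

text \<open>The value that a conformal measure of eigenvalue \<open>exp P\<close> gives to the cylinder of depth \<open>n\<close>
  around \<open>p\<close>, up to distortion and the measure of the image of that cylinder under \<open>T ^^ n\<close>.\<close>

definition weight :: "nat \<Rightarrow> (nat \<Rightarrow> nat) \<times> 'g \<Rightarrow> real" where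
  "weight n p = exp (birkhoff_sum n \<phi> (fst p) - real n * P)"

text \<open>The common property of \<open>\<nu>\<close> and the product measure on which all comparisons rest. The constant
  depends on the final state and on the initial group element: for the product measure it contains
  the values of \<open>c\<close> at both ends.\<close>

definition quasi_conformal :: "((nat \<Rightarrow> nat) \<times> 'g) measure \<Rightarrow> bool" where
  "quasi_conformal \<theta> \<longleftrightarrow> sets \<theta> = sets MX \<and>
     (\<forall>s\<in>X. \<forall>g\<in>carrier G. \<exists>K>0. \<forall>p\<in>X. \<forall>n. snd p = g \<longrightarrow> (T ^^ n) p \<in> nb 1 s \<longrightarrow>
        ennreal (weight n p / K) \<le> emeasure \<theta> (nb (Suc n) p) \<and>
        emeasure \<theta> (nb (Suc n) p) \<le> ennreal (K * weight n p))"

lemma weight_pos [simp]: "weight n p > 0" by (simp add: weight_def)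

lemma weight_neq_0 [simp]: "weight n p \<noteq> 0" by (simp add: weight_def)

lemma weight_0 [simp]: "weight 0 p = 1" by (simp add: weight_def)

lemma weight_add: "weight (n + k) p = weight n p * weight k ((T ^^ n) p)"
  by (simp add: weight_def birkhoff_sum_add[of n k] fst_Tn exp_add[symmetric] distrib_right)

lemma weight_distortion:
  obtains C where "C > 0" "\<And>n p q. p \<in> X \<Longrightarrow> q \<in> nb n p \<Longrightarrow> weight n q \<le> C * weight n p"
proof -
  obtain \<Delta> :: real where \<Delta>: "\<Delta> \<ge> 0"
    "\<And>n x y. x \<in> mshift I A \<Longrightarrow> y \<in> mshift I A \<Longrightarrow> (\<And>k. k < n \<Longrightarrow> x k = y k) \<Longrightarrow>
       \<bar>birkhoff_sum n \<phi> x - birkhoff_sum n \<phi> y\<bar> \<le> \<Delta>"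
    using bounded_distortion[OF hoelder] by blast
  have "weight n q \<le> exp \<Delta> * weight n p" if "p \<in> X" "q \<in> nb n p" for n p q
  proof -
    have "\<bar>birkhoff_sum n \<phi> (fst q) - birkhoff_sum n \<phi> (fst p)\<bar> \<le> \<Delta>"
      using that by (intro \<Delta>) (auto simp: nb_def in_X)
    then show ?thesis by (simp add: weight_def exp_add[symmetric])
  qed
  then show ?thesis using that[of "exp \<Delta>"] by auto
qed

lemma quasi_conformalD:
  assumes "quasi_conformal \<theta>" "s \<in> X" "g \<in> carrier G"
  obtains K where "K > 0"
    "\<And>p n. p \<in> X \<Longrightarrow> snd p = g \<Longrightarrow> (T ^^ n) p \<in> nb 1 s \<Longrightarrow> ennreal (weight n p / K) \<le> emeasure \<theta> (nb (Suc n) p)"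
    "\<And>p n. p \<in> X \<Longrightarrow> snd p = g \<Longrightarrow> (T ^^ n) p \<in> nb 1 s \<Longrightarrow> emeasure \<theta> (nb (Suc n) p) \<le> ennreal (K * weight n p)"
  using assms unfolding quasi_conformal_def by meson

lemma quasi_conformal_finite:
  assumes "quasi_conformal \<theta>" "s \<in> X"
  shows "emeasure \<theta> (nb 1 s) < \<infinity>" "emeasure \<theta> (nb 1 s) > 0"
proof -
  obtain K where K: "K > 0"
    "\<And>p n. p \<in> X \<Longrightarrow> snd p = snd s \<Longrightarrow> (T ^^ n) p \<in> nb 1 s \<Longrightarrow> ennreal (weight n p / K) \<le> emeasure \<theta> (nb (Suc n) p)"
    "\<And>p n. p \<in> X \<Longrightarrow> snd p = snd s \<Longrightarrow> (T ^^ n) p \<in> nb 1 s \<Longrightarrow> emeasure \<theta> (nb (Suc n) p) \<le> ennreal (K * weight n p)"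
    using quasi_conformalD[OF assms, of "snd s"] assms(2) by (metis in_X)
  have "emeasure \<theta> (nb 1 s) \<le> ennreal K" using K(3)[of s 0] assms(2) by simp
  then show "emeasure \<theta> (nb 1 s) < \<infinity>" by (auto simp: order_le_less_trans)
  have "ennreal (1 / K) \<le> emeasure \<theta> (nb 1 s)" using K(2)[of s 0] assms(2) by simp
  moreover have "ennreal (1 / K) > 0" using K by simp
  ultimately show "emeasure \<theta> (nb 1 s) > 0" by (rule less_le_trans[rotated])
qed

text \<open>Whenever the orbit is back in its initial state it has a definite chance to follow a fixed path
  to the state \<open>t\<close> next. Comparing \<open>\<theta>\<close> with its restriction to the points that reach \<open>t\<close> turns
  this into the assertion that almost every point does.\<close>

lemma visits_every_state:
  assumes q: "quasi_conformal \<theta>"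
    and ret: "\<And>s. s \<in> X \<Longrightarrow> AE p in \<theta>. p \<in> nb 1 s \<longrightarrow> (\<exists>\<^sub>\<infinity>n. (T ^^ n) p \<in> nb 1 s)"
    and nonsing: "\<And>Q. AE p in \<theta>. Q p \<Longrightarrow> AE p in \<theta>. Q (T p)"
    and t: "t \<in> X"
  shows "AE p in \<theta>. \<exists>\<^sub>\<infinity>n. (T ^^ n) p \<in> nb 1 t"
proof -
  have M: "sets \<theta> = sets MX" using q by (simp add: quasi_conformal_def)
  have sp: "space \<theta> = X" using sets_eq_imp_space_eq[OF M] by simp
  define V where "V = {p \<in> X. \<exists>n. (T ^^ n) p \<in> nb 1 t}"
  have Vs: "V \<in> sets MX"
  proof -
    have "V = (\<Union>n. (T ^^ n) -` nb 1 t \<inter> space MX)" unfolding V_def space_borel_of topspace_ext by blast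
    also have "\<dots> \<in> sets MX" by (intro sets.countable_UN image_subsetI measurable_sets[OF measurable_Tn] nb_sets)
    finally show ?thesis .
  qed
  obtain C where C: "C > 0" "\<And>n p q. p \<in> X \<Longrightarrow> q \<in> nb n p \<Longrightarrow> weight n q \<le> C * weight n p"
    using weight_distortion by blast
  have "AE p in \<theta>. p \<in> nb 1 s \<longrightarrow> p \<in> V" if s: "s \<in> X" for s
  proof -
    obtain k r where r: "r \<in> nb 1 s" "(T ^^ k) r \<in> nb 1 t" using path[OF s t] by blast
    obtain K1 where K1: "K1 > 0"
      "\<And>p n. p \<in> X \<Longrightarrow> snd p = snd s \<Longrightarrow> (T ^^ n) p \<in> nb 1 s \<Longrightarrow> emeasure \<theta> (nb (Suc n) p) \<le> ennreal (K1 * weight n p)"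
      using quasi_conformalD[OF q s, of "snd s"] s by (metis in_X)
    obtain K2 where K2: "K2 > 0"
      "\<And>p n. p \<in> X \<Longrightarrow> snd p = snd s \<Longrightarrow> (T ^^ n) p \<in> nb 1 t \<Longrightarrow> ennreal (weight n p / K2) \<le> emeasure \<theta> (nb (Suc n) p)"
      using quasi_conformalD[OF q t, of "snd s"] s by (metis in_X)
    define K where "K = K1 * C * K2 / weight k r"
    have K: "K > 0" using K1 K2 C by (simp add: K_def)
    define \<theta>' where "\<theta>' = density \<theta> (indicator V)"
    have \<theta>': "emeasure \<theta>' B = emeasure \<theta> (V \<inter> B)" if "B \<in> sets MX" for B
      using that Vs M by (simp add: \<theta>'_def emeasure_density flip: indicator_inter_arith)
    have E: "nb 1 s - V \<in> sets MX" using Vs by auto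
    have "emeasure \<theta> (nb 1 s - V) \<le> ennreal K * emeasure \<theta>' (nb 1 s - V)"
    proof (rule comparison[OF M _ K _ _ ret[OF s] E])
      show "sets \<theta>' = sets MX" using M by (simp add: \<theta>'_def)
      have "emeasure \<theta>' (nb 1 s) \<le> emeasure \<theta> (nb 1 s)" using M by (simp add: \<theta>' emeasure_mono)
      then show "emeasure \<theta>' (nb 1 s) < \<infinity>" using quasi_conformal_finite[OF q s] by auto
      fix p n assume p: "p \<in> nb 1 s" "(T ^^ n) p \<in> nb 1 s"
      have pX: "p \<in> X" "snd p = snd s" using p by (auto simp: nb_def)
      have "r \<in> nb 1 ((T ^^ n) p)" using r(1) nb_eq[OF p(2)] by simp
      then obtain z where z: "z \<in> nb (Suc n) p" "(T ^^ n) z = r" using concatenate[OF pX(1)] by blast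
      have zX: "z \<in> X" "snd z = snd s" using z(1) pX by (auto simp: nb_def)
      have zt: "(T ^^ (n + k)) z \<in> nb 1 t" using z(2) r(2) by (simp add: add.commute[of n k] funpow_add)
      have "nb (Suc (n + k)) z \<subseteq> V \<inter> nb (Suc n) p"
      proof
        fix y assume y: "y \<in> nb (Suc (n + k)) z"
        have "(T ^^ (n + k)) y \<in> nb 1 t" using nb_Suc_visit[OF zX(1) y] zt by blast
        moreover have "y \<in> nb (Suc n) p" using y nb_mono[of "Suc n" "Suc (n + k)" z] nb_eq[OF z(1)] by auto
        ultimately show "y \<in> V \<inter> nb (Suc n) p" using nb_subset unfolding V_def by blast
      qed
      then have "emeasure \<theta> (nb (Suc (n + k)) z) \<le> emeasure \<theta>' (nb (Suc n) p)"
        using Vs M by (simp add: \<theta>' emeasure_mono)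
      then have low: "ennreal (weight (n + k) z / K2) \<le> emeasure \<theta>' (nb (Suc n) p)"
        using K2(2)[OF zX zt] by (rule order_trans[rotated])
      have "weight n p \<le> C * weight n z"
        using C(2)[OF zX(1), of p n] z(1) pX nb_eq[of z n p] nb_mono[of n "Suc n" p] by auto
      then have "K1 * weight n p \<le> K1 * (C * weight n z)" using K1 by simp
      also have "\<dots> = K * (weight (n + k) z / K2)"
        using K2(1) weight_pos[of k r] unfolding weight_add z(2) by (simp add: K_def)
      finally have "ennreal (K1 * weight n p) \<le> ennreal K * ennreal (weight (n + k) z / K2)"
        using K by (subst ennreal_mult'[symmetric]) (auto intro!: ennreal_leI)
      also have "\<dots> \<le> ennreal K * emeasure \<theta>' (nb (Suc n) p)" using low by (intro mult_left_mono) auto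
      finally show "emeasure \<theta> (nb (Suc n) p) \<le> ennreal K * emeasure \<theta>' (nb (Suc n) p)"
        using K1(2)[OF pX p(2)] by (rule order_trans[rotated])
    qed auto
    also have "emeasure \<theta>' (nb 1 s - V) = 0" using E by (simp add: \<theta>' Int_Diff)
    finally have "emeasure \<theta> (nb 1 s - V) = 0" by simp
    then have "nb 1 s - V \<in> null_sets \<theta>" using E M by auto
    then have "AE p in \<theta>. p \<notin> nb 1 s - V" by (rule AE_not_in)
    then show ?thesis by eventually_elim auto
  qed
  then have V: "AE p in \<theta>. p \<in> V" by (rule AE_states[OF M])
  have "AE p in \<theta>. (T ^^ m) p \<in> V" for m
  proof (induction m)
    case (Suc m)
    show ?case using nonsing[OF Suc] by (simp add: funpow_swap1)
  qed (use V in simp)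
  then have "AE p in \<theta>. \<forall>m. (T ^^ m) p \<in> V" by (simp add: AE_all_countable)
  then show ?thesis
  proof eventually_elim
    case (elim p)
    have "\<exists>n\<ge>m. (T ^^ n) p \<in> nb 1 t" for m
    proof -
      obtain j where "(T ^^ j) ((T ^^ m) p) \<in> nb 1 t" using elim by (auto simp: V_def)
      then have "(T ^^ (j + m)) p \<in> nb 1 t" by (simp add: funpow_add)
      then show ?thesis by (intro exI[of _ "j + m"]) auto
    qed
    then show ?case by (auto simp: INFM_nat_le)
  qed
qed

end

section \<open>Conformal measures\<close>

context group_extension_potential
begin

lemma weight_nonneg [simp]: "0 \<le> weight n p" by (simp add: weight_def)

lemma measurable_potential [measurable]: "(\<lambda>p. \<phi> (fst p)) \<in> borel_measurable MX"
proof (rule continuous_measurable)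
  fix p e assume p: "p \<in> X" and e: "(e::real) > 0"
  obtain \<alpha> V :: real where a: "\<alpha> > 0" "V \<ge> 0"
    and V: "\<And>n x y. x \<in> mshift I A \<Longrightarrow> y \<in> mshift I A \<Longrightarrow> (\<And>k. k < Suc n \<Longrightarrow> x k = y k) \<Longrightarrow>
       \<bar>\<phi> x - \<phi> y\<bar> \<le> V * exp (- \<alpha> * real (Suc n))"
    using hoelder_bound[OF hoelder] by blast
  have "(\<lambda>n. V * exp (- \<alpha>) ^ Suc n) \<longlonglongrightarrow> V * 0"
    using a by (intro tendsto_mult tendsto_const LIMSEQ_Suc LIMSEQ_power_zero) auto
  then have "\<forall>\<^sub>F n in sequentially. V * exp (- \<alpha>) ^ Suc n < e"
    using e by (intro order_tendstoD) auto
  then obtain n where n: "V * exp (- \<alpha>) ^ Suc n < e" by (auto simp: eventually_sequentially)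
  have pw: "exp (- \<alpha> * real m) = exp (- \<alpha>) ^ m" for m
    by (simp add: exp_of_nat_mult[symmetric] mult.commute)
  have "\<bar>\<phi> (fst q) - \<phi> (fst p)\<bar> < e" if "q \<in> nb (Suc n) p" for q
  proof -
    have "\<bar>\<phi> (fst q) - \<phi> (fst p)\<bar> \<le> V * exp (- \<alpha> * real (Suc n))"
      using that p by (intro V) (auto simp: nb_def in_X)
    then show ?thesis using n unfolding pw by simp
  qed
  then show "\<exists>n. \<forall>q\<in>nb n p. \<bar>\<phi> (fst q) - \<phi> (fst p)\<bar> < e" by blast
qed

lemma measurable_birkhoff [measurable]: "(\<lambda>p. birkhoff_sum n \<phi> (fst p)) \<in> borel_measurable MX"
proof -
  have "(\<lambda>p. \<phi> (fst ((T ^^ k) p))) \<in> borel_measurable MX" for k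
    by (rule measurable_compose[OF measurable_Tn measurable_potential])
  then show ?thesis unfolding birkhoff_sum_def fst_Tn by measurable
qed

lemma measurable_weight [measurable]: "weight n \<in> borel_measurable MX"
  unfolding weight_def[abs_def] by measurable

definition succ_set :: "nat \<Rightarrow> ((nat \<Rightarrow> nat) \<times> 'g) set" where
  "succ_set i = {p \<in> X. i \<in> I \<and> A i (fst p 0)}"

lemma succ_set_sets [measurable]: "succ_set i \<in> sets MX"
  by (rule open_sets_MX) (auto simp: succ_set_def nb_def intro!: exI[of _ 1])

lemma succ_set_Int_X [simp]: "succ_set i \<inter> X = succ_set i"
  by (auto simp: succ_set_def)

lemma measurable_prepend: "prepend i \<in> measurable (restrict_space MX (succ_set i)) MX"
proof (rule measurable_sigma_sets[OF sets_MX_nb])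
  show "{nb (Suc n) p |n p. p \<in> X} \<subseteq> Pow X" using nb_subset by auto
  show "prepend i \<in> space (restrict_space MX (succ_set i)) \<rightarrow> X"
    by (auto simp: succ_set_def space_restrict_space intro: prepend_X)
  fix B assume "B \<in> {nb (Suc n) p |n p. p \<in> X}"
  then obtain n p where B: "B = nb (Suc n) p" "p \<in> X" by auto
  have "{z \<in> succ_set i. prepend i z \<in> B} \<in> sets MX"
  proof (rule open_sets_MX)
    show "{z \<in> succ_set i. prepend i z \<in> B} \<subseteq> X" by (auto simp: succ_set_def)
    fix z assume z: "z \<in> {z \<in> succ_set i. prepend i z \<in> B}"
    have "nb (Suc n) z \<subseteq> {z \<in> succ_set i. prepend i z \<in> B}"
    proof
      fix y assume y: "y \<in> nb (Suc n) z"
      then have ys: "y \<in> succ_set i" using z by (auto simp: succ_set_def nb_def)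
      then have "prepend i y \<in> X" by (auto simp: succ_set_def intro: prepend_X)
      then have "prepend i y \<in> nb (Suc n) (prepend i z)"
        using y by (auto simp: nb_def prepend_def split: nat.splits)
      moreover have "nb (Suc n) (prepend i z) = B" using z nb_eq by (simp add: B(1))
      ultimately show "y \<in> {z \<in> succ_set i. prepend i z \<in> B}" using ys by simp
    qed
    then show "\<exists>n. nb n z \<subseteq> {z \<in> succ_set i. prepend i z \<in> B}" by blast
  qed
  moreover have "prepend i -` B \<inter> space (restrict_space MX (succ_set i)) = {z \<in> succ_set i. prepend i z \<in> B}"
    by (auto simp: space_restrict_space succ_set_def)
  ultimately show "prepend i -` B \<inter> space (restrict_space MX (succ_set i)) \<in> sets (restrict_space MX (succ_set i))"
    by (subst sets_restrict_space_iff) auto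
qed

text \<open>The indicator function removes the points to which the letter \<open>i\<close> cannot be prepended.\<close>

definition branch_term :: "nat \<Rightarrow> ((nat \<Rightarrow> nat) \<times> 'g \<Rightarrow> ennreal) \<Rightarrow> (nat \<Rightarrow> nat) \<times> 'g \<Rightarrow> ennreal" where
  "branch_term i u p = ennreal (exp (\<phi> (fst (prepend i p)))) * u (prepend i p) * indicator (succ_set i) p"

text \<open>The transfer operator on non-negative functions with values in \<open>[0, \<infinity>]\<close>, where no question of
  convergence arises.\<close>

definition Lop :: "((nat \<Rightarrow> nat) \<times> 'g \<Rightarrow> ennreal) \<Rightarrow> (nat \<Rightarrow> nat) \<times> 'g \<Rightarrow> ennreal" where
  "Lop u p = (\<Sum>i. branch_term i u p)"

lemma measurable_branch_term [measurable]:
  assumes [measurable]: "u \<in> borel_measurable MX"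
  shows "branch_term i u \<in> borel_measurable MX"
proof -
  note measurable_prepend[measurable]
  have "(\<lambda>p. ennreal (exp (\<phi> (fst (prepend i p)))) * u (prepend i p)) \<in> borel_measurable (restrict_space MX (succ_set i))"
    by (intro borel_measurable_times_ennreal measurable_compose[OF measurable_prepend assms]
        measurable_compose[OF measurable_prepend, of "\<lambda>p. ennreal (exp (\<phi> (fst p)))"]) measurable
  then show ?thesis
    unfolding branch_term_def[abs_def] by (subst (asm) borel_measurable_restrict_space_iff_ennreal) auto
qed

lemma measurable_Lop [measurable]: "u \<in> borel_measurable MX \<Longrightarrow> Lop u \<in> borel_measurable MX"
  unfolding Lop_def[abs_def] by measurable

lemma Lop_mono: "(\<And>p. p \<in> X \<Longrightarrow> u p \<le> v p) \<Longrightarrow> Lop u p \<le> Lop v p"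
  unfolding Lop_def
proof (rule suminf_le)
  assume le: "\<And>p. p \<in> X \<Longrightarrow> u p \<le> v p"
  fix i
  show "branch_term i u p \<le> branch_term i v p"
  proof (cases "p \<in> succ_set i")
    case True
    then have "prepend i p \<in> X" unfolding succ_set_def using prepend_X by blast
    then show ?thesis unfolding branch_term_def by (intro mult_right_mono mult_left_mono le) auto
  qed (simp add: branch_term_def)
qed auto

lemma Lop_cmult: "Lop (\<lambda>p. c * u p) p = c * Lop u p"
  unfolding Lop_def branch_term_def by (simp add: mult.assoc mult.left_commute)

lemma Lop_add: "Lop (\<lambda>p. u p + v p) p = Lop u p + Lop v p"
  unfolding Lop_def branch_term_def by (simp add: distrib_left distrib_right suminf_add)

end

locale conformal = group_extension_potential I A G \<Psi> \<phi> P
  for I :: "nat set" and A :: "nat \<Rightarrow> nat \<Rightarrow> bool"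
    and G :: "('g, 'm) monoid_scheme" (structure) and \<Psi> :: "nat list \<Rightarrow> 'g"
    and \<phi> :: "(nat \<Rightarrow> nat) \<Rightarrow> real" and P :: real +
  fixes \<nu> :: "((nat \<Rightarrow> nat) \<times> 'g) measure"
  assumes sets_\<nu>: "sets \<nu> = sets MX"
    and dual: "dual_eigenmeasure T (\<phi> \<circ> fst) (exp P) \<nu>"
    and \<nu>_state: "\<And>s. s \<in> X \<Longrightarrow> 0 < emeasure \<nu> (nb 1 s) \<and> emeasure \<nu> (nb 1 s) < \<infinity>"
begin

declare sets_\<nu> [measurable_cong]

lemma space_\<nu> [simp]: "space \<nu> = X"
  using sets_eq_imp_space_eq[OF sets_\<nu>] by simp

lemma sigma_finite_\<nu>: "sigma_finite_measure \<nu>"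
  using dual by (simp add: dual_eigenmeasure_def)

definition letter_set :: "nat \<Rightarrow> ((nat \<Rightarrow> nat) \<times> 'g) set" where
  "letter_set i = {p \<in> X. fst p 0 = i}"

lemma letter_set_sets [measurable]: "letter_set i \<in> sets MX"
  by (rule open_sets_MX) (auto simp: letter_set_def nb_def intro!: exI[of _ 1])

text \<open>The function \<open>exp (- \<phi>)\<close> on the part of a state that is mapped into the cylinder is bounded, hence
  integrable, and the transfer operator maps it to an indicator function. It suffices to consider
  cylinders of positive depth, as only these are sure to have finite measure.\<close>

lemma branch_generator:
  assumes i: "i \<in> I" and p: "p \<in> X"
  shows "(\<integral>\<^sup>+y. ennreal (exp (P - \<phi> (fst y))) * indicator (letter_set i) y * indicator (nb (Suc n) p) (T y) \<partial>\<nu>)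
    = emeasure \<nu> (nb (Suc n) p \<inter> succ_set i)"
proof -
  define B where "B = nb (Suc n) p"
  have B: "B \<in> sets MX" "B \<subseteq> X" using nb_subset by (auto simp: B_def)
  define D where "D = letter_set i \<inter> (T -` B \<inter> space MX)"
  have Ds [measurable]: "D \<in> sets MX"
    unfolding D_def by (intro sets.Int letter_set_sets measurable_sets[OF measurable_T] B)
  define u where "u y = exp (- \<phi> (fst y)) * indicator D y" for y
  have um [measurable]: "u \<in> borel_measurable MX" unfolding u_def by measurable
  obtain \<alpha> V :: real where V: "\<alpha> > 0" "V \<ge> 0" "\<And>n x y. x \<in> mshift I A \<Longrightarrow> y \<in> mshift I A \<Longrightarrow> (\<And>k. k < Suc n \<Longrightarrow> x k = y k) \<Longrightarrow>
       \<bar>\<phi> x - \<phi> y\<bar> \<le> V * exp (- \<alpha> * real (Suc n))"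
    using hoelder_bound[OF hoelder] by blast
  have "integrable \<nu> u"
  proof (cases "D = {}")
    case True
    then have "u = (\<lambda>_. 0)" by (auto simp: u_def)
    then show ?thesis by simp
  next
    case False
    then obtain s where s: "s \<in> D" by blast
    have sX: "s \<in> X" using s by (auto simp: D_def)
    have Dsub: "D \<subseteq> nb 1 s"
    proof
      fix y assume y: "y \<in> D"
      have "snd y \<otimes> \<Psi> [i] = snd s \<otimes> \<Psi> [i]"
        using y s by (auto simp: D_def letter_set_def B_def nb_def snd_T)
      then have "snd y = snd s" using i sX y by (auto simp: D_def in_X)
      then show "y \<in> nb 1 s" using y s by (auto simp: D_def letter_set_def nb_def)
    qed
    have bd: "u y \<le> exp (V - \<phi> (fst s)) * indicator (nb 1 s) y" for y
    proof (cases "y \<in> D")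
      case True
      then have "y \<in> nb 1 s" using Dsub by blast
      then have "\<bar>\<phi> (fst y) - \<phi> (fst s)\<bar> \<le> V * exp (- \<alpha> * real (Suc 0))"
        using sX by (intro V(3)) (auto simp: nb_def in_X)
      also have "\<dots> \<le> V * 1" using V by (intro mult_left_mono) auto
      finally show ?thesis using True Dsub by (auto simp: u_def)
    qed (simp add: u_def)
    show ?thesis
    proof (rule integrableI_nonneg)
      have "(\<integral>\<^sup>+y. ennreal (u y) \<partial>\<nu>) \<le> (\<integral>\<^sup>+y. ennreal (exp (V - \<phi> (fst s))) * indicator (nb 1 s) y \<partial>\<nu>)"
        using bd by (intro nn_integral_mono) (metis ennreal_indicator ennreal_leI ennreal_mult' exp_ge_zero)
      also have "\<dots> = ennreal (exp (V - \<phi> (fst s))) * emeasure \<nu> (nb 1 s)"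
        using nb_sets sets_\<nu> by (intro nn_integral_cmult_indicator) auto
      also have "\<dots> < \<infinity>" using \<nu>_state[OF sX] by (simp add: ennreal_mult_less_top)
      finally show "(\<integral>\<^sup>+y. ennreal (u y) \<partial>\<nu>) < \<infinity>" .
    qed (auto simp: u_def)
  qed
  then have du: "integrable \<nu> (transfer_op X T (\<phi> \<circ> fst) u)"
    "integral\<^sup>L \<nu> (transfer_op X T (\<phi> \<circ> fst) u) = exp P * integral\<^sup>L \<nu> u"
    using dual unfolding dual_eigenmeasure_def by auto
  have tr: "transfer_op X T (\<phi> \<circ> fst) u z = indicator (B \<inter> succ_set i) z" if z: "z \<in> X" for z
  proof -
    have "transfer_op X T (\<phi> \<circ> fst) u z = (\<Sum>\<^sub>\<infinity>y\<in>{y \<in> X. T y = z}. indicator D y)"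
      unfolding transfer_op_def by (intro infsum_cong) (auto simp: u_def exp_minus indicator_def)
    also have "\<dots> = (\<Sum>\<^sub>\<infinity>y\<in>(if z \<in> B \<inter> succ_set i then {prepend i z} else {}). 1)"
    proof (rule infsum_cong_neutral)
      fix y assume y: "y \<in> (if z \<in> B \<inter> succ_set i then {prepend i z} else {}) - {y \<in> X. T y = z}"
      then show "(1::real) = 0" using T_prepend[OF i z] prepend_X[OF i z] by (auto simp: succ_set_def split: if_splits)
    next
      fix y assume y: "y \<in> {y \<in> X. T y = z} - (if z \<in> B \<inter> succ_set i then {prepend i z} else {})"
      have "y \<notin> D"
      proof
        assume yD: "y \<in> D"
        then have y0: "y \<in> X" "fst y 0 = i" "T y = z" "z \<in> B" using y by (auto simp: D_def letter_set_def)
        have "A i (fst z 0)" using y0 by (auto simp: in_X mshift_def fst_T left_shift_def)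
        then have "z \<in> B \<inter> succ_set i" using y0 i z by (auto simp: succ_set_def)
        moreover have "y = prepend i z" using prepend_T[OF y0(1)] y0 by simp
        ultimately show False using y by simp
      qed
      then show "indicator D y = (0::real)" by simp
    next
      fix y assume y: "y \<in> {y \<in> X. T y = z} \<inter> (if z \<in> B \<inter> succ_set i then {prepend i z} else {})"
      then have "y \<in> D" by (auto simp: D_def letter_set_def split: if_splits)
      then show "indicator D y = (1::real)" by simp
    qed
    also have "\<dots> = indicator (B \<inter> succ_set i) z" by auto
    finally show ?thesis .
  qed
  have "(\<integral>\<^sup>+y. ennreal (exp (P - \<phi> (fst y))) * indicator (letter_set i) y * indicator B (T y) \<partial>\<nu>)
      = (\<integral>\<^sup>+y. ennreal (exp P) * ennreal (u y) \<partial>\<nu>)"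
  proof (rule nn_integral_cong)
    fix y assume "y \<in> space \<nu>"
    then show "ennreal (exp (P - \<phi> (fst y))) * indicator (letter_set i) y * indicator B (T y) = ennreal (exp P) * ennreal (u y)"
      by (auto simp: u_def D_def indicator_def ennreal_mult'[symmetric] exp_diff exp_minus divide_inverse)
  qed
  also have "\<dots> = ennreal (exp P) * (\<integral>\<^sup>+y. ennreal (u y) \<partial>\<nu>)"
    by (intro nn_integral_cmult) measurable
  also have "(\<integral>\<^sup>+y. ennreal (u y) \<partial>\<nu>) = ennreal (integral\<^sup>L \<nu> u)"
    by (intro nn_integral_eq_integral \<open>integrable \<nu> u\<close>) (simp add: u_def)
  also have "ennreal (exp P) * ennreal (integral\<^sup>L \<nu> u) = ennreal (exp P * integral\<^sup>L \<nu> u)"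
    by (simp add: ennreal_mult')
  also have "\<dots> = ennreal (integral\<^sup>L \<nu> (transfer_op X T (\<phi> \<circ> fst) u))"
    unfolding du(2) ..
  also have "\<dots> = (\<integral>\<^sup>+z. ennreal (transfer_op X T (\<phi> \<circ> fst) u z) \<partial>\<nu>)"
    using du(1) tr by (intro nn_integral_eq_integral[symmetric]) auto
  also have "\<dots> = (\<integral>\<^sup>+z. indicator (B \<inter> succ_set i) z \<partial>\<nu>)"
    using tr by (intro nn_integral_cong) (auto simp: ennreal_indicator)
  also have "\<dots> = emeasure \<nu> (B \<inter> succ_set i)"
    using B by (intro nn_integral_indicator) (simp add: sets_\<nu>)
  finally show ?thesis by (simp add: B_def)
qed

text \<open>Restricted to the points with first letter \<open>i\<close> the map \<open>T\<close> is injective with image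
  \<open>succ_set i\<close>, and conformality says that its Jacobian there is \<open>exp (P - \<phi>)\<close>.\<close>

lemma branch_jacobian:
  assumes i: "i \<in> I" and [measurable]: "v \<in> borel_measurable MX"
  shows "(\<integral>\<^sup>+y. ennreal (exp (P - \<phi> (fst y))) * indicator (letter_set i) y * v (T y) \<partial>\<nu>)
    = (\<integral>\<^sup>+z. v z * indicator (succ_set i) z \<partial>\<nu>)"
proof -
  define \<alpha> where "\<alpha> = distr (density \<nu> (\<lambda>y. ennreal (exp (P - \<phi> (fst y))) * indicator (letter_set i) y)) MX T"
  define \<beta> where "\<beta> = density \<nu> (indicator (succ_set i))"
  let ?E = "insert {} {nb (Suc n) p |n p. p \<in> X}"
  have nn\<alpha>: "(\<integral>\<^sup>+z. w z \<partial>\<alpha>) = (\<integral>\<^sup>+y. ennreal (exp (P - \<phi> (fst y))) * indicator (letter_set i) y * w (T y) \<partial>\<nu>)"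
    if [measurable]: "w \<in> borel_measurable MX" for w
    unfolding \<alpha>_def by (subst nn_integral_distr) (auto simp: nn_integral_density)
  have nn\<beta>: "(\<integral>\<^sup>+z. w z \<partial>\<beta>) = (\<integral>\<^sup>+z. w z * indicator (succ_set i) z \<partial>\<nu>)"
    if [measurable]: "w \<in> borel_measurable MX" for w
    unfolding \<beta>_def by (subst nn_integral_density) (auto simp: mult.commute)
  have s\<alpha>: "sets \<alpha> = sets MX" and s\<beta>: "sets \<beta> = sets MX" by (auto simp: \<alpha>_def \<beta>_def sets_\<nu>)
  have eq: "emeasure \<alpha> (nb (Suc n) p) = emeasure \<beta> (nb (Suc n) p)" if "p \<in> X" for n p
  proof -
    have "emeasure \<alpha> (nb (Suc n) p) = emeasure \<nu> (nb (Suc n) p \<inter> succ_set i)"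
      using nn\<alpha>[of "indicator (nb (Suc n) p)"] branch_generator[OF i that, of n] by (simp add: s\<alpha>)
    also have "\<dots> = emeasure \<beta> (nb (Suc n) p)"
      using nn\<beta>[of "indicator (nb (Suc n) p)"] by (simp add: s\<beta> sets_\<nu> flip: indicator_inter_arith)
    finally show ?thesis .
  qed
  have "\<alpha> = \<beta>"
  proof (rule measure_eqI_generator_eq_countable)
    show "Int_stable ?E"
    proof (rule Int_stableI)
      fix a b assume ab: "a \<in> ?E" "b \<in> ?E"
      show "a \<inter> b \<in> ?E"
      proof (cases "a \<inter> b = {}")
        case False
        then obtain z where z: "z \<in> a" "z \<in> b" by blast
        obtain m p where a: "a = nb (Suc m) p" "p \<in> X" using ab z by blast
        obtain n q where b: "b = nb (Suc n) q" "q \<in> X" using ab z by blast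
        have "a \<inter> b = nb (Suc m) z \<inter> nb (Suc n) z" using z a b nb_eq by auto
        also have "\<dots> = nb (Suc (max m n)) z" by (auto simp: nb_def less_Suc_eq_le le_max_iff_disj)
        finally show ?thesis using z a nb_subset by blast
      qed auto
    qed
    show "?E \<subseteq> Pow X" using nb_subset by auto
    show "emeasure \<alpha> Y = emeasure \<beta> Y" if "Y \<in> ?E" for Y using that eq by auto
    have "sigma_sets X ?E = sigma_sets X {nb (Suc n) p |n p. p \<in> X}"
      by (rule sigma_sets_eqI) (auto intro: sigma_sets.Empty sigma_sets.Basic)
    then show "sets \<alpha> = sigma_sets X ?E" "sets \<beta> = sigma_sets X ?E" using s\<alpha> s\<beta> sets_MX_nb by auto
    let ?A = "{nb (Suc 0) p |p. p \<in> X}"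
    show "?A \<subseteq> ?E" by blast
    show "countable ?A" by (rule countable_subset[OF _ countable_nbs]) auto
    show "\<Union>?A = X" using nb_subset nb_self by blast
    fix a assume "a \<in> ?A"
    then obtain p where p: "a = nb (Suc 0) p" "p \<in> X" by blast
    have "emeasure \<alpha> a = emeasure \<nu> (a \<inter> succ_set i)"
      using eq[OF p(2), of 0] nn\<beta>[of "indicator a"] by (simp add: p s\<beta> sets_\<nu> flip: indicator_inter_arith)
    also have "\<dots> \<le> emeasure \<nu> a" by (intro emeasure_mono) (auto simp: sets_\<nu> p)
    also have "\<dots> < \<infinity>" using \<nu>_state[OF p(2)] p by simp
    finally show "emeasure \<alpha> a \<noteq> \<infinity>" by simp
  qed
  then show ?thesis using nn\<alpha>[of v] nn\<beta>[of v] by simp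
qed

lemma Lop_duality:
  assumes [measurable]: "u \<in> borel_measurable MX" "v \<in> borel_measurable MX"
  shows "(\<integral>\<^sup>+p. Lop u p * v p \<partial>\<nu>) = ennreal (exp P) * (\<integral>\<^sup>+p. u p * v (T p) \<partial>\<nu>)"
proof -
  have term_eq: "(\<integral>\<^sup>+p. branch_term i u p * v p \<partial>\<nu>) = (\<integral>\<^sup>+y. ennreal (exp P) * (u y * v (T y)) * indicator (letter_set i) y \<partial>\<nu>)" for i
  proof (cases "i \<in> I")
    case True
    have "(\<integral>\<^sup>+p. branch_term i u p * v p \<partial>\<nu>) = (\<integral>\<^sup>+p. branch_term i u p * v p * indicator (succ_set i) p \<partial>\<nu>)"
      by (intro nn_integral_cong) (auto simp: branch_term_def indicator_def)
    also have "\<dots> = (\<integral>\<^sup>+y. ennreal (exp (P - \<phi> (fst y))) * indicator (letter_set i) y * (branch_term i u (T y) * v (T y)) \<partial>\<nu>)"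
      by (rule branch_jacobian[OF True, symmetric]) measurable
    also have "\<dots> = (\<integral>\<^sup>+y. ennreal (exp P) * (u y * v (T y)) * indicator (letter_set i) y \<partial>\<nu>)"
    proof (rule nn_integral_cong)
      fix y assume "y \<in> space \<nu>"
      then have y: "y \<in> X" by simp
      show "ennreal (exp (P - \<phi> (fst y))) * indicator (letter_set i) y * (branch_term i u (T y) * v (T y))
        = ennreal (exp P) * (u y * v (T y)) * indicator (letter_set i) y"
      proof (cases "y \<in> letter_set i")
        case yi: True
        then have "prepend i (T y) = y" using prepend_T[OF y] by (auto simp: letter_set_def)
        moreover have "T y \<in> succ_set i"
          using yi y True by (auto simp: succ_set_def letter_set_def in_X mshift_def fst_T left_shift_def snd_T)
        ultimately have "branch_term i u (T y) = ennreal (exp (\<phi> (fst y))) * u y"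
          by (simp add: branch_term_def)
        moreover have "ennreal (exp (P - \<phi> (fst y))) * ennreal (exp (\<phi> (fst y))) = ennreal (exp P)"
          by (subst ennreal_mult'[symmetric]) (auto simp: exp_add[symmetric])
        ultimately show ?thesis using yi by (simp add: mult.assoc[symmetric])
      qed auto
    qed
    finally show ?thesis .
  next
    case False
    then have "succ_set i = {}" "letter_set i = {}" using letter_in_I by (auto simp: succ_set_def letter_set_def)
    then show ?thesis by (simp add: branch_term_def)
  qed
  have "(\<integral>\<^sup>+p. Lop u p * v p \<partial>\<nu>) = (\<integral>\<^sup>+p. (\<Sum>i. branch_term i u p * v p) \<partial>\<nu>)"
    by (simp add: Lop_def)
  also have "\<dots> = (\<Sum>i. \<integral>\<^sup>+p. branch_term i u p * v p \<partial>\<nu>)"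
    by (intro nn_integral_suminf) measurable
  also have "\<dots> = (\<Sum>i. \<integral>\<^sup>+y. ennreal (exp P) * (u y * v (T y)) * indicator (letter_set i) y \<partial>\<nu>)"
    by (simp only: term_eq)
  also have "\<dots> = (\<integral>\<^sup>+y. (\<Sum>i. ennreal (exp P) * (u y * v (T y)) * indicator (letter_set i) y) \<partial>\<nu>)"
    by (intro nn_integral_suminf[symmetric]) measurable
  also have "\<dots> = (\<integral>\<^sup>+y. ennreal (exp P) * (u y * v (T y)) \<partial>\<nu>)"
  proof (rule nn_integral_cong)
    fix y assume "y \<in> space \<nu>"
    then have *: "indicator (letter_set i) y = (if i = fst y 0 then 1 else (0::ennreal))" for i
      by (auto simp: letter_set_def)
    have "(\<lambda>i. if i = fst y 0 then ennreal (exp P) * (u y * v (T y)) else 0) sums (ennreal (exp P) * (u y * v (T y)))"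
      by (rule sums_single)
    then have "(\<Sum>i. if i = fst y 0 then ennreal (exp P) * (u y * v (T y)) else 0) = ennreal (exp P) * (u y * v (T y))"
      by (rule sums_unique[symmetric])
    moreover have "(\<lambda>i. ennreal (exp P) * (u y * v (T y)) * indicator (letter_set i) y)
        = (\<lambda>i. if i = fst y 0 then ennreal (exp P) * (u y * v (T y)) else 0)"
      by (auto simp: *)
    ultimately show "(\<Sum>i. ennreal (exp P) * (u y * v (T y)) * indicator (letter_set i) y) = ennreal (exp P) * (u y * v (T y))"
      by simp
  qed
  also have "\<dots> = ennreal (exp P) * (\<integral>\<^sup>+p. u p * v (T p) \<partial>\<nu>)"
    by (intro nn_integral_cmult) measurable
  finally show ?thesis .
qed

lemma AE_T:
  assumes "AE p in \<nu>. Q p" shows "AE p in \<nu>. Q (T p)"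
proof -
  obtain N where N: "{p \<in> space \<nu>. \<not> Q p} \<subseteq> N" "emeasure \<nu> N = 0" "N \<in> sets \<nu>"
    using AE_E[OF assms] by blast
  then have [measurable]: "N \<in> sets MX" by (simp add: sets_\<nu>)
  have "ennreal (exp P) * (\<integral>\<^sup>+p. 1 * indicator N (T p) \<partial>\<nu>) = (\<integral>\<^sup>+p. Lop (\<lambda>_. 1) p * indicator N p \<partial>\<nu>)"
    by (rule Lop_duality[symmetric]) measurable
  also have "\<dots> = 0"
    using N by (subst nn_integral_0_iff_AE) (auto intro: AE_I[of _ _ N] simp: indicator_def)
  finally have "(\<integral>\<^sup>+p. indicator N (T p) \<partial>\<nu>) = 0" by (simp add: ennreal_mult_eq_top_iff)
  then have "AE p in \<nu>. indicator N (T p) = (0::ennreal)"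
    by (subst (asm) nn_integral_0_iff_AE) measurable
  then have "AE p in \<nu>. p \<in> space \<nu> \<and> T p \<notin> N"
    using AE_space[of \<nu>] by eventually_elim (auto simp: indicator_def split: if_splits)
  then show ?thesis
  proof eventually_elim
    case (elim p)
    then have "T p \<in> space \<nu>" by (simp only: space_\<nu> T_X)
    then show ?case using N(1) elim by blast
  qed
qed

text \<open>The map \<open>T ^^ n\<close> sends the cylinder of depth \<open>n + 1\<close> around \<open>p\<close> bijectively onto a full state, with
  Jacobian \<open>1 / weight n\<close>.\<close>

lemma cylinder_integral:
  assumes "p \<in> X" "E \<in> sets MX" "E \<subseteq> nb 1 ((T ^^ n) p)"
  shows "(\<integral>\<^sup>+y. ennreal (1 / weight n y) * indicator (nb (Suc n) p) y * indicator E ((T ^^ n) y) \<partial>\<nu>) = emeasure \<nu> E"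
  using assms
proof (induction n arbitrary: p)
  case 0
  then have "(\<integral>\<^sup>+y. ennreal (1 / weight 0 y) * indicator (nb (Suc 0) p) y * indicator E ((T ^^ 0) y) \<partial>\<nu>) = (\<integral>\<^sup>+y. indicator E y \<partial>\<nu>)"
    by (intro nn_integral_cong) (auto simp: indicator_def)
  then show ?case using 0 by (simp add: sets_\<nu>)
next
  case (Suc n)
  define i where "i = fst p 0"
  have i: "i \<in> I" using letter_in_I[OF Suc.prems(1)] by (simp add: i_def)
  define v where "v z = ennreal (1 / weight n z) * indicator (nb (Suc n) (T p)) z * indicator E ((T ^^ n) z)" for z
  have [measurable]: "v \<in> borel_measurable MX"
    unfolding v_def using Suc.prems(2) by measurable
  have "(\<integral>\<^sup>+y. ennreal (1 / weight (Suc n) y) * indicator (nb (Suc (Suc n)) p) y * indicator E ((T ^^ Suc n) y) \<partial>\<nu>)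
      = (\<integral>\<^sup>+y. ennreal (exp (P - \<phi> (fst y))) * indicator (letter_set i) y * v (T y) \<partial>\<nu>)"
  proof (rule nn_integral_cong)
    fix y assume "y \<in> space \<nu>"
    then have y: "y \<in> X" by simp
    have "y \<in> nb (Suc (Suc n)) p \<longleftrightarrow> y \<in> letter_set i \<and> T y \<in> nb (Suc n) (T p)"
    proof
      assume "y \<in> nb (Suc (Suc n)) p"
      then show "y \<in> letter_set i \<and> T y \<in> nb (Suc n) (T p)"
        using T_nb[of y "Suc n" p] by (auto simp: nb_def letter_set_def i_def)
    next
      assume *: "y \<in> letter_set i \<and> T y \<in> nb (Suc n) (T p)"
      then have "snd y \<otimes> \<Psi> [i] = snd p \<otimes> \<Psi> [i]" by (auto simp: nb_def letter_set_def i_def snd_T)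
      then have "snd y = snd p" using y Suc.prems(1) i by (auto simp: in_X)
      then have "y \<in> nb 1 p" using * y by (auto simp: nb_def letter_set_def i_def)
      then show "y \<in> nb (Suc (Suc n)) p" using * nb_add[of y 1 "Suc n" p] by simp
    qed
    moreover have "1 / weight (Suc n) y = exp (P - \<phi> (fst y)) * (1 / weight n (T y))"
      using weight_add[of 1 n y] by (simp add: weight_def birkhoff_sum_def exp_diff fst_T)
    moreover have "(T ^^ Suc n) y = (T ^^ n) (T y)" by (simp add: funpow_swap1)
    ultimately show "ennreal (1 / weight (Suc n) y) * indicator (nb (Suc (Suc n)) p) y * indicator E ((T ^^ Suc n) y)
        = ennreal (exp (P - \<phi> (fst y))) * indicator (letter_set i) y * v (T y)"
      by (auto simp: v_def indicator_def ennreal_mult'[symmetric])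
  qed
  also have "\<dots> = (\<integral>\<^sup>+z. v z * indicator (succ_set i) z \<partial>\<nu>)" by (rule branch_jacobian[OF i]) measurable
  also have "\<dots> = (\<integral>\<^sup>+z. v z \<partial>\<nu>)"
  proof (rule nn_integral_cong)
    fix z assume "z \<in> space \<nu>"
    have "z \<in> succ_set i" if "z \<in> nb (Suc n) (T p)"
    proof -
      have "fst z 0 = fst p 1" using that by (auto simp: nb_def fst_T left_shift_def)
      then show ?thesis using that i Suc.prems(1) by (auto simp: succ_set_def nb_def i_def in_X[of p] mshift_def)
    qed
    then show "v z * indicator (succ_set i) z = v z" by (auto simp: v_def indicator_def)
  qed
  also have "\<dots> = emeasure \<nu> E"
    unfolding v_def using Suc.prems by (intro Suc.IH) (auto simp: funpow_swap1)
  finally show ?case .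
qed

lemma cylinder_bounds:
  obtains C where "C > 0"
    "\<And>p E n. p \<in> X \<Longrightarrow> E \<in> sets MX \<Longrightarrow> E \<subseteq> nb 1 ((T ^^ n) p) \<Longrightarrow>
       ennreal (weight n p / C) * emeasure \<nu> E \<le> emeasure \<nu> {q \<in> nb (Suc n) p. (T ^^ n) q \<in> E}"
    "\<And>p E n. p \<in> X \<Longrightarrow> E \<in> sets MX \<Longrightarrow> E \<subseteq> nb 1 ((T ^^ n) p) \<Longrightarrow>
       emeasure \<nu> {q \<in> nb (Suc n) p. (T ^^ n) q \<in> E} \<le> ennreal (C * weight n p) * emeasure \<nu> E"
proof -
  obtain C where C: "C > 0" "\<And>n p q. p \<in> X \<Longrightarrow> q \<in> nb n p \<Longrightarrow> weight n q \<le> C * weight n p"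
    using weight_distortion by blast
  have main: "ennreal (weight n p / C) * emeasure \<nu> E \<le> emeasure \<nu> {q \<in> nb (Suc n) p. (T ^^ n) q \<in> E} \<and>
     emeasure \<nu> {q \<in> nb (Suc n) p. (T ^^ n) q \<in> E} \<le> ennreal (C * weight n p) * emeasure \<nu> E"
    if p: "p \<in> X" and E: "E \<in> sets MX" "E \<subseteq> nb 1 ((T ^^ n) p)" for p E n
  proof -
    define D where "D = {q \<in> nb (Suc n) p. (T ^^ n) q \<in> E}"
    have "D = nb (Suc n) p \<inter> ((T ^^ n) -` E \<inter> space MX)" by (auto simp: D_def nb_def)
    then have D: "D \<in> sets \<nu>" using measurable_sets[OF measurable_Tn E(1)] by (simp add: sets_\<nu> sets.Int)
    have w: "weight n q \<le> C * weight n p" "weight n p \<le> C * weight n q" if "q \<in> D" for q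
      using that C(2)[OF p, of q n] C(2)[of q p n] nb_sym[OF p, of q n] nb_mono[of n "Suc n" p] nb_subset[of n p]
      by (auto simp: D_def)
    have int: "(\<integral>\<^sup>+y. ennreal (1 / weight n y) * indicator D y \<partial>\<nu>) = emeasure \<nu> E"
      unfolding cylinder_integral[OF p E, symmetric] by (intro nn_integral_cong) (auto simp: D_def indicator_def)
    have "emeasure \<nu> E \<le> (\<integral>\<^sup>+y. ennreal (C / weight n p) * indicator D y \<partial>\<nu>)"
      unfolding int[symmetric]
    proof (intro nn_integral_mono)
      fix y assume "y \<in> space \<nu>"
      show "ennreal (1 / weight n y) * indicator D y \<le> ennreal (C / weight n p) * indicator D y"
        using w[of y] C(1) by (auto simp: indicator_def intro!: ennreal_leI simp: field_simps)
    qed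
    then have 1: "emeasure \<nu> E \<le> ennreal (C / weight n p) * emeasure \<nu> D"
      using D by (simp add: nn_integral_cmult_indicator)
    have "ennreal (weight n p / C) * emeasure \<nu> E \<le> ennreal (weight n p / C) * (ennreal (C / weight n p) * emeasure \<nu> D)"
      using 1 by (intro mult_left_mono) auto
    also have "\<dots> = emeasure \<nu> D"
      using C(1) by (simp add: mult.assoc[symmetric] ennreal_mult'[symmetric])
    finally have lo: "ennreal (weight n p / C) * emeasure \<nu> E \<le> emeasure \<nu> D" .
    have "(\<integral>\<^sup>+y. ennreal (1 / (C * weight n p)) * indicator D y \<partial>\<nu>) \<le> emeasure \<nu> E"
      unfolding int[symmetric]
    proof (intro nn_integral_mono)
      fix y assume "y \<in> space \<nu>"
      show "ennreal (1 / (C * weight n p)) * indicator D y \<le> ennreal (1 / weight n y) * indicator D y"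
        using w[of y] C(1) weight_pos[of n y] by (auto simp: indicator_def intro!: ennreal_leI simp: field_simps)
    qed
    then have 2: "ennreal (1 / (C * weight n p)) * emeasure \<nu> D \<le> emeasure \<nu> E"
      using D by (simp add: nn_integral_cmult_indicator)
    have "emeasure \<nu> D = ennreal (C * weight n p) * (ennreal (1 / (C * weight n p)) * emeasure \<nu> D)"
      using C(1) by (simp add: mult.assoc[symmetric] ennreal_mult'[symmetric])
    also have "\<dots> \<le> ennreal (C * weight n p) * emeasure \<nu> E" using 2 by (intro mult_left_mono) auto
    finally show ?thesis using lo by (simp add: D_def)
  qed
  show ?thesis by (rule that[OF C(1)]) (use main in blast)+
qed

lemma quasi_conformal_\<nu>: "quasi_conformal \<nu>"
  unfolding quasi_conformal_def
proof (intro conjI ballI)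
  obtain C where C: "C > 0"
    "\<And>p E n. p \<in> X \<Longrightarrow> E \<in> sets MX \<Longrightarrow> E \<subseteq> nb 1 ((T ^^ n) p) \<Longrightarrow>
       ennreal (weight n p / C) * emeasure \<nu> E \<le> emeasure \<nu> {q \<in> nb (Suc n) p. (T ^^ n) q \<in> E}"
    "\<And>p E n. p \<in> X \<Longrightarrow> E \<in> sets MX \<Longrightarrow> E \<subseteq> nb 1 ((T ^^ n) p) \<Longrightarrow>
       emeasure \<nu> {q \<in> nb (Suc n) p. (T ^^ n) q \<in> E} \<le> ennreal (C * weight n p) * emeasure \<nu> E"
    using cylinder_bounds by blast
  fix s g assume s: "s \<in> X" "g \<in> carrier G"
  obtain a where a: "emeasure \<nu> (nb 1 s) = ennreal a" "a > 0"
    using \<nu>_state[OF s(1)] by (cases "emeasure \<nu> (nb 1 s)") auto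
  define K where "K = max (C * a) (C / a)"
  have "K > 0" using C a by (auto simp: K_def less_max_iff_disj)
  moreover have "ennreal (weight n p / K) \<le> emeasure \<nu> (nb (Suc n) p) \<and> emeasure \<nu> (nb (Suc n) p) \<le> ennreal (K * weight n p)"
    if p: "p \<in> X" "(T ^^ n) p \<in> nb 1 s" for p n
  proof -
    have sub: "nb 1 s \<subseteq> nb 1 ((T ^^ n) p)" using nb_eq[OF p(2)] by simp
    have "{q \<in> nb (Suc n) p. (T ^^ n) q \<in> nb 1 s} = nb (Suc n) p"
      using nb_Suc_visit[OF p(1), of _ n n s] p(2) by blast
    then have b: "ennreal (weight n p / C) * ennreal a \<le> emeasure \<nu> (nb (Suc n) p)"
      "emeasure \<nu> (nb (Suc n) p) \<le> ennreal (C * weight n p) * ennreal a"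
      using C(2)[OF p(1) nb_sets sub] C(3)[OF p(1) nb_sets sub] a by auto
    have "weight n p / K \<le> weight n p / C * a"
    proof -
      have "C / a \<le> K" by (simp add: K_def)
      then have "C \<le> K * a" using a by (simp add: field_simps)
      then show ?thesis using C(1) \<open>K > 0\<close> weight_pos[of n p] by (simp add: field_simps)
    qed
    then have "ennreal (weight n p / K) \<le> ennreal (weight n p / C) * ennreal a"
      using a C by (subst ennreal_mult'[symmetric]) (auto intro: ennreal_leI)
    moreover have "C * weight n p * a \<le> K * weight n p"
      using weight_pos[of n p] by (simp add: K_def mult.commute mult.left_commute)
    then have "ennreal (C * weight n p) * ennreal a \<le> ennreal (K * weight n p)"
      using a C by (subst ennreal_mult'[symmetric]) (auto intro: ennreal_leI)
    ultimately show ?thesis using b by (meson order_trans)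
  qed
  ultimately show "\<exists>K>0. \<forall>p\<in>X. \<forall>n. snd p = g \<longrightarrow> (T ^^ n) p \<in> nb 1 s \<longrightarrow>
        ennreal (weight n p / K) \<le> emeasure \<nu> (nb (Suc n) p) \<and>
        emeasure \<nu> (nb (Suc n) p) \<le> ennreal (K * weight n p)" by blast
qed (rule sets_\<nu>)

end

section \<open>The invariant measure of the twisted potential\<close>

lemma infinite_suminf_indicator:
  assumes "\<exists>\<^sub>\<infinity>n. n \<in> B"
  shows "(\<Sum>n. indicator B n :: ennreal) = \<infinity>"
proof (rule ccontr)
  assume "(\<Sum>n. indicator B n :: ennreal) \<noteq> \<infinity>"
  then have "(\<Sum>n. ennreal (indicator B n)) \<noteq> \<infinity>" by (simp add: ennreal_indicator)
  then have "summable (indicator B :: nat \<Rightarrow> real)"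
    unfolding infinity_ennreal_def by (intro summable_suminf_not_top) auto
  then have "indicator B \<longlonglongrightarrow> (0::real)" by (rule summable_LIMSEQ_zero)
  then have "\<forall>\<^sub>F n in sequentially. indicator B n < (1::real)" by (rule order_tendstoD) simp
  then have "\<forall>\<^sub>F n in sequentially. n \<notin> B" by eventually_elim (auto simp: indicator_def split: if_splits)
  then show False using assms by (simp add: frequently_def cofinite_eq_sequentially)
qed

context group_extension
begin

definition never_return :: "(nat \<Rightarrow> nat) \<times> 'g \<Rightarrow> ((nat \<Rightarrow> nat) \<times> 'g) set" where
  "never_return s = {p \<in> nb 1 s. \<forall>n\<ge>1. (T ^^ n) p \<notin> nb 1 s}"

definition return_set :: "nat \<Rightarrow> (nat \<Rightarrow> nat) \<times> 'g \<Rightarrow> ((nat \<Rightarrow> nat) \<times> 'g) set" where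
  "return_set n s = {p \<in> nb 1 s. (T ^^ n) p \<in> nb 1 s}"

lemma measurable_Tn_in [measurable]:
  assumes "B \<in> sets MX" shows "{p \<in> X. (T ^^ n) p \<in> B} \<in> sets MX"
proof -
  have "{p \<in> X. (T ^^ n) p \<in> B} = (T ^^ n) -` B \<inter> space MX" by auto
  then show ?thesis using measurable_sets[OF measurable_Tn assms] by simp
qed

lemma return_set_sets [measurable]: "return_set n s \<in> sets MX"
proof -
  have "return_set n s = nb 1 s \<inter> {p \<in> X. (T ^^ n) p \<in> nb 1 s}" by (auto simp: return_set_def nb_def)
  also have "\<dots> \<in> sets MX" by (intro sets.Int nb_sets measurable_Tn_in)
  finally show ?thesis .
qed

lemma never_return_sets [measurable]: "never_return s \<in> sets MX"
proof -
  have "never_return s = nb 1 s - (\<Union>n\<in>{1..}. return_set n s)" by (auto simp: never_return_def return_set_def)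
  then show ?thesis by (simp add: sets.Diff sets.countable_UN' nb_sets return_set_sets)
qed

lemma never_return_unique:
  assumes "(T ^^ m) p \<in> never_return s" "(T ^^ n) p \<in> nb 1 s" shows "n \<le> m"
proof (rule ccontr)
  assume "\<not> n \<le> m"
  then have "(T ^^ (n - m)) ((T ^^ m) p) = (T ^^ n) p" "n - m \<ge> 1"
    by (auto simp flip: funpow_add comp_apply[of "T ^^ (n - m)"])
  then show False using assms unfolding never_return_def by auto
qed

text \<open>An orbit that starts in the state of \<open>s\<close> and returns only finitely often meets \<open>never_return s\<close> at
  the time of its last visit.\<close>

lemma returns_from_never_return:
  assumes M: "sets \<theta> = sets MX" and null: "emeasure \<theta> (never_return s) = 0"
    and nonsing: "\<And>Q. AE p in \<theta>. Q p \<Longrightarrow> AE p in \<theta>. Q (T p)"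
  shows "AE p in \<theta>. p \<in> nb 1 s \<longrightarrow> (\<exists>\<^sub>\<infinity>n. (T ^^ n) p \<in> nb 1 s)"
proof -
  have "never_return s \<in> null_sets \<theta>" using null M by auto
  then have 0: "AE p in \<theta>. p \<notin> never_return s" by (rule AE_not_in)
  have "AE p in \<theta>. (T ^^ m) p \<notin> never_return s" for m
  proof (induction m)
    case (Suc m)
    show ?case using nonsing[OF Suc] by (simp add: funpow_swap1)
  qed (use 0 in simp)
  then have "AE p in \<theta>. \<forall>m. (T ^^ m) p \<notin> never_return s" by (simp add: AE_all_countable)
  then show ?thesis
  proof eventually_elim
    case (elim p)
    show ?case
    proof (rule impI, rule ccontr)
      assume p: "p \<in> nb 1 s" "\<not> (\<exists>\<^sub>\<infinity>n. (T ^^ n) p \<in> nb 1 s)"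
      define N where "N = {n. (T ^^ n) p \<in> nb 1 s}"
      have N: "finite N" "N \<noteq> {}" using p by (auto simp: N_def INFM_iff_infinite intro: exI[of _ 0])
      define m where "m = Max N"
      have m: "m \<in> N" "\<And>n. n \<in> N \<Longrightarrow> n \<le> m" using N by (auto simp: m_def)
      have "(T ^^ n) ((T ^^ m) p) \<notin> nb 1 s" if "n \<ge> 1" for n
      proof
        assume "(T ^^ n) ((T ^^ m) p) \<in> nb 1 s"
        then have "n + m \<in> N" by (simp add: N_def funpow_add)
        then show False using m(2) that by fastforce
      qed
      then have "(T ^^ m) p \<in> never_return s" using m(1) unfolding never_return_def N_def by blast
      then show False using elim by blast
    qed
  qed
qed

lemma measurable_fst_base: "fst \<in> measurable MX (borel_of (shift_topology I A))"
proof (rule measurable_sigma_sets[OF sets_borel_of])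
  show "{U. openin (shift_topology I A) U} \<subseteq> Pow (topspace (shift_topology I A))"
    using openin_subset by auto
  have ts: "topspace (shift_topology I A) = mshift I A"
    by (auto simp: shift_topology_def PiE_iff mshift_def)
  show "fst \<in> space MX \<rightarrow> topspace (shift_topology I A)"
    unfolding ts by (auto simp: in_X)
  fix U assume "U \<in> {U. openin (shift_topology I A) U}"
  then have U: "\<And>x. x \<in> U \<Longrightarrow> \<exists>n. \<forall>y\<in>mshift I A. (\<forall>k<n. y k = x k) \<longrightarrow> y \<in> U"
    by (auto simp: openin_shift_topology)
  show "fst -` U \<inter> space MX \<in> sets MX"
  proof (rule open_sets_MX)
    fix p assume p: "p \<in> fst -` U \<inter> space MX"
    then obtain n where "\<forall>y\<in>mshift I A. (\<forall>k<n. y k = fst p k) \<longrightarrow> y \<in> U" using U[of "fst p"] by auto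
    then have "nb n p \<subseteq> fst -` U \<inter> space MX" by (auto simp: nb_def in_X)
    then show "\<exists>n. nb n p \<subseteq> fst -` U \<inter> space MX" by blast
  qed auto
qed

lemma topspace_shift [simp]: "topspace (shift_topology I A) = mshift I A"
  by (auto simp: shift_topology_def PiE_iff mshift_def)

lemma nb_eq_Times: "p \<in> X \<Longrightarrow> nb n p = cylinder I A (map (fst p) [0..<n]) \<times> {snd p}"
  by (auto simp: nb_def cylinder_def in_X)

lemma cylinder_open: "openin (shift_topology I A) (cylinder I A w)"
  unfolding openin_shift_topology cylinder_def by (auto intro!: exI[of _ "length w"])

lemma cylinder_sets: "cylinder I A w \<in> sets (borel_of (shift_topology I A))"
  unfolding sets_borel_of using cylinder_open by (intro sigma_sets.Basic) auto

lemma sets_product: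
  assumes M: "sets \<mu> = sets (borel_of (shift_topology I A))"
  shows "sets (\<mu> \<Otimes>\<^sub>M haar G) = sets MX"
proof
  have "sets (\<mu> \<Otimes>\<^sub>M haar G) = sets (borel_of (shift_topology I A) \<Otimes>\<^sub>M haar G)"
    by (rule sets_pair_measure_cong) (auto simp: M)
  also have "\<dots> \<subseteq> sets MX"
  proof -
    have "a \<times> b \<in> sets MX" if a: "a \<in> sets (borel_of (shift_topology I A))" and b: "b \<in> sets (haar G)" for a b
    proof -
      have "fst -` a \<inter> X \<in> sets MX" "snd -` b \<inter> X \<in> sets MX"
        using measurable_sets[OF measurable_fst_base a] measurable_sets[OF measurable_snd', of b] by simp_all
      then have "(fst -` a \<inter> X) \<inter> (snd -` b \<inter> X) \<in> sets MX" by (rule sets.Int)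
      also have "(fst -` a \<inter> X) \<inter> (snd -` b \<inter> X) = a \<times> b"
        using b sets.sets_into_space[OF a] by (auto simp: in_X)
      finally show ?thesis .
    qed
    then have "{a \<times> b |a b. a \<in> sets (borel_of (shift_topology I A)) \<and> b \<in> sets (haar G)} \<subseteq> sets MX"
      by blast
    moreover have "space (borel_of (shift_topology I A)) \<times> space (haar G) = space MX"
      by (simp add: ext_space_def)
    ultimately show ?thesis unfolding sets_pair_measure by (simp only: sets.sigma_sets_subset)
  qed
  finally show "sets (\<mu> \<Otimes>\<^sub>M haar G) \<subseteq> sets MX" .
  have sp: "space (\<mu> \<Otimes>\<^sub>M haar G) = X"
    using sets_eq_imp_space_eq[OF M] by (simp add: space_pair_measure ext_space_def)
  have "nb (Suc n) p \<in> sets (\<mu> \<Otimes>\<^sub>M haar G)" if "p \<in> X" for n p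
    unfolding nb_eq_Times[OF that] using that by (intro pair_measureI) (auto simp: M cylinder_sets in_X)
  then have "{nb (Suc n) p |n p. p \<in> X} \<subseteq> sets (\<mu> \<Otimes>\<^sub>M haar G)" by blast
  then show "sets MX \<subseteq> sets (\<mu> \<Otimes>\<^sub>M haar G)"
    unfolding sets_MX_nb using sets.sigma_sets_subset[of _ "\<mu> \<Otimes>\<^sub>M haar G"] unfolding sp by blast
qed

lemma sigma_finite_haar: "sigma_finite_measure (haar G)"
  by (rule sigma_finite_measure_count_space_countable) (rule countable_G)

lemma product_slice:
  assumes "g \<in> carrier G" "B \<in> sets \<mu>"
  shows "emeasure (\<mu> \<Otimes>\<^sub>M haar G) (B \<times> {g}) = emeasure \<mu> B"
  using assms by (subst sigma_finite_measure.emeasure_pair_measure_Times[OF sigma_finite_haar]) auto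

lemma measurable_left_shift: "left_shift \<in> measurable (borel_of (shift_topology I A)) (borel_of (shift_topology I A))"
proof (rule measurable_sigma_sets[OF sets_borel_of])
  show "{U. openin (shift_topology I A) U} \<subseteq> Pow (topspace (shift_topology I A))"
    by (auto dest: openin_subset simp del: topspace_shift)
  show "left_shift \<in> space (borel_of (shift_topology I A)) \<rightarrow> topspace (shift_topology I A)"
    by (auto simp: left_shift_mshift)
  fix U assume "U \<in> {U. openin (shift_topology I A) U}"
  then have U: "\<And>x. x \<in> U \<Longrightarrow> \<exists>n. \<forall>y\<in>mshift I A. (\<forall>k<n. y k = x k) \<longrightarrow> y \<in> U"
    by (auto simp: openin_shift_topology)
  have "openin (shift_topology I A) (left_shift -` U \<inter> mshift I A)"
    unfolding openin_shift_topology
  proof (intro conjI ballI)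
    fix x assume x: "x \<in> left_shift -` U \<inter> mshift I A"
    then obtain n where n: "\<forall>y\<in>mshift I A. (\<forall>k<n. y k = left_shift x k) \<longrightarrow> y \<in> U" using U[of "left_shift x"] by auto
    show "\<exists>n. \<forall>y\<in>mshift I A. (\<forall>k<n. y k = x k) \<longrightarrow> y \<in> left_shift -` U \<inter> mshift I A"
    proof (intro exI[of _ "Suc n"] ballI impI)
      fix y assume y: "y \<in> mshift I A" "\<forall>k<Suc n. y k = x k"
      then have "left_shift y \<in> U" using n left_shift_mshift[OF y(1)] by (auto simp: left_shift_def)
      then show "y \<in> left_shift -` U \<inter> mshift I A" using y by simp
    qed
  qed auto
  then show "left_shift -` U \<inter> space (borel_of (shift_topology I A)) \<in> sets (borel_of (shift_topology I A))"
    unfolding sets_borel_of by (intro sigma_sets.Basic) simp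
qed

text \<open>Fibrewise \<open>T\<close> is a right translation of \<open>G\<close>, under which counting measure is invariant.\<close>

lemma product_invariant:
  assumes M: "sets \<mu> = sets (borel_of (shift_topology I A))" and fin: "prob_space \<mu>"
    and inv: "\<And>B. B \<in> sets \<mu> \<Longrightarrow> emeasure \<mu> (left_shift -` B \<inter> space \<mu>) = emeasure \<mu> B"
    and B: "B \<in> sets MX"
  shows "emeasure (\<mu> \<Otimes>\<^sub>M haar G) {p \<in> X. T p \<in> B} = emeasure (\<mu> \<Otimes>\<^sub>M haar G) B"
proof -
  interpret haar: sigma_finite_measure "haar G" by (rule sigma_finite_haar)
  have sp: "space \<mu> = mshift I A" using sets_eq_imp_space_eq[OF M] by simp
  have m: "left_shift \<in> measurable \<mu> \<mu>" using measurable_left_shift measurable_cong_sets[OF M M] by simp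
  have d: "distr \<mu> \<mu> left_shift = \<mu>"
    by (rule measure_eqI) (auto simp: emeasure_distr m inv)
  have Bp: "B \<in> sets (\<mu> \<Otimes>\<^sub>M haar G)" using B sets_product[OF M] by simp
  have Cp: "{p \<in> X. T p \<in> B} \<in> sets (\<mu> \<Otimes>\<^sub>M haar G)"
    using measurable_Tn_in[OF B, of 1] sets_product[OF M] by simp
  have "emeasure (\<mu> \<Otimes>\<^sub>M haar G) {p \<in> X. T p \<in> B} = (\<integral>\<^sup>+x. emeasure (haar G) (Pair x -` {p \<in> X. T p \<in> B}) \<partial>\<mu>)"
    by (rule haar.emeasure_pair_measure_alt[OF Cp])
  also have "\<dots> = (\<integral>\<^sup>+x. emeasure (haar G) (Pair (left_shift x) -` B) \<partial>\<mu>)"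
  proof (rule nn_integral_cong)
    fix x assume "x \<in> space \<mu>"
    then have x: "x \<in> mshift I A" by (simp add: sp)
    have i: "x 0 \<in> I" using x by (auto simp: mshift_def)
    have BX: "B \<subseteq> X" using sets.sets_into_space[OF B] by simp
    have "bij_betw (\<lambda>g. g \<otimes> \<Psi> [x 0]) (Pair x -` {p \<in> X. T p \<in> B}) (Pair (left_shift x) -` B)"
    proof (rule bij_betw_byWitness[where f' = "\<lambda>g. g \<otimes> inv (\<Psi> [x 0])"])
      show "\<forall>a\<in>Pair x -` {p \<in> X. T p \<in> B}. a \<otimes> \<Psi> [x 0] \<otimes> inv \<Psi> [x 0] = a"
        using i by (auto simp: in_X G.m_assoc)
      show "\<forall>a\<in>Pair (left_shift x) -` B. a \<otimes> inv \<Psi> [x 0] \<otimes> \<Psi> [x 0] = a"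
        using i BX by (auto simp: in_X G.m_assoc dest!: subsetD)
      show "(\<lambda>g. g \<otimes> \<Psi> [x 0]) ` (Pair x -` {p \<in> X. T p \<in> B}) \<subseteq> Pair (left_shift x) -` B"
        by (auto simp: ext_map_def)
      show "(\<lambda>g. g \<otimes> inv (\<Psi> [x 0])) ` (Pair (left_shift x) -` B) \<subseteq> Pair x -` {p \<in> X. T p \<in> B}"
        using i BX x by (auto simp: ext_map_def in_X G.m_assoc dest!: subsetD)
    qed
    moreover have "Pair x -` {p \<in> X. T p \<in> B} \<subseteq> carrier G" "Pair (left_shift x) -` B \<subseteq> carrier G"
      using BX by (auto simp: in_X dest!: subsetD)
    ultimately show "emeasure (haar G) (Pair x -` {p \<in> X. T p \<in> B}) = emeasure (haar G) (Pair (left_shift x) -` B)"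
      by (simp add: emeasure_count_space bij_betw_finite bij_betw_same_card)
  qed
  also have "\<dots> = (\<integral>\<^sup>+x. emeasure (haar G) (Pair x -` B) \<partial>distr \<mu> \<mu> left_shift)"
    by (rule nn_integral_distr[symmetric]) (simp_all add: m haar.measurable_emeasure_Pair[OF Bp])
  also have "\<dots> = emeasure (\<mu> \<Otimes>\<^sub>M haar G) B"
    unfolding d by (rule haar.emeasure_pair_measure_alt[OF Bp, symmetric])
  finally show ?thesis .
qed

end

locale gibbs_extension = group_extension_potential I A G \<Psi> \<phi> P
  for I :: "nat set" and A :: "nat \<Rightarrow> nat \<Rightarrow> bool"
    and G :: "('g, 'm) monoid_scheme" (structure) and \<Psi> :: "nat list \<Rightarrow> 'g"
    and \<phi> :: "(nat \<Rightarrow> nat) \<Rightarrow> real" and P :: real +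
  fixes c :: "'g \<Rightarrow> real" and \<mu> :: "(nat \<Rightarrow> nat) measure"
  assumes hom_c: "c \<in> hom G pos_reals"
    and gibbs: "invariant_gibbs_measure I A (twisted_potential \<Psi> c \<phi>) \<mu>"
    and pressure_c: "P = real_of_ereal (gurevich_pressure I A (twisted_potential \<Psi> c \<phi>))"
    and conservative_m: "conservative T (\<mu> \<Otimes>\<^sub>M haar G)"
begin

abbreviation "m \<equiv> \<mu> \<Otimes>\<^sub>M haar G"

lemma sets_\<mu>: "sets \<mu> = sets (borel_of (shift_topology I A))"
  using gibbs by (simp add: invariant_gibbs_measure_def)

lemma prob_\<mu>: "prob_space \<mu>"
  using gibbs by (simp add: invariant_gibbs_measure_def)

lemma space_\<mu>: "space \<mu> = mshift I A"
  using sets_eq_imp_space_eq[OF sets_\<mu>] by simp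

lemma sets_m [measurable_cong]: "sets m = sets MX"
  by (rule sets_product[OF sets_\<mu>])

lemma space_m: "space m = X"
  using sets_eq_imp_space_eq[OF sets_m] by simp

lemma X_nonempty: "X \<noteq> {}"
proof -
  have "mshift I A \<noteq> {}" using prob_space.not_empty[OF prob_\<mu>] space_\<mu> by simp
  then show ?thesis using G.one_closed by (auto simp: ext_space_def)
qed

lemma c_pos [simp]: "g \<in> carrier G \<Longrightarrow> c g > 0"
  using hom_c by (auto simp: hom_def pos_reals_def)

lemma c_mult: "g \<in> carrier G \<Longrightarrow> k \<in> carrier G \<Longrightarrow> c (g \<otimes> k) = c g * c k"
  using hom_c by (auto simp: hom_def pos_reals_def)

lemma c_one: "c \<one> = 1"
  using c_mult[of \<one> \<one>] c_pos[OF G.one_closed] by auto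

lemma snd_Tn_carrier: "p \<in> X \<Longrightarrow> snd ((T ^^ n) p) \<in> carrier G"
  using Tn_X in_X by blast

lemma birkhoff_twisted:
  assumes "p \<in> X"
  shows "birkhoff_sum n (twisted_potential \<Psi> c \<phi>) (fst p) =
    birkhoff_sum n \<phi> (fst p) + ln (c (snd p)) - ln (c (snd ((T ^^ n) p)))"
proof (induction n)
  case (Suc n)
  define q where "q = (T ^^ n) p"
  have q: "snd q \<in> carrier G" "fst q 0 \<in> I"
    using assms letter_in_I[of q 0] by (auto simp: q_def snd_Tn_carrier)
  have "ln (c (snd (T q))) = ln (c (snd q)) + ln (c (\<Psi> [fst q 0]))"
    using q by (simp add: snd_T c_mult ln_mult_pos)
  moreover have "birkhoff_sum (Suc n) f (fst p) = birkhoff_sum n f (fst p) + f (fst q)" for f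
    by (simp add: birkhoff_sum_def q_def fst_Tn)
  ultimately show ?case using Suc by (simp add: twisted_potential_def q_def)
qed simp

text \<open>The analogue of \<open>weight\<close> for the twisted potential: the product of the values of \<open>c\<close> along the orbit
  telescopes to a quotient of the values at its ends.\<close>

definition weight_c :: "nat \<Rightarrow> (nat \<Rightarrow> nat) \<times> 'g \<Rightarrow> real" where
  "weight_c n p = weight n p * (c (snd p) / c (snd ((T ^^ n) p)))"

lemma weight_c_eq:
  assumes "p \<in> X"
  shows "weight_c n p = exp (birkhoff_sum n (twisted_potential \<Psi> c \<phi>) (fst p) - real n * P)"
proof -
  have "c (snd p) > 0" "c (snd ((T ^^ n) p)) > 0" using assms snd_Tn_carrier[of p] in_X by auto
  then show ?thesis
    by (simp add: birkhoff_twisted[OF assms] weight_c_def weight_def exp_diff exp_add)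
qed

lemma weight_c_pos: "p \<in> X \<Longrightarrow> weight_c n p > 0"
  by (simp add: weight_c_eq)

lemma m_nb: "p \<in> X \<Longrightarrow> emeasure m (nb n p) = emeasure \<mu> (cylinder I A (map (fst p) [0..<n]))"
  by (subst nb_eq_Times) (auto simp: product_slice in_X sets_\<mu> cylinder_sets)

lemma m_nb_bounds:
  obtains C where "C > 0"
    "\<And>p n. p \<in> X \<Longrightarrow> n \<ge> 1 \<Longrightarrow> ennreal (weight_c n p / C) \<le> emeasure m (nb n p)"
    "\<And>p n. p \<in> X \<Longrightarrow> n \<ge> 1 \<Longrightarrow> emeasure m (nb n p) \<le> ennreal (C * weight_c n p)"
proof -
  interpret \<mu>: prob_space \<mu> by (rule prob_\<mu>)
  obtain C where C: "C > 0" "\<And>n w x. n \<ge> 1 \<Longrightarrow> w \<in> words_of_length I A n \<Longrightarrow> x \<in> cylinder I A w \<Longrightarrow>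
     inverse C \<le> measure \<mu> (cylinder I A w) * exp (- birkhoff_sum n (twisted_potential \<Psi> c \<phi>) x + real n * P) \<and>
     measure \<mu> (cylinder I A w) * exp (- birkhoff_sum n (twisted_potential \<Psi> c \<phi>) x + real n * P) \<le> C"
    using gibbs unfolding invariant_gibbs_measure_def pressure_c[symmetric] Let_def by blast
  have "weight_c n p / C \<le> measure \<mu> (cylinder I A (map (fst p) [0..<n])) \<and>
      measure \<mu> (cylinder I A (map (fst p) [0..<n])) \<le> C * weight_c n p" if p: "p \<in> X" "n \<ge> 1" for p n
  proof -
    have "map (fst p) [0..<n] \<in> words_of_length I A n"
      using p by (auto simp: words_of_length_def successively_conv_nth in_X mshift_def)
    moreover have "fst p \<in> cylinder I A (map (fst p) [0..<n])" using p by (auto simp: cylinder_def in_X)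
    moreover have "exp (- birkhoff_sum n (twisted_potential \<Psi> c \<phi>) (fst p) + real n * P) = inverse (weight_c n p)"
      unfolding weight_c_eq[OF p(1)] by (simp add: exp_minus[symmetric])
    ultimately have "inverse C \<le> measure \<mu> (cylinder I A (map (fst p) [0..<n])) * inverse (weight_c n p) \<and>
      measure \<mu> (cylinder I A (map (fst p) [0..<n])) * inverse (weight_c n p) \<le> C"
      using C(2)[OF p(2)] by metis
    then show ?thesis using C(1) weight_c_pos[OF p(1), of n] by (simp add: field_simps)
  qed
  then show ?thesis
    using that[OF C(1)] by (simp add: m_nb \<mu>.emeasure_eq_measure ennreal_leI)
qed

lemma m_state_le_1: "s \<in> X \<Longrightarrow> emeasure m (nb n s) \<le> 1"
  by (simp add: m_nb prob_space.emeasure_le_1[OF prob_\<mu>])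

lemma quasi_conformal_m: "quasi_conformal m"
  unfolding quasi_conformal_def
proof (intro conjI ballI)
  obtain C where C: "C > 0" "\<And>n p q. p \<in> X \<Longrightarrow> q \<in> nb n p \<Longrightarrow> weight n q \<le> C * weight n p"
    using weight_distortion by blast
  obtain D where D: "D > 0"
    "\<And>p n. p \<in> X \<Longrightarrow> n \<ge> 1 \<Longrightarrow> ennreal (weight_c n p / D) \<le> emeasure m (nb n p)"
    "\<And>p n. p \<in> X \<Longrightarrow> n \<ge> 1 \<Longrightarrow> emeasure m (nb n p) \<le> ennreal (D * weight_c n p)"
    using m_nb_bounds by blast
  fix s g assume s: "s \<in> X" "g \<in> carrier G"
  define a where "a = weight 1 s * (c g / c (snd (T s)))"
  have a: "a > 0" using s snd_Tn_carrier[OF s(1), of 1] by (simp add: a_def)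
  define K where "K = max (D * C * a) (D * C / a)"
  have K: "K > 0" using C D a by (auto simp: K_def less_max_iff_disj)
  have "ennreal (weight n p / K) \<le> emeasure m (nb (Suc n) p) \<and> emeasure m (nb (Suc n) p) \<le> ennreal (K * weight n p)"
    if p: "p \<in> X" "snd p = g" "(T ^^ n) p \<in> nb 1 s" for p n
  proof -
    define q where "q = (T ^^ n) p"
    have q: "q \<in> nb 1 s" "q \<in> X" using p by (auto simp: q_def)
    have b: "weight 1 q \<le> C * weight 1 s" "weight 1 s \<le> C * weight 1 q"
      using C(2)[OF s(1) q(1)] C(2)[OF q(2) nb_sym[OF s(1) q(1)]] by auto
    have sT: "snd (T q) = snd (T s)" using q by (auto simp: nb_def snd_T)
    have "weight (Suc n) p = weight n p * weight 1 q" using weight_add[of n 1 p] by (simp add: q_def)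
    moreover have "(T ^^ Suc n) p = T q" by (simp add: q_def)
    ultimately have w: "weight_c (Suc n) p = weight n p * (weight 1 q * (c g / c (snd (T s))))"
      unfolding weight_c_def by (simp add: sT p(2))
    define t where "t = c g / c (snd (T s))"
    have t: "t > 0" using s snd_Tn_carrier[OF s(1), of 1] by (simp add: t_def)
    have "weight 1 q * t \<le> C * a" "a \<le> C * (weight 1 q * t)"
      using b t unfolding a_def t_def[symmetric] by (auto simp: mult_right_mono mult.assoc[symmetric])
    then have wc: "weight_c (Suc n) p \<le> weight n p * (C * a)" "weight n p * a \<le> C * weight_c (Suc n) p"
      unfolding w t_def[symmetric] by (auto simp: mult_left_mono mult.left_commute)
    have "D * weight_c (Suc n) p \<le> D * (weight n p * (C * a))" using wc D by (intro mult_left_mono) auto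
    also have "\<dots> = (D * C * a) * weight n p" by (simp add: mult_ac)
    also have "\<dots> \<le> K * weight n p" by (intro mult_right_mono) (auto simp: K_def)
    finally have 1: "D * weight_c (Suc n) p \<le> K * weight n p" .
    have "D * C / a \<le> K" by (simp add: K_def)
    then have "D * C \<le> K * a" using a by (simp add: field_simps)
    have "weight n p * (D * C) \<le> weight n p * (K * a)"
      using \<open>D * C \<le> K * a\<close> by (intro mult_left_mono) auto
    also have "\<dots> = K * (weight n p * a)" by (simp add: mult_ac)
    also have "\<dots> \<le> K * (C * weight_c (Suc n) p)" using wc K by (intro mult_left_mono) auto
    finally have "weight n p * D * C \<le> K * weight_c (Suc n) p * C" by (simp add: mult_ac)
    then have "weight n p * D \<le> K * weight_c (Suc n) p" using C(1) by simp
    then have 2: "weight n p / K \<le> weight_c (Suc n) p / D" using K D(1) by (simp add: field_simps)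
    show ?thesis using order_trans[OF ennreal_leI[OF 2] D(2)[OF p(1), of "Suc n"]]
        order_trans[OF D(3)[OF p(1), of "Suc n"] ennreal_leI[OF 1]] by simp
  qed
  with K show "\<exists>K>0. \<forall>p\<in>X. \<forall>n. snd p = g \<longrightarrow> (T ^^ n) p \<in> nb 1 s \<longrightarrow>
        ennreal (weight n p / K) \<le> emeasure m (nb (Suc n) p) \<and>
        emeasure m (nb (Suc n) p) \<le> ennreal (K * weight n p)" by blast
qed (rule sets_m)

lemma m_invariant: "B \<in> sets MX \<Longrightarrow> emeasure m {p \<in> X. T p \<in> B} = emeasure m B"
  using gibbs by (intro product_invariant sets_\<mu> prob_\<mu>) (auto simp: invariant_gibbs_measure_def)

lemma AE_m_T:
  assumes "AE p in m. Q p" shows "AE p in m. Q (T p)"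
proof -
  obtain N where N: "{p \<in> space m. \<not> Q p} \<subseteq> N" "emeasure m N = 0" "N \<in> sets m"
    using AE_E[OF assms] by blast
  have N': "N \<in> sets MX" using N by (simp add: sets_m)
  have "{p \<in> X. T p \<in> N} \<in> null_sets m"
    using m_invariant[OF N'] N measurable_Tn_in[OF N', of 1] by (auto simp: sets_m)
  moreover have "{p \<in> space m. \<not> Q (T p)} \<subseteq> {p \<in> X. T p \<in> N}"
    unfolding space_m using N(1)[unfolded space_m] T_X by blast
  ultimately show ?thesis by (rule AE_I')
qed

text \<open>The points that never return to a state form a wandering set.\<close>

lemma m_never_return: "emeasure m (never_return s) = 0"
proof -
  have "disjoint_family (\<lambda>n. (T ^^ n) -` never_return s \<inter> space m)"
    unfolding disjoint_family_on_def
  proof (intro ballI impI)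
    fix a b :: nat assume "a \<noteq> b"
    have "False" if "(T ^^ a) p \<in> never_return s" "(T ^^ b) p \<in> never_return s" for p
    proof -
      have "never_return s \<subseteq> nb 1 s" by (auto simp: never_return_def)
      then have "b \<le> a" "a \<le> b"
        using never_return_unique[OF that(1), of b] never_return_unique[OF that(2), of a] that by blast+
      then show False using \<open>a \<noteq> b\<close> by simp
    qed
    then show "(T ^^ a) -` never_return s \<inter> space m \<inter> ((T ^^ b) -` never_return s \<inter> space m) = {}" by blast
  qed
  then show ?thesis using conservative_m never_return_sets unfolding conservative_def sets_m by blast
qed

lemma m_returns: "AE p in m. p \<in> nb 1 s \<longrightarrow> (\<exists>\<^sub>\<infinity>n. (T ^^ n) p \<in> nb 1 s)"
  by (rule returns_from_never_return[OF sets_m m_never_return AE_m_T])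

lemma m_visits: "s \<in> X \<Longrightarrow> AE p in m. \<exists>\<^sub>\<infinity>n. (T ^^ n) p \<in> nb 1 s"
  by (rule visits_every_state[OF quasi_conformal_m m_returns AE_m_T])

lemma m_return_sum:
  assumes s: "s \<in> X"
  shows "(\<Sum>n. emeasure m (return_set n s)) = \<infinity>"
proof -
  have "(\<Sum>n. emeasure m (return_set n s)) = (\<Sum>n. \<integral>\<^sup>+p. indicator (return_set n s) p \<partial>m)"
    by (simp add: sets_m)
  also have "\<dots> = (\<integral>\<^sup>+p. (\<Sum>n. indicator (return_set n s) p) \<partial>m)"
    by (intro nn_integral_suminf[symmetric]) (simp add: sets_m)
  also have "\<dots> = (\<integral>\<^sup>+p. \<infinity> * indicator (nb 1 s) p \<partial>m)"
  proof (rule nn_integral_cong_AE)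
    show "AE p in m. (\<Sum>n. indicator (return_set n s) p) = (\<infinity>::ennreal) * indicator (nb 1 s) p"
      using m_returns[of s]
    proof eventually_elim
      case (elim p)
      show ?case
      proof (cases "p \<in> nb 1 s")
        case True
        have "(\<Sum>n. indicator (return_set n s) p) = (\<Sum>n. indicator {n. (T ^^ n) p \<in> nb 1 s} n :: ennreal)"
          using True by (intro suminf_cong) (auto simp: return_set_def indicator_def)
        also have "\<dots> = \<infinity>" using elim True by (intro infinite_suminf_indicator) auto
        finally show ?thesis using True by simp
      next
        case False
        then have "indicator (return_set n s) p = (0::ennreal)" for n by (auto simp: return_set_def)
        then show ?thesis using False by simp
      qed
    qed
  qed
  also have "\<dots> = \<infinity> * emeasure m (nb 1 s)"
    by (rule nn_integral_cmult_indicator) (simp add: sets_m)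
  also have "\<dots> = \<infinity>" using quasi_conformal_finite(2)[OF quasi_conformal_m s] by (simp add: ennreal_top_mult)
  finally show ?thesis .
qed

end

section \<open>Pressure\<close>

lemma ext_ln_mono: "x \<le> y \<Longrightarrow> ext_ln x \<le> ext_ln y"
proof (cases "y = \<infinity> \<or> x = 0")
  case False
  assume le: "x \<le> y"
  then have f: "x \<noteq> \<infinity>" using False by (auto simp: top_unique)
  have "0 < enn2real x" using False f by (simp add: enn2real_positive_iff less_top[symmetric] zero_less_iff_neq_zero)
  moreover have "enn2real x \<le> enn2real y" using le False by (intro enn2real_mono) (auto simp: less_top)
  ultimately have "ln (enn2real x) \<le> ln (enn2real y)" by (subst ln_le_cancel_iff) auto
  moreover have "y \<noteq> 0" using le False by auto
  ultimately show ?thesis using False f by (simp add: ext_ln_def)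
qed (auto simp: ext_ln_def)

lemma ext_ln_ennreal: "y > 0 \<Longrightarrow> ext_ln (ennreal y) = ereal (ln y)"
  by (auto simp: ext_ln_def ennreal_eq_0_iff)

lemma limsup_le_of_exp_bound:
  assumes C: "C > 0" and Z: "\<And>n. n \<ge> 1 \<Longrightarrow> Z n \<le> ennreal (C * exp (real n * P))"
  shows "limsup (\<lambda>n. ext_ln (Z n) / ereal (real n)) \<le> ereal P"
proof -
  have "\<forall>\<^sub>F n in sequentially. ext_ln (Z n) / ereal (real n) \<le> ereal ((ln C + real n * P) / real n)"
    using eventually_ge_at_top[of 1]
  proof eventually_elim
    case (elim n)
    have "ext_ln (Z n) \<le> ereal (ln C + real n * P)"
      using ext_ln_mono[OF Z[OF elim]] C by (simp add: ext_ln_ennreal ln_mult_pos)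
    then have "ext_ln (Z n) / ereal (real n) \<le> ereal (ln C + real n * P) / ereal (real n)"
      using elim by (intro ereal_divide_right_mono) auto
    then show ?case using elim by simp
  qed
  then have "limsup (\<lambda>n. ext_ln (Z n) / ereal (real n)) \<le> limsup (\<lambda>n. ereal ((ln C + real n * P) / real n))"
    by (rule Limsup_mono)
  also have "\<dots> = ereal P"
  proof (rule lim_imp_Limsup)
    have "(\<lambda>n. ln C / real n + P) \<longlonglongrightarrow> 0 + P"
      by (intro tendsto_add tendsto_const lim_const_over_n)
    moreover have "\<forall>\<^sub>F n in sequentially. ln C / real n + P = (ln C + real n * P) / real n"
      using eventually_ge_at_top[of 1] by eventually_elim (simp add: field_simps)
    ultimately show "(\<lambda>n. ereal ((ln C + real n * P) / real n)) \<longlonglongrightarrow> ereal P"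
      by (auto intro: Lim_transform_eventually)
  qed simp
  finally show ?thesis .
qed

lemma exp_bound_of_limsup:
  assumes "limsup (\<lambda>n. ext_ln (Z n) / ereal (real n)) < ereal q"
  obtains N where "\<And>n. n \<ge> N \<Longrightarrow> Z n \<le> ennreal (exp (real n * q))"
proof -
  have "\<forall>\<^sub>F n in sequentially. ext_ln (Z n) / ereal (real n) < ereal q"
    using assms by (rule Limsup_lessD)
  then have "\<forall>\<^sub>F n in sequentially. Z n \<le> ennreal (exp (real n * q))"
    using eventually_ge_at_top[of 1]
  proof eventually_elim
    case (elim n)
    show ?case
    proof (cases "Z n = 0")
      case False
      have "Z n \<noteq> \<infinity>" using elim by (auto simp: ext_ln_def)
      then obtain z where z: "Z n = ennreal z" "z > 0"
        using False by (cases "Z n") (auto simp: ennreal_eq_0_iff infinity_ennreal_def)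
      then have "ereal (ln z / real n) < ereal q" using elim by (simp add: ext_ln_ennreal)
      then have "ln z < real n * q" using elim by (simp add: field_simps)
      then have "z < exp (real n * q)" using z(2) by (metis exp_less_mono exp_ln)
      then show ?thesis using z by (simp add: ennreal_leI)
    qed simp
  qed
  then show ?thesis using that by (auto simp: eventually_sequentially)
qed

lemma ennreal_sum_le_infsum:
  fixes f :: "'b \<Rightarrow> ennreal"
  shows "finite F \<Longrightarrow> F \<subseteq> B \<Longrightarrow> sum f F \<le> infsum f B"
  by (subst nonneg_infsum_complete) (auto intro: SUP_upper)

lemma nn_integral_count_space_le_infsum:
  fixes f :: "'b \<Rightarrow> ennreal"
  assumes "countable B"
  shows "(\<integral>\<^sup>+x. f x \<partial>count_space B) \<le> infsum f B"
proof (cases "finite B")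
  case True
  then show ?thesis by (simp add: nn_integral_count_space_finite)
next
  case False
  define e where "e = from_nat_into B"
  have b: "bij_betw e UNIV B" unfolding e_def using assms False by (rule bij_betw_from_nat_into)
  have "(\<integral>\<^sup>+x. f x \<partial>count_space B) = (\<integral>\<^sup>+n. f (e n) \<partial>count_space UNIV)"
    by (rule nn_integral_bij_count_space[OF b, symmetric])
  also have "\<dots> = (\<Sum>n. f (e n))" by (rule nn_integral_count_space_nat)
  also have "\<dots> \<le> infsum f B"
  proof (rule suminf_le_const)
    fix n
    have "(\<Sum>k<n. f (e k)) = sum f (e ` {..<n})"
      using b by (subst sum.reindex) (auto simp: bij_betw_def inj_on_def)
    also have "\<dots> \<le> infsum f B"
      using b by (intro ennreal_sum_le_infsum) (auto simp: bij_betw_def)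
    finally show "(\<Sum>k<n. f (e k)) \<le> infsum f B" .
  qed auto
  finally show ?thesis .
qed

lemma birkhoff_sum_periodic:
  assumes "(left_shift ^^ k) x = x"
  shows "birkhoff_sum (j * k) f x = real j * birkhoff_sum k f x"
proof (induction j)
  case (Suc j)
  have "birkhoff_sum (Suc j * k) f x = birkhoff_sum k f x + birkhoff_sum (j * k) f ((left_shift ^^ k) x)"
    using birkhoff_sum_add[of k "j * k" f x] by simp
  then show ?case using Suc assms by (simp add: distrib_right)
qed simp

text \<open>A single periodic orbit already bounds the pressure below. This excludes the value
  \<open>-\<infinity>\<close>, at which \<open>real_of_ereal\<close> is not the inverse of \<open>ereal\<close>.\<close>

lemma gurevich_pressure_not_MInfty:
  assumes x: "x \<in> mshift I A" "x 0 = (SOME a. a \<in> I)" "(left_shift ^^ k) x = x" "k \<ge> 1"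
  shows "gurevich_pressure I A f \<noteq> -\<infinity>"
proof
  assume "gurevich_pressure I A f = -\<infinity>"
  define q where "q = birkhoff_sum k f x / real k - 1"
  have "limsup (\<lambda>n. ext_ln (partition_fun I A f (x 0) n) / ereal (real n)) < ereal q"
    using \<open>gurevich_pressure I A f = -\<infinity>\<close> by (simp add: gurevich_pressure_def Let_def x(2))
  then obtain N where N: "\<And>n. n \<ge> N \<Longrightarrow> partition_fun I A f (x 0) n \<le> ennreal (exp (real n * q))"
    using exp_bound_of_limsup by blast
  define n where "n = Suc N * k"
  have per: "(left_shift ^^ n) x = x"
    unfolding n_def using x(3) by (metis funpow_mod_eq mod_mult_self2_is_0 funpow_0)
  have "ennreal (exp (birkhoff_sum n f x)) = (\<Sum>y\<in>{x}. ennreal (exp (birkhoff_sum n f y)))" by simp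
  also have "\<dots> \<le> partition_fun I A f (x 0) n"
    unfolding partition_fun_def using x per by (intro ennreal_sum_le_infsum) auto
  also have "\<dots> \<le> ennreal (exp (real n * q))"
  proof (rule N)
    have "N * 1 \<le> Suc N * k" using x(4) by (intro mult_le_mono) auto
    then show "N \<le> n" by (simp add: n_def)
  qed
  finally have "birkhoff_sum n f x \<le> real n * q" by simp
  moreover have "birkhoff_sum n f x = real n * (q + 1)"
    unfolding n_def birkhoff_sum_periodic[OF x(3)] using x(4) by (simp add: q_def field_simps)
  moreover have "real n > 0" using x(4) by (simp add: n_def del: of_nat_mult)
  ultimately show False by (simp add: distrib_left)
qed

context group_extension
begin

definition per :: "nat \<Rightarrow> (nat \<Rightarrow> nat) \<times> 'g \<Rightarrow> ((nat \<Rightarrow> nat) \<times> 'g) set" where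
  "per n s = {p \<in> nb 1 s. (T ^^ n) p = p}"

lemma per_mod:
  assumes "p \<in> per n s" shows "fst p k = fst p (k mod n)"
proof (induction k rule: less_induct)
  case (less k)
  show ?case
  proof (cases "k < n \<or> n = 0")
    case False
    have "fst p k = fst ((T ^^ n) p) (k - n)" using False by simp
    also have "(T ^^ n) p = p" using assms by (simp add: per_def)
    also have "fst p (k - n) = fst p ((k - n) mod n)" using False by (intro less) auto
    also have "(k - n) mod n = k mod n" using False by (metis le_mod_geq not_less)
    finally show ?thesis .
  qed auto
qed

lemma per_unique:
  assumes "p \<in> per n s" "q \<in> per n s" "n \<ge> 1" "z \<in> nb n p" "z \<in> nb n q"
  shows "p = q"
proof -
  have "fst p k = fst q k" for k
  proof -
    have "k mod n < n" using assms(3) by simp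
    then have "fst p (k mod n) = fst q (k mod n)" using assms(4,5) by (auto simp: nb_def)
    then show ?thesis using per_mod[OF assms(1), of k] per_mod[OF assms(2), of k] by simp
  qed
  moreover have "snd p = snd q" using assms(1,2) by (auto simp: per_def nb_def)
  ultimately show ?thesis by (simp add: prod_eq_iff fun_eq_iff)
qed

text \<open>If the orbit of \<open>q\<close> returns to its initial state, the word read until then can be repeated
  periodically, and the group coordinate comes back as well.\<close>

lemma periodic_closing:
  assumes q: "q \<in> return_set n s" and n: "n \<ge> 1"
  obtains p where "p \<in> per n s" "q \<in> nb n p"
proof -
  define p where "p = ((\<lambda>k. fst q (k mod n)), snd q)"
  have qX: "q \<in> X" "fst q n = fst q 0" "snd q = snd s" "snd ((T ^^ n) q) = snd s" "fst q 0 = fst s 0"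
    using q by (auto simp: return_set_def nb_def)
  have "A (fst q (k mod n)) (fst q (Suc k mod n))" for k
  proof (cases "Suc k mod n = 0")
    case True
    then have "Suc (k mod n) = n" using n by (simp add: mod_Suc split: if_splits)
    then show ?thesis using qX True by (auto simp: in_X mshift_def) (metis)
  next
    case False
    then have "Suc k mod n = Suc (k mod n)" by (simp add: mod_Suc split: if_splits)
    then show ?thesis using qX by (auto simp: in_X mshift_def)
  qed
  then have pX: "p \<in> X" using qX(1) by (auto simp: p_def in_X mshift_def)
  have pq: "q \<in> nb n p" using qX by (auto simp: nb_def p_def)
  have "snd ((T ^^ n) p) = snd ((T ^^ n) q)" by (rule snd_Tn_cong) (auto simp: p_def)
  moreover have "fst ((T ^^ n) p) k = fst p k" for k by (simp add: p_def)
  ultimately have "(T ^^ n) p = p" using qX by (simp add: prod_eq_iff fun_eq_iff p_def)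
  moreover have "p \<in> nb 1 s" using pX qX by (auto simp: nb_def p_def)
  ultimately show ?thesis using that pq by (auto simp: per_def)
qed

text \<open>A point of the Markov shift over \<open>I \<times> G\<close> is determined by its image under \<open>ext_decode\<close>, since its
  group letters are the group coordinates along the orbit of that image.\<close>

lemma ext_point_iff:
  "z \<in> mshift (ext_alphabet I G) (ext_matrix A G \<Psi>) \<longleftrightarrow>
    ext_decode z \<in> X \<and> (\<forall>k. snd (z k) = snd ((T ^^ k) (ext_decode z)))"
proof
  assume z: "z \<in> mshift (ext_alphabet I G) (ext_matrix A G \<Psi>)"
  have zk: "fst (z k) \<in> I" "snd (z k) \<in> carrier G" "A (fst (z k)) (fst (z (Suc k)))"
    "snd (z (Suc k)) = snd (z k) \<otimes> \<Psi> [fst (z k)]" for k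
    using z by (auto simp: mshift_def ext_alphabet_def ext_matrix_def mem_Times_iff split_beta)
  have X: "ext_decode z \<in> X" using zk by (auto simp: in_X ext_decode_def mshift_def)
  have "snd (z k) = snd ((T ^^ k) (ext_decode z))" for k
  proof (induction k)
    case (Suc k)
    then show ?case using zk(4)[of k] by (simp add: snd_T ext_decode_def)
  qed (simp add: ext_decode_def)
  with X show "ext_decode z \<in> X \<and> (\<forall>k. snd (z k) = snd ((T ^^ k) (ext_decode z)))" by blast
next
  assume *: "ext_decode z \<in> X \<and> (\<forall>k. snd (z k) = snd ((T ^^ k) (ext_decode z)))"
  have "snd (z k) \<in> carrier G" for k using * Tn_X in_X by metis
  moreover have "fst (z k) \<in> I" "A (fst (z k)) (fst (z (Suc k)))" for k
    using * by (auto simp: in_X ext_decode_def mshift_def)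
  moreover have "snd (z (Suc k)) = snd (z k) \<otimes> \<Psi> [fst (z k)]" for k
  proof -
    have "snd (z (Suc k)) = snd ((T ^^ Suc k) (ext_decode z))" using * by blast
    also have "\<dots> = snd ((T ^^ k) (ext_decode z)) \<otimes> \<Psi> [fst (z k)]" by (simp add: snd_T) (simp add: ext_decode_def)
    also have "snd ((T ^^ k) (ext_decode z)) = snd (z k)" using * by metis
    finally show ?thesis .
  qed
  ultimately show "z \<in> mshift (ext_alphabet I G) (ext_matrix A G \<Psi>)"
    by (auto simp: mshift_def ext_alphabet_def ext_matrix_def mem_Times_iff split_beta)
qed

lemma fst_ext_decode: "fst (ext_decode ((left_shift ^^ k) z)) = (left_shift ^^ k) (fst (ext_decode z))"
  by (rule ext) (simp add: ext_decode_def left_shift_funpow)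

lemma partition_fun_ext:
  assumes s: "s \<in> X"
  shows "partition_fun (ext_alphabet I G) (ext_matrix A G \<Psi>) ((f \<circ> fst) \<circ> ext_decode) (fst s 0, snd s) n =
    (\<Sum>\<^sub>\<infinity>p\<in>per n s. ennreal (exp (birkhoff_sum n f (fst p))))"
proof -
  let ?Z = "{z \<in> mshift (ext_alphabet I G) (ext_matrix A G \<Psi>). z 0 = (fst s 0, snd s) \<and> (left_shift ^^ n) z = z}"
  define enc where "enc p = (\<lambda>k. (fst p k, snd ((T ^^ k) p)))" for p
  have dec_enc: "ext_decode (enc p) = p" for p by (auto simp: ext_decode_def enc_def prod_eq_iff)
  have bij: "bij_betw ext_decode ?Z (per n s)"
  proof (rule bij_betw_byWitness[where f' = enc])
    show "\<forall>z\<in>?Z. enc (ext_decode z) = z"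
    proof
      fix z assume "z \<in> ?Z"
      then have *: "snd (z k) = snd ((T ^^ k) (ext_decode z))" for k unfolding ext_point_iff by blast
      have "enc (ext_decode z) k = z k" for k
      proof (rule prod_eqI)
        show "fst (enc (ext_decode z) k) = fst (z k)" by (simp add: enc_def ext_decode_def)
        show "snd (enc (ext_decode z) k) = snd (z k)" unfolding enc_def snd_conv *[of k] ..
      qed
      then show "enc (ext_decode z) = z" by blast
    qed
    show "\<forall>p\<in>per n s. ext_decode (enc p) = p" by (simp add: dec_enc)
    show "ext_decode ` ?Z \<subseteq> per n s"
    proof (rule image_subsetI)
      fix z assume "z \<in> ?Z"
      then have z: "z \<in> mshift (ext_alphabet I G) (ext_matrix A G \<Psi>)" "z 0 = (fst s 0, snd s)" "(left_shift ^^ n) z = z"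
        by blast+
      have z': "ext_decode z \<in> X" "\<And>k. snd (z k) = snd ((T ^^ k) (ext_decode z))" using z(1) unfolding ext_point_iff by blast+
      have zn: "z (n + k) = z k" for k using z(3) left_shift_funpow[of n z k] by simp
      have "fst ((T ^^ n) (ext_decode z)) k = fst (ext_decode z) k" for k
        using zn[of k] by (simp add: ext_decode_def)
      moreover have "snd ((T ^^ n) (ext_decode z)) = snd (ext_decode z)"
      proof -
        have "snd ((T ^^ n) (ext_decode z)) = snd (z n)" by (rule z'(2)[symmetric])
        then show ?thesis using zn[of 0] by (simp add: ext_decode_def)
      qed
      ultimately have "(T ^^ n) (ext_decode z) = ext_decode z" by (simp add: prod_eq_iff fun_eq_iff)
      moreover have "ext_decode z \<in> nb 1 s" using z'(1) z(2) by (simp add: nb_def ext_decode_def)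
      ultimately show "ext_decode z \<in> per n s" by (simp add: per_def)
    qed
    show "enc ` per n s \<subseteq> ?Z"
    proof (intro image_subsetI CollectI conjI)
      fix p assume p: "p \<in> per n s"
      have pX: "p \<in> X" "(T ^^ n) p = p" using p by (auto simp: per_def nb_def)
      show "enc p \<in> mshift (ext_alphabet I G) (ext_matrix A G \<Psi>)"
        unfolding ext_point_iff dec_enc using pX by (simp add: enc_def)
      show "enc p 0 = (fst s 0, snd s)" using p by (simp add: enc_def per_def nb_def)
      have "(T ^^ (n + k)) p = (T ^^ k) p" for k
        using pX(2) by (simp add: funpow_add add.commute[of n k])
      then have "(left_shift ^^ n) (enc p) k = enc p k" for k
        unfolding left_shift_funpow enc_def by (metis add_0_right fst_Tn_nth)
      then show "(left_shift ^^ n) (enc p) = enc p" by blast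
    qed
  qed
  have "partition_fun (ext_alphabet I G) (ext_matrix A G \<Psi>) ((f \<circ> fst) \<circ> ext_decode) (fst s 0, snd s) n
     = (\<Sum>\<^sub>\<infinity>z\<in>?Z. ennreal (exp (birkhoff_sum n f (fst (ext_decode z)))))"
    unfolding partition_fun_def by (intro infsum_cong) (simp add: birkhoff_sum_def fst_ext_decode)
  also have "\<dots> = (\<Sum>\<^sub>\<infinity>p\<in>per n s. ennreal (exp (birkhoff_sum n f (fst p))))"
    by (rule infsum_reindex_bij_betw[OF bij])
  finally show ?thesis .
qed

end

context gibbs_extension
begin

lemma weight_c_per: "p \<in> per n s \<Longrightarrow> weight_c n p = weight n p"
  using less_imp_neq[OF c_pos[of "snd p"]] by (auto simp: weight_c_def per_def nb_def in_X)

text \<open>The cylinders of depth \<open>n\<close> around different points of period \<open>n\<close> are disjoint, and their total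
  measure is at most that of the state.\<close>

lemma per_sum_le:
  obtains D where "D > 0" "\<And>n s. s \<in> X \<Longrightarrow> n \<ge> 1 \<Longrightarrow>
    (\<Sum>\<^sub>\<infinity>p\<in>per n s. ennreal (exp (birkhoff_sum n \<phi> (fst p)))) \<le> ennreal (D * exp (real n * P))"
proof -
  obtain D where D: "D > 0"
    "\<And>p n. p \<in> X \<Longrightarrow> n \<ge> 1 \<Longrightarrow> ennreal (weight_c n p / D) \<le> emeasure m (nb n p)"
    by (rule m_nb_bounds) blast
  have "(\<Sum>\<^sub>\<infinity>p\<in>per n s. ennreal (exp (birkhoff_sum n \<phi> (fst p)))) \<le> ennreal (D * exp (real n * P))"
    if s: "s \<in> X" and n: "n \<ge> 1" for n s
  proof (rule infsum_le_finite_sums)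
    fix F assume F: "finite F" "F \<subseteq> per n s"
    have bound: "ennreal (exp (birkhoff_sum n \<phi> (fst p))) \<le> ennreal (D * exp (real n * P)) * emeasure m (nb n p)"
      if p: "p \<in> F" for p
    proof -
      have p': "p \<in> per n s" "p \<in> X" using p F by (auto simp: per_def nb_def)
      have "exp (birkhoff_sum n \<phi> (fst p)) = D * exp (real n * P) * (weight_c n p / D)"
        using D(1) by (simp add: weight_c_per[OF p'(1)] weight_def exp_diff)
      then have "ennreal (exp (birkhoff_sum n \<phi> (fst p))) = ennreal (D * exp (real n * P)) * ennreal (weight_c n p / D)"
        using D(1) by (simp only: ennreal_mult' mult_nonneg_nonneg exp_ge_zero less_imp_le)
      also have "\<dots> \<le> ennreal (D * exp (real n * P)) * emeasure m (nb n p)"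
        using D(2)[OF p'(2) n] by (intro mult_left_mono) auto
      finally show ?thesis .
    qed
    have disj: "disjoint_family_on (nb n) F"
      unfolding disjoint_family_on_def
    proof (intro ballI impI)
      fix p q assume "p \<in> F" "q \<in> F" "p \<noteq> q"
      then show "nb n p \<inter> nb n q = {}" using per_unique[of p n s q] F(2) n by blast
    qed
    have "(\<Sum>p\<in>F. ennreal (exp (birkhoff_sum n \<phi> (fst p)))) \<le> (\<Sum>p\<in>F. ennreal (D * exp (real n * P)) * emeasure m (nb n p))"
      using bound by (intro sum_mono) auto
    also have "\<dots> = ennreal (D * exp (real n * P)) * (\<Sum>p\<in>F. emeasure m (nb n p))" by (simp add: sum_distrib_left)
    also have "(\<Sum>p\<in>F. emeasure m (nb n p)) = emeasure m (\<Union>p\<in>F. nb n p)"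
      using F disj by (intro sum_emeasure) (auto simp: sets_m)
    also have "\<dots> \<le> emeasure m (nb 1 s)"
    proof (rule emeasure_mono)
      show "(\<Union>p\<in>F. nb n p) \<subseteq> nb 1 s"
      proof (rule UN_least)
        fix p assume "p \<in> F"
        then have "p \<in> nb 1 s" using F unfolding per_def by blast
        then have "nb 1 p = nb 1 s" by (rule nb_eq)
        then show "nb n p \<subseteq> nb 1 s" using nb_mono[OF n, of p] by simp
      qed
    qed (simp add: sets_m)
    also have "\<dots> \<le> 1" by (rule m_state_le_1[OF s])
    finally show "(\<Sum>p\<in>F. ennreal (exp (birkhoff_sum n \<phi> (fst p)))) \<le> ennreal (D * exp (real n * P))"
      by (simp add: mult_left_mono)
  qed (rule nonneg_summable_on_complete, simp)
  with D(1) show ?thesis using that by blast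
qed

text \<open>By \<open>periodic_closing\<close> the points that return at time \<open>n\<close> are covered by the cylinders around points
  of period \<open>n\<close>.\<close>

lemma return_le_per_sum:
  obtains D where "D > 0" "\<And>n s. s \<in> X \<Longrightarrow> n \<ge> 1 \<Longrightarrow> emeasure m (return_set n s) \<le>
    ennreal (D * exp (- real n * P)) * (\<Sum>\<^sub>\<infinity>p\<in>per n s. ennreal (exp (birkhoff_sum n \<phi> (fst p))))"
proof -
  obtain D where D: "D > 0"
    "\<And>p n. p \<in> X \<Longrightarrow> n \<ge> 1 \<Longrightarrow> emeasure m (nb n p) \<le> ennreal (D * weight_c n p)"
    by (rule m_nb_bounds) blast
  have "emeasure m (return_set n s) \<le>
    ennreal (D * exp (- real n * P)) * (\<Sum>\<^sub>\<infinity>p\<in>per n s. ennreal (exp (birkhoff_sum n \<phi> (fst p))))"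
    if s: "s \<in> X" and n: "n \<ge> 1" for n s
  proof -
    have perX: "per n s \<subseteq> X" by (auto simp: per_def nb_def)
    have disj: "disjoint_family_on (nb n) (per n s)"
      unfolding disjoint_family_on_def using per_unique[OF _ _ n] by blast
    have cnt: "countable (per n s)"
    proof (rule countable_image_inj_on)
      show "countable (nb n ` per n s)" by (rule countable_subset[OF _ countable_nbs]) (use perX in blast)
      show "inj_on (nb n) (per n s)"
      proof (rule inj_onI)
        fix p q assume pq: "p \<in> per n s" "q \<in> per n s" "nb n p = nb n q"
        have "p \<in> nb n p" using pq perX by (intro nb_self) auto
        then show "p = q" using per_unique[OF pq(1,2) n, of p] pq(3) by simp
      qed
    qed
    have "emeasure m (return_set n s) \<le> emeasure m (\<Union>p\<in>per n s. nb n p)"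
    proof (rule emeasure_mono)
      show "return_set n s \<subseteq> (\<Union>p\<in>per n s. nb n p)" using periodic_closing[OF _ n] by blast
      show "(\<Union>p\<in>per n s. nb n p) \<in> sets m"
        unfolding sets_m by (intro sets.countable_UN' cnt image_subsetI nb_sets)
    qed
    also have "\<dots> = (\<integral>\<^sup>+p. emeasure m (nb n p) \<partial>count_space (per n s))"
      by (intro emeasure_UN_countable cnt disj) (simp add: sets_m)
    also have "\<dots> \<le> (\<integral>\<^sup>+p. ennreal (D * exp (- real n * P)) * ennreal (exp (birkhoff_sum n \<phi> (fst p))) \<partial>count_space (per n s))"
    proof (rule nn_integral_mono)
      fix p assume "p \<in> space (count_space (per n s))"
      then have p: "p \<in> per n s" by simp
      have "emeasure m (nb n p) \<le> ennreal (D * weight_c n p)" using p perX n by (intro D(2)) auto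
      also have "D * weight_c n p = D * exp (- real n * P) * exp (birkhoff_sum n \<phi> (fst p))"
        by (simp add: weight_c_per[OF p] weight_def exp_diff exp_minus divide_inverse)
      also have "ennreal \<dots> = ennreal (D * exp (- real n * P)) * ennreal (exp (birkhoff_sum n \<phi> (fst p)))"
        by (rule ennreal_mult'') simp
      finally show "emeasure m (nb n p) \<le> \<dots>" .
    qed
    also have "\<dots> = ennreal (D * exp (- real n * P)) * (\<integral>\<^sup>+p. ennreal (exp (birkhoff_sum n \<phi> (fst p))) \<partial>count_space (per n s))"
      by (rule nn_integral_cmult) simp
    also have "\<dots> \<le> ennreal (D * exp (- real n * P)) * (\<Sum>\<^sub>\<infinity>p\<in>per n s. ennreal (exp (birkhoff_sum n \<phi> (fst p))))"
      by (intro mult_left_mono nn_integral_count_space_le_infsum cnt) simp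
    finally show ?thesis .
  qed
  with D(1) show ?thesis using that by blast
qed

text \<open>Periodic points over a loop with trivial group element do not see \<open>c\<close>. The Gibbs property
  bounds their weighted number from above, while a smaller growth rate would make the return probabilities
  summable and contradict conservativity.\<close>

lemma ext_pressure_eq:
  assumes letters: "\<And>i. i \<in> I \<Longrightarrow> \<exists>x\<in>mshift I A. x 0 = i"
  shows "ext_pressure I A G \<Psi> (\<phi> \<circ> fst) = ereal P"
proof -
  define a where "a = (SOME a. a \<in> ext_alphabet I G)"
  obtain p\<^sub>0 where "p\<^sub>0 \<in> X" using X_nonempty by blast
  then have "(fst p\<^sub>0 0, snd p\<^sub>0) \<in> ext_alphabet I G" using letter_in_I by (simp add: ext_alphabet_def in_X)
  then have a: "a \<in> ext_alphabet I G" unfolding a_def by (rule someI)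
  then obtain x where x: "x \<in> mshift I A" "x 0 = fst a" using letters[of "fst a"] by (auto simp: ext_alphabet_def)
  define s where "s = (x, snd a)"
  have s: "s \<in> X" "a = (fst s 0, snd s)" using a x by (auto simp: s_def in_X ext_alphabet_def)
  define Z where "Z n = (\<Sum>\<^sub>\<infinity>p\<in>per n s. ennreal (exp (birkhoff_sum n \<phi> (fst p))))" for n
  have ep: "ext_pressure I A G \<Psi> (\<phi> \<circ> fst) = limsup (\<lambda>n. ext_ln (Z n) / ereal (real n))"
    unfolding ext_pressure_def gurevich_pressure_def Let_def a_def[symmetric] s(2) Z_def
    by (simp only: partition_fun_ext[OF s(1)])
  obtain D where D: "D > 0" "\<And>n. n \<ge> 1 \<Longrightarrow> Z n \<le> ennreal (D * exp (real n * P))"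
    unfolding Z_def using per_sum_le s(1) by metis
  have up: "limsup (\<lambda>n. ext_ln (Z n) / ereal (real n)) \<le> ereal P"
    using limsup_le_of_exp_bound[OF D] .
  have "\<not> limsup (\<lambda>n. ext_ln (Z n) / ereal (real n)) < ereal P"
  proof
    assume "limsup (\<lambda>n. ext_ln (Z n) / ereal (real n)) < ereal P"
    then obtain q where q: "limsup (\<lambda>n. ext_ln (Z n) / ereal (real n)) < ereal q" "q < P"
      using ereal_dense2 less_ereal.simps(1) by (metis)
    obtain N where N: "\<And>n. n \<ge> N \<Longrightarrow> Z n \<le> ennreal (exp (real n * q))"
      using exp_bound_of_limsup[OF q(1)] by blast
    obtain D where D: "D > 0" "\<And>n. n \<ge> 1 \<Longrightarrow> emeasure m (return_set n s) \<le> ennreal (D * exp (- real n * P)) * Z n"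
      unfolding Z_def using return_le_per_sum s(1) by metis
    define r where "r = exp (q - P)"
    have r: "0 < r" "r < 1" using q by (auto simp: r_def)
    have bd: "emeasure m (return_set n s) \<le> ennreal (D * r ^ n) + (if n \<in> {..Suc N} then 1 else 0)" for n
    proof (cases "n \<in> {..Suc N}")
      case True
      have "emeasure m (return_set n s) \<le> emeasure m (nb 1 s)"
        by (intro emeasure_mono) (auto simp: sets_m return_set_def)
      also have "\<dots> \<le> 1" by (rule m_state_le_1[OF s(1)])
      finally show ?thesis using True by (simp add: add_increasing)
    next
      case False
      then have "emeasure m (return_set n s) \<le> ennreal (D * exp (- real n * P)) * Z n" by (intro D) auto
      also have "\<dots> \<le> ennreal (D * exp (- real n * P)) * ennreal (exp (real n * q))"
        using False by (intro mult_left_mono N) auto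
      also have "\<dots> = ennreal (D * (exp (- real n * P) * exp (real n * q)))"
        by (subst ennreal_mult''[symmetric]) (auto simp: mult.assoc)
      also have "exp (- real n * P) * exp (real n * q) = r ^ n"
        by (simp add: r_def exp_of_nat_mult[symmetric] exp_add[symmetric] algebra_simps)
      finally show ?thesis using False by simp
    qed
    have "(\<Sum>n. emeasure m (return_set n s)) \<le> (\<Sum>n. ennreal (D * r ^ n) + (if n \<in> {..Suc N} then 1 else 0))"
      using bd by (intro suminf_le) auto
    also have "\<dots> = (\<Sum>n. ennreal (D * r ^ n)) + (\<Sum>n. if n \<in> {..Suc N} then 1 else 0)"
      by (intro suminf_add[symmetric]) auto
    also have "(\<Sum>n. if n \<in> {..Suc N} then 1 else (0::ennreal)) = (\<Sum>n\<in>{..Suc N}. if n \<in> {..Suc N} then 1 else 0)"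
      by (rule suminf_finite) auto
    also have "(\<Sum>n. ennreal (D * r ^ n)) = ennreal (D * (1 / (1 - r)))"
      using D r by (intro suminf_ennreal_eq sums_mult geometric_sums) auto
    also have "ennreal (D * (1 / (1 - r))) + (\<Sum>n\<in>{..Suc N}. if n \<in> {..Suc N} then 1 else 0) < \<infinity>"
      by (simp add: ennreal_add_eq_top less_top[symmetric])
    finally show False using m_return_sum[OF s(1)] by simp
  qed
  then show ?thesis using up ep by simp
qed

lemma periodic_point:
  assumes s: "s \<in> X"
  obtains k p where "k \<ge> 1" "p \<in> per k s"
proof -
  obtain k\<^sub>0 where k: "\<And>k. k \<ge> k\<^sub>0 \<Longrightarrow> \<exists>r\<in>nb 1 s. (T ^^ k) r \<in> nb 1 s" using path[OF s s] by blast
  then obtain r where "r \<in> return_set (Suc k\<^sub>0) s" using k[of "Suc k\<^sub>0"] unfolding return_set_def by auto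
  then obtain p where "p \<in> per (Suc k\<^sub>0) s" by (rule periodic_closing) auto
  then show ?thesis using that[of "Suc k\<^sub>0" p] by simp
qed

lemma twisted_pressure_eq:
  assumes letters: "\<And>i. i \<in> I \<Longrightarrow> \<exists>x\<in>mshift I A. x 0 = i"
    and fin: "gurevich_pressure I A (twisted_potential \<Psi> c \<phi>) < \<infinity>"
  shows "gurevich_pressure I A (twisted_potential \<Psi> c \<phi>) = ereal P"
proof -
  obtain p\<^sub>0 where "p\<^sub>0 \<in> X" using X_nonempty by blast
  then have "fst p\<^sub>0 0 \<in> I" by (rule letter_in_I)
  then have "(SOME a. a \<in> I) \<in> I" by (rule someI)
  then obtain x where x: "x \<in> mshift I A" "x 0 = (SOME a. a \<in> I)" using letters by blast
  define s where "s = (x, \<one>)"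
  have s: "s \<in> X" using x by (auto simp: s_def in_X)
  obtain k p where k: "k \<ge> 1" "p \<in> per k s" using periodic_point[OF s] by blast
  have "fst p \<in> mshift I A" "fst p 0 = (SOME a. a \<in> I)" "(left_shift ^^ k) (fst p) = fst p"
    using k(2) x by (auto simp: per_def nb_def s_def in_X fst_Tn[symmetric])
  then have "gurevich_pressure I A (twisted_potential \<Psi> c \<phi>) \<noteq> -\<infinity>"
    using k(1) by (intro gurevich_pressure_not_MInfty)
  then show ?thesis using fin unfolding pressure_c by (cases "gurevich_pressure I A (twisted_potential \<Psi> c \<phi>)") auto
qed

end

section \<open>Ergodicity and uniqueness of superharmonic functions\<close>

locale equilibrium = gibbs_extension I A G \<Psi> \<phi> P c \<mu> + conformal I A G \<Psi> \<phi> P \<nu>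
  for I :: "nat set" and A :: "nat \<Rightarrow> nat \<Rightarrow> bool"
    and G :: "('g, 'm) monoid_scheme" (structure) and \<Psi> :: "nat list \<Rightarrow> 'g"
    and \<phi> :: "(nat \<Rightarrow> nat) \<Rightarrow> real" and P :: real
    and c :: "'g \<Rightarrow> real" and \<mu> :: "(nat \<Rightarrow> nat) measure"
    and \<nu> :: "((nat \<Rightarrow> nat) \<times> 'g) measure" +
  fixes h :: "(nat \<Rightarrow> nat) \<times> 'g \<Rightarrow> real"
  assumes h_pos: "\<And>p. p \<in> X \<Longrightarrow> h p > 0"
    and h_continuous: "\<And>p e. p \<in> X \<Longrightarrow> e > 0 \<Longrightarrow> \<exists>n. \<forall>q\<in>nb n p. \<bar>h q - h p\<bar> < e"
    and h_eigen: "\<And>p. p \<in> X \<Longrightarrow> Lop (\<lambda>q. ennreal (h q)) p = ennreal (exp P) * ennreal (h p)"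
    and h_bounded: "\<And>s. s \<in> X \<Longrightarrow> \<exists>B. \<forall>p\<in>nb 1 s. h p \<le> B"
begin

lemma measurable_h [measurable]: "h \<in> borel_measurable MX"
  by (rule continuous_measurable) (rule h_continuous)

lemma \<nu>_nb_pos: "p \<in> X \<Longrightarrow> emeasure \<nu> (nb (Suc n) p) > 0"
proof -
  assume p: "p \<in> X"
  obtain K where K: "K > 0" "\<And>q j. q \<in> X \<Longrightarrow> snd q = snd p \<Longrightarrow> (T ^^ j) q \<in> nb 1 ((T ^^ n) p) \<Longrightarrow> ennreal (weight j q / K) \<le> emeasure \<nu> (nb (Suc j) q)"
    using quasi_conformalD[OF quasi_conformal_\<nu>, of "(T ^^ n) p" "snd p"] p by (metis Tn_X in_X)
  have "ennreal (weight n p / K) \<le> emeasure \<nu> (nb (Suc n) p)" using K(2)[of p n] p by simp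
  moreover have "0 < ennreal (weight n p / K)" using K(1) by simp
  ultimately show ?thesis by (rule less_le_trans[rotated])
qed

lemma \<nu>_nb_finite: "p \<in> X \<Longrightarrow> emeasure \<nu> (nb (Suc n) p) < \<infinity>"
proof -
  assume p: "p \<in> X"
  have "emeasure \<nu> (nb (Suc n) p) \<le> emeasure \<nu> (nb 1 p)"
    using nb_mono[of 1 "Suc n" p] by (intro emeasure_mono) (auto simp: sets_\<nu>)
  then show ?thesis using \<nu>_state[OF p] by auto
qed

text \<open>The points of \<open>s\<close> that come back at time \<open>n\<close> and never again form disjoint sets whose
  \<open>\<nu>\<close>-measures are comparable to the \<open>m\<close>-measures of the returns at time \<open>n\<close>; the latter have
  infinite sum.\<close>

lemma \<nu>_never_return:
  assumes s: "s \<in> X" shows "emeasure \<nu> (never_return s) = 0"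
proof (rule ccontr)
  assume ne: "emeasure \<nu> (never_return s) \<noteq> 0"
  have sub: "never_return s \<subseteq> nb 1 s" by (auto simp: never_return_def)
  have "emeasure \<nu> (never_return s) \<le> emeasure \<nu> (nb 1 s)"
    using sub by (intro emeasure_mono) (auto simp: sets_\<nu>)
  then have "emeasure \<nu> (never_return s) < \<infinity>" using \<nu>_state[OF s] by auto
  then obtain a where a: "emeasure \<nu> (never_return s) = ennreal a" "a > 0"
    using ne by (cases "emeasure \<nu> (never_return s)") (auto simp: ennreal_eq_0_iff)
  obtain C where C: "C > 0"
    "\<And>p E n. p \<in> X \<Longrightarrow> E \<in> sets MX \<Longrightarrow> E \<subseteq> nb 1 ((T ^^ n) p) \<Longrightarrow>
       ennreal (weight n p / C) * emeasure \<nu> E \<le> emeasure \<nu> {q \<in> nb (Suc n) p. (T ^^ n) q \<in> E}"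
    by (rule cylinder_bounds) blast
  obtain K1 where K1: "K1 > 0"
    "\<And>p n. p \<in> X \<Longrightarrow> snd p = snd s \<Longrightarrow> (T ^^ n) p \<in> nb 1 s \<Longrightarrow> emeasure m (nb (Suc n) p) \<le> ennreal (K1 * weight n p)"
    using quasi_conformalD[OF quasi_conformal_m s, of "snd s"] s by (metis in_X)
  define K where "K = K1 * C / a"
  have K: "K > 0" using K1 C a by (simp add: K_def)
  define S where "S n = {p \<in> nb 1 s. (T ^^ n) p \<in> never_return s}" for n
  have S_eq: "S n = nb 1 s \<inter> {p \<in> X. (T ^^ n) p \<in> never_return s}" for n by (auto simp: S_def nb_def)
  have Ss: "S n \<in> sets MX" for n
    unfolding S_eq by (intro sets.Int nb_sets measurable_Tn_in never_return_sets)
  have le: "emeasure m (return_set n s) \<le> ennreal K * emeasure \<nu> (S n)" for n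
  proof -
    define \<theta> where "\<theta> = density \<nu> (indicator (S n))"
    have \<theta>: "emeasure \<theta> B = emeasure \<nu> (S n \<inter> B)" if "B \<in> sets MX" for B
      using that Ss by (simp add: \<theta>_def emeasure_density sets_\<nu> flip: indicator_inter_arith)
    have "emeasure m (return_set n s) \<le> ennreal K * emeasure \<theta> (return_set n s)"
    proof (rule nb_partition_le[OF sets_m, where d = "\<lambda>_. Suc n"])
      show "sets \<theta> = sets MX" by (simp add: \<theta>_def sets_\<nu>)
      show "return_set n s \<subseteq> X" using nb_subset by (auto simp: return_set_def nb_def)
      fix p assume p: "p \<in> return_set n s"
      have pX: "p \<in> X" "p \<in> nb 1 s" "(T ^^ n) p \<in> nb 1 s" using p by (auto simp: return_set_def nb_def)
      have ps: "nb (Suc n) p \<subseteq> nb 1 s" using nb_mono[of 1 "Suc n" p] nb_eq[OF pX(2)] by simp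
      show "q \<in> return_set n s \<and> Suc n = Suc n" if q: "q \<in> nb (Suc n) p" for q
        using q ps nb_Suc_visit[OF pX(1) q, of n s] pX(3) unfolding return_set_def by blast
      have sub': "never_return s \<subseteq> nb 1 ((T ^^ n) p)" using sub nb_eq[OF pX(3)] by simp
      have "{q \<in> nb (Suc n) p. (T ^^ n) q \<in> never_return s} \<subseteq> S n \<inter> nb (Suc n) p"
        using ps unfolding S_def by blast
      then have "emeasure \<nu> {q \<in> nb (Suc n) p. (T ^^ n) q \<in> never_return s} \<le> emeasure \<theta> (nb (Suc n) p)"
        unfolding \<theta>[OF nb_sets] using Ss by (intro emeasure_mono) (auto simp: sets_\<nu>)
      then have lo: "ennreal (weight n p / C) * ennreal a \<le> emeasure \<theta> (nb (Suc n) p)"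
        using C(2)[OF pX(1) never_return_sets sub'] unfolding a(1) by (rule order_trans[rotated])
      have "snd p = snd s" using pX by (simp add: nb_def)
      then have "emeasure m (nb (Suc n) p) \<le> ennreal (K1 * weight n p)" using K1(2) pX by blast
      also have "K1 * weight n p = K * (weight n p / C * a)" using C(1) a(2) by (simp add: K_def)
      also have "ennreal \<dots> = ennreal K * (ennreal (weight n p / C) * ennreal a)"
        using K C(1) a(2) by (simp add: ennreal_mult'[symmetric])
      also have "\<dots> \<le> ennreal K * emeasure \<theta> (nb (Suc n) p)" using lo by (intro mult_left_mono) auto
      finally show "emeasure m (nb (Suc n) p) \<le> ennreal K * emeasure \<theta> (nb (Suc n) p)" .
    qed
    also have "emeasure \<theta> (return_set n s) \<le> emeasure \<nu> (S n)"
      unfolding \<theta>[OF return_set_sets] using Ss by (intro emeasure_mono) (auto simp: sets_\<nu>)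
    finally show ?thesis by (simp add: mult_left_mono)
  qed
  have "disjoint_family S"
    unfolding disjoint_family_on_def
  proof (intro ballI impI)
    fix i j :: nat assume "i \<noteq> j"
    have False if "p \<in> S i" "p \<in> S j" for p
    proof -
      have "(T ^^ i) p \<in> never_return s" "(T ^^ j) p \<in> never_return s" using that by (auto simp: S_def)
      then have "i \<le> j" "j \<le> i" using never_return_unique sub by blast+
      then show False using \<open>i \<noteq> j\<close> by simp
    qed
    then show "S i \<inter> S j = {}" by blast
  qed
  then have "(\<Sum>n. emeasure \<nu> (S n)) = emeasure \<nu> (\<Union>n. S n)"
    using Ss by (intro suminf_emeasure) (auto simp: sets_\<nu>)
  also have "\<dots> \<le> emeasure \<nu> (nb 1 s)" by (intro emeasure_mono) (auto simp: sets_\<nu> S_def)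
  finally have fin: "(\<Sum>n. emeasure \<nu> (S n)) < \<infinity>" using \<nu>_state[OF s] by auto
  have "\<infinity> = (\<Sum>n. emeasure m (return_set n s))" by (rule m_return_sum[OF s, symmetric])
  also have "\<dots> \<le> (\<Sum>n. ennreal K * emeasure \<nu> (S n))" using le by (intro suminf_le) auto
  also have "\<dots> = ennreal K * (\<Sum>n. emeasure \<nu> (S n))" by simp
  also have "\<dots> < \<infinity>" using fin by (simp add: ennreal_mult_less_top)
  finally show False by simp
qed

lemma \<nu>_visits: "s \<in> X \<Longrightarrow> AE p in \<nu>. \<exists>\<^sub>\<infinity>n. (T ^^ n) p \<in> nb 1 s"
  by (rule visits_every_state[OF quasi_conformal_\<nu> _ AE_T])
    (rule returns_from_never_return[OF sets_\<nu> \<nu>_never_return AE_T])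

lemma AE_Tn: "AE p in \<nu>. Q p \<Longrightarrow> AE p in \<nu>. Q ((T ^^ n) p)"
proof (induction n)
  case (Suc n)
  show ?case using AE_T[OF Suc.IH[OF Suc.prems]] by (simp add: funpow_swap1)
qed simp

text \<open>If a part of positive measure of the state \<open>s\<close> belongs to \<open>Z\<close>, then by bounded distortion a
  fixed proportion of every cylinder ending in \<open>s\<close> does, and the comparison of \<open>\<nu>\<close> with its
  restriction to \<open>Z\<close> shows that nothing is left outside.\<close>

lemma zero_one:
  assumes Z: "Z \<in> sets MX" and preim: "AE p in \<nu>. T p \<in> Z \<longrightarrow> p \<in> Z"
  shows "(AE p in \<nu>. p \<in> Z) \<or> (AE p in \<nu>. p \<notin> Z)"
proof (cases "\<forall>s\<in>X. emeasure \<nu> (Z \<inter> nb 1 s) = 0")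
  case True
  have "AE p in \<nu>. p \<in> nb 1 s \<longrightarrow> p \<notin> Z" if "s \<in> X" for s
  proof -
    have "Z \<inter> nb 1 s \<in> null_sets \<nu>" using True that Z by (auto simp: sets_\<nu>)
    then have "AE p in \<nu>. p \<notin> Z \<inter> nb 1 s" by (rule AE_not_in)
    then show ?thesis by eventually_elim auto
  qed
  then have "AE p in \<nu>. p \<notin> Z" by (rule AE_states[OF sets_\<nu>])
  then show ?thesis ..
next
  case False
  then obtain s where s: "s \<in> X" "emeasure \<nu> (Z \<inter> nb 1 s) \<noteq> 0" by blast
  have "emeasure \<nu> (Z \<inter> nb 1 s) \<le> emeasure \<nu> (nb 1 s)"
    by (intro emeasure_mono) (auto simp: sets_\<nu>)
  then have "emeasure \<nu> (Z \<inter> nb 1 s) < \<infinity>" using \<nu>_state[OF s(1)] by auto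
  then obtain a where a: "emeasure \<nu> (Z \<inter> nb 1 s) = ennreal a" "a > 0"
    using s(2) by (cases "emeasure \<nu> (Z \<inter> nb 1 s)") (auto simp: ennreal_eq_0_iff)
  obtain C where C: "C > 0"
    "\<And>p E n. p \<in> X \<Longrightarrow> E \<in> sets MX \<Longrightarrow> E \<subseteq> nb 1 ((T ^^ n) p) \<Longrightarrow>
       ennreal (weight n p / C) * emeasure \<nu> E \<le> emeasure \<nu> {q \<in> nb (Suc n) p. (T ^^ n) q \<in> E}"
    by (rule cylinder_bounds) blast
  have preimn: "AE p in \<nu>. (T ^^ n) p \<in> Z \<longrightarrow> p \<in> Z" for n
  proof (induction n)
    case (Suc n)
    show ?case using Suc AE_Tn[OF preim, of n] by eventually_elim simp
  qed simp
  define \<theta> where "\<theta> = density \<nu> (indicator Z)"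
  have \<theta>: "emeasure \<theta> B = emeasure \<nu> (Z \<inter> B)" if "B \<in> sets MX" for B
    using that Z by (simp add: \<theta>_def emeasure_density sets_\<nu> flip: indicator_inter_arith)
  have "AE p in \<nu>. p \<in> nb 1 r \<longrightarrow> p \<in> Z" if r: "r \<in> X" for r
  proof -
    obtain K1 where K1: "K1 > 0"
      "\<And>p n. p \<in> X \<Longrightarrow> snd p = snd r \<Longrightarrow> (T ^^ n) p \<in> nb 1 s \<Longrightarrow> emeasure \<nu> (nb (Suc n) p) \<le> ennreal (K1 * weight n p)"
      using quasi_conformalD[OF quasi_conformal_\<nu> s(1), of "snd r"] r by (metis in_X)
    define K where "K = K1 * C / a"
    have K: "K > 0" using K1 C a by (simp add: K_def)
    have E: "nb 1 r - Z \<in> sets MX" using Z by auto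
    have "emeasure \<nu> (nb 1 r - Z) \<le> ennreal K * emeasure \<theta> (nb 1 r - Z)"
    proof (rule comparison[OF sets_\<nu> _ K _ _ _ E])
      show "sets \<theta> = sets MX" by (simp add: \<theta>_def sets_\<nu>)
      have "emeasure \<theta> (nb 1 r) \<le> emeasure \<nu> (nb 1 r)" by (simp add: \<theta> emeasure_mono sets_\<nu>)
      then show "emeasure \<theta> (nb 1 r) < \<infinity>" using \<nu>_state[OF r] by auto
      show "AE p in \<nu>. p \<in> nb 1 r \<longrightarrow> (\<exists>\<^sub>\<infinity>n. (T ^^ n) p \<in> nb 1 s)"
        using \<nu>_visits[OF s(1)] by eventually_elim simp
      fix p n assume p: "p \<in> nb 1 r" "(T ^^ n) p \<in> nb 1 s"
      have pX: "p \<in> X" "snd p = snd r" using p by (auto simp: nb_def)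
      have sub: "Z \<inter> nb 1 s \<subseteq> nb 1 ((T ^^ n) p)" using nb_eq[OF p(2)] by simp
      have Zs: "Z \<inter> nb 1 s \<in> sets MX" using Z by auto
      have "AE q in \<nu>. q \<in> {q \<in> nb (Suc n) p. (T ^^ n) q \<in> Z \<inter> nb 1 s} \<longrightarrow> q \<in> Z \<inter> nb (Suc n) p"
        using preimn[of n] by eventually_elim auto
      then have "emeasure \<nu> {q \<in> nb (Suc n) p. (T ^^ n) q \<in> Z \<inter> nb 1 s} \<le> emeasure \<theta> (nb (Suc n) p)"
        unfolding \<theta>[OF nb_sets] using Z by (intro emeasure_mono_AE) (auto simp: sets_\<nu>)
      then have lo: "ennreal (weight n p / C) * ennreal a \<le> emeasure \<theta> (nb (Suc n) p)"
        using C(2)[OF pX(1) Zs sub] unfolding a(1) by (rule order_trans[rotated])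
      have "emeasure \<nu> (nb (Suc n) p) \<le> ennreal (K1 * weight n p)" using K1(2) pX p(2) by blast
      also have "K1 * weight n p = K * (weight n p / C * a)" using C(1) a(2) by (simp add: K_def)
      also have "ennreal \<dots> = ennreal K * (ennreal (weight n p / C) * ennreal a)"
        using K C(1) a(2) by (simp add: ennreal_mult'[symmetric])
      also have "\<dots> \<le> ennreal K * emeasure \<theta> (nb (Suc n) p)" using lo by (intro mult_left_mono) auto
      finally show "emeasure \<nu> (nb (Suc n) p) \<le> ennreal K * emeasure \<theta> (nb (Suc n) p)" .
    qed auto
    also have "emeasure \<theta> (nb 1 r - Z) = 0" by (simp only: \<theta>[OF E] Diff_disjoint Int_Diff[symmetric] Diff_cancel) (simp add: Diff_Int_distrib)
    finally have "nb 1 r - Z \<in> null_sets \<nu>" using E by (auto simp: sets_\<nu>)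
    then have "AE p in \<nu>. p \<notin> nb 1 r - Z" by (rule AE_not_in)
    then show ?thesis by eventually_elim auto
  qed
  then have "AE p in \<nu>. p \<in> Z" by (rule AE_states[OF sets_\<nu>])
  then show ?thesis ..
qed

text \<open>For the function \<open>w = min u (k h)\<close> the defect \<open>d = w - exp (-P) Lop w\<close> satisfies
  \<open>\<integral> d \<Sum>n. 1_s \<circ> T^n \<le> \<integral>_s w < \<infinity>\<close> by telescoping, while almost every orbit visits \<open>s\<close> infinitely
  often. Hence \<open>w\<close>, and with it \<open>q = k h - w\<close>, is harmonic. A non-negative harmonic function that vanishes
  at a point vanishes at all its preimages, so \<open>zero_one\<close> applies to the set where \<open>q\<close> is \<open>0\<close>, that
  is, where \<open>k h \<le> u\<close>.\<close>

lemma superharmonic_level: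
  assumes u [measurable]: "u \<in> borel_measurable MX"
    and sup: "AE p in \<nu>. Lop u p \<le> ennreal (exp P) * u p" and k: "k \<ge> 0"
  shows "(AE p in \<nu>. ennreal (k * h p) \<le> u p) \<or> (AE p in \<nu>. u p < ennreal (k * h p))"
proof -
  define b where "b p = ennreal (k * h p)" for p
  define w where "w p = min (u p) (b p)" for p
  define d where "d p = w p - ennreal (exp (- P)) * Lop w p" for p
  define q where "q p = b p - w p" for p
  have [measurable]: "b \<in> borel_measurable MX" unfolding b_def by measurable
  have [measurable]: "w \<in> borel_measurable MX" unfolding w_def by measurable
  have [measurable]: "d \<in> borel_measurable MX" unfolding d_def by measurable
  have [measurable]: "q \<in> borel_measurable MX" unfolding q_def by measurable
  have eP: "ennreal (exp (- P)) * ennreal (exp P) = 1"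
    by (subst ennreal_mult''[symmetric]) (auto simp: exp_minus)
  have inX: "AE p in \<nu>. p \<in> X" using AE_space[of \<nu>] by simp
  have Lb: "Lop b p = ennreal (exp P) * b p" if p: "p \<in> X" for p
  proof -
    have "b = (\<lambda>p. ennreal k * ennreal (h p))" unfolding b_def using k by (simp add: ennreal_mult')
    then show ?thesis using Lop_cmult[of "ennreal k" "\<lambda>p. ennreal (h p)" p] h_eigen[OF p] by (simp add: mult_ac)
  qed
  have Lw: "AE p in \<nu>. Lop w p \<le> ennreal (exp P) * w p"
    using sup inX
  proof eventually_elim
    case (elim p)
    have "Lop w p \<le> Lop u p" by (rule Lop_mono) (simp add: w_def)
    moreover have "Lop w p \<le> Lop b p" by (rule Lop_mono) (simp add: w_def)
    ultimately show ?case using elim Lb[of p] by (auto simp: w_def min_def)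
  qed
  have wd: "AE p in \<nu>. w p = d p + ennreal (exp (- P)) * Lop w p"
    using Lw
  proof eventually_elim
    case (elim p)
    have "ennreal (exp (- P)) * Lop w p \<le> ennreal (exp (- P)) * (ennreal (exp P) * w p)"
      using elim by (intro mult_left_mono) auto
    also have "\<dots> = w p" by (simp add: mult.assoc[symmetric] eP)
    finally show ?case unfolding d_def by (simp add: diff_add_cancel_ennreal)
  qed
  obtain s where s: "s \<in> X" using X_nonempty by blast
  define S :: "nat \<Rightarrow> (nat \<Rightarrow> nat) \<times> 'g \<Rightarrow> ennreal" where "S n p = indicator (nb 1 s) ((T ^^ n) p)" for n p
  have [measurable]: "S n \<in> borel_measurable MX" for n unfolding S_def by measurable
  define J where "J n = (\<integral>\<^sup>+p. w p * S n p \<partial>\<nu>)" for n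
  have step: "J n = (\<integral>\<^sup>+p. d p * S n p \<partial>\<nu>) + J (Suc n)" for n
  proof -
    have "J n = (\<integral>\<^sup>+p. d p * S n p + ennreal (exp (- P)) * (Lop w p * S n p) \<partial>\<nu>)"
      unfolding J_def
    proof (rule nn_integral_cong_AE)
      show "AE p in \<nu>. w p * S n p = d p * S n p + ennreal (exp (- P)) * (Lop w p * S n p)"
        using wd
      proof eventually_elim
        case (elim p)
        have "w p * S n p = (d p + ennreal (exp (- P)) * Lop w p) * S n p"
          using elim by (rule arg_cong[where f = "\<lambda>x. x * S n p"])
        then show ?case by (simp only: distrib_right mult.assoc)
      qed
    qed
    also have "\<dots> = (\<integral>\<^sup>+p. d p * S n p \<partial>\<nu>) + ennreal (exp (- P)) * (\<integral>\<^sup>+p. Lop w p * S n p \<partial>\<nu>)"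
      by (subst nn_integral_add) (auto simp: nn_integral_cmult)
    also have "(\<integral>\<^sup>+p. Lop w p * S n p \<partial>\<nu>) = ennreal (exp P) * (\<integral>\<^sup>+p. w p * S n (T p) \<partial>\<nu>)"
      by (rule Lop_duality) measurable
    also have "ennreal (exp (- P)) * (ennreal (exp P) * (\<integral>\<^sup>+p. w p * S n (T p) \<partial>\<nu>)) = J (Suc n)"
      by (simp add: mult.assoc[symmetric] eP J_def S_def funpow_swap1)
    finally show ?thesis .
  qed
  have tele: "(\<Sum>n<N. \<integral>\<^sup>+p. d p * S n p \<partial>\<nu>) + J N = J 0" for N
  proof (induction N)
    case (Suc N)
    then show ?case using step[of N] by (simp add: add.assoc)
  qed simp
  have J0: "J 0 < \<infinity>"
  proof -
    obtain B where B: "\<And>p. p \<in> nb 1 s \<Longrightarrow> h p \<le> B" using h_bounded[OF s] by blast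
    have "J 0 \<le> (\<integral>\<^sup>+p. ennreal (k * B) * indicator (nb 1 s) p \<partial>\<nu>)"
      unfolding J_def
    proof (rule nn_integral_mono)
      fix p
      show "w p * S 0 p \<le> ennreal (k * B) * indicator (nb 1 s) p"
      proof (cases "p \<in> nb 1 s")
        case True
        have "w p \<le> ennreal (k * h p)" by (simp add: w_def b_def)
        also have "\<dots> \<le> ennreal (k * B)" using B[OF True] k by (intro ennreal_leI mult_left_mono)
        finally show ?thesis using True by (simp add: S_def)
      qed (simp add: S_def)
    qed
    also have "\<dots> = ennreal (k * B) * emeasure \<nu> (nb 1 s)"
      by (rule nn_integral_cmult_indicator) (simp add: sets_\<nu>)
    also have "\<dots> < \<infinity>" using \<nu>_state[OF s] by (simp add: ennreal_mult_less_top)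
    finally show ?thesis .
  qed
  have "(\<integral>\<^sup>+p. d p * (\<Sum>n. S n p) \<partial>\<nu>) = (\<integral>\<^sup>+p. (\<Sum>n. d p * S n p) \<partial>\<nu>)" by simp
  also have "\<dots> = (\<Sum>n. \<integral>\<^sup>+p. d p * S n p \<partial>\<nu>)" by (intro nn_integral_suminf) measurable
  also have "\<dots> \<le> J 0"
  proof (rule suminf_le_const)
    fix N
    show "(\<Sum>n<N. \<integral>\<^sup>+p. d p * S n p \<partial>\<nu>) \<le> J 0" using tele[of N] by (metis add_increasing2 order_refl zero_le)
  qed auto
  finally have "(\<integral>\<^sup>+p. d p * (\<Sum>n. S n p) \<partial>\<nu>) \<noteq> \<infinity>" using J0 by auto
  then have "AE p in \<nu>. d p * (\<Sum>n. S n p) \<noteq> \<infinity>"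
    by (intro nn_integral_noteq_infinite) measurable
  then have d0: "AE p in \<nu>. d p = 0"
    using \<nu>_visits[OF s]
  proof eventually_elim
    case (elim p)
    have "(\<Sum>n. S n p) = (\<Sum>n. indicator {n. (T ^^ n) p \<in> nb 1 s} n)"
      by (intro suminf_cong) (simp add: S_def indicator_def)
    also have "\<dots> = \<infinity>" using elim(2) by (intro infinite_suminf_indicator) simp
    finally show ?case using elim(1) by (auto simp: ennreal_mult_eq_top_iff)
  qed
  have wq: "w p + q p = b p" for p
    unfolding q_def by (simp add: add.commute[of "w p"] diff_add_cancel_ennreal w_def)
  have Lq: "AE p in \<nu>. Lop q p = ennreal (exp P) * q p"
    using wd d0 inX
  proof eventually_elim
    case (elim p)
    have "ennreal (exp P) * w p = ennreal (exp P) * (ennreal (exp (- P)) * Lop w p)" using elim by simp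
    also have "\<dots> = Lop w p" using eP by (simp add: mult.assoc[symmetric] mult.commute[of "ennreal (exp P)"])
    finally have 1: "Lop w p = ennreal (exp P) * w p" by simp
    have "Lop w p + Lop q p = Lop b p" using Lop_add[of w q p] wq by simp
    also have "\<dots> = ennreal (exp P) * w p + ennreal (exp P) * q p"
      using Lb[OF elim(3)] wq[of p] by (simp add: distrib_left[symmetric])
    finally have "ennreal (exp P) * w p + Lop q p = ennreal (exp P) * w p + ennreal (exp P) * q p" by (simp add: 1)
    moreover have "ennreal (exp P) * w p \<noteq> \<infinity>"
      by (auto simp: ennreal_mult_eq_top_iff w_def b_def min_def top_unique)
    ultimately show ?case by (simp add: ennreal_add_left_cancel)
  qed
  define Z where "Z = {p \<in> X. q p = 0}"
  have Zs [measurable]: "Z \<in> sets MX"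
  proof -
    have "Z = q -` {0} \<inter> space MX" by (auto simp: Z_def)
    also have "\<dots> \<in> sets MX" by (rule measurable_sets[OF \<open>q \<in> borel_measurable MX\<close>]) simp
    finally show ?thesis .
  qed
  have "ennreal (exp P) * (\<integral>\<^sup>+p. q p * indicator Z (T p) \<partial>\<nu>) = (\<integral>\<^sup>+p. Lop q p * indicator Z p \<partial>\<nu>)"
    by (rule Lop_duality[symmetric]) measurable
  also have "\<dots> = (\<integral>\<^sup>+p. 0 \<partial>\<nu>)"
  proof (rule nn_integral_cong_AE)
    show "AE p in \<nu>. Lop q p * indicator Z p = 0"
      using Lq
    proof eventually_elim
      case (elim p)
      then show ?case by (cases "p \<in> Z") (simp_all add: Z_def)
    qed
  qed
  finally have "(\<integral>\<^sup>+p. q p * indicator Z (T p) \<partial>\<nu>) = 0" by simp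
  then have "AE p in \<nu>. q p * indicator Z (T p) = 0"
    by (subst (asm) nn_integral_0_iff_AE) measurable
  then have "AE p in \<nu>. T p \<in> Z \<longrightarrow> p \<in> Z"
    using inX by eventually_elim (auto simp: Z_def indicator_def split: if_splits)
  then have "(AE p in \<nu>. p \<in> Z) \<or> (AE p in \<nu>. p \<notin> Z)" by (rule zero_one[OF Zs])
  have "p \<in> Z \<longleftrightarrow> b p \<le> u p" if "p \<in> X" for p
  proof -
    have "q p = 0 \<longleftrightarrow> b p \<le> w p" unfolding q_def by (simp add: diff_eq_0_iff_ennreal b_def less_top)
    then show ?thesis using that by (auto simp: Z_def w_def)
  qed
  note Z_iff = this
  show ?thesis using \<open>(AE p in \<nu>. p \<in> Z) \<or> (AE p in \<nu>. p \<notin> Z)\<close>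
  proof (elim disjE)
    assume "AE p in \<nu>. p \<in> Z"
    then have "AE p in \<nu>. b p \<le> u p" using inX by eventually_elim (use Z_iff in auto)
    then show ?thesis unfolding b_def ..
  next
    assume "AE p in \<nu>. p \<notin> Z"
    then have "AE p in \<nu>. u p < b p" using inX by eventually_elim (use Z_iff in \<open>auto simp: not_le\<close>)
    then show ?thesis unfolding b_def ..
  qed
qed

lemma not_AE_False: "\<not> (AE p in \<nu>. False)"
proof
  assume "AE p in \<nu>. False"
  moreover have "X \<in> sets \<nu>" using sets.top[of \<nu>] by simp
  ultimately have "emeasure \<nu> X = 0" using AE_iff_null[of \<nu> "\<lambda>_. False"] by (simp add: null_sets_def)
  moreover obtain s where s: "s \<in> X" using X_nonempty by blast
  moreover have "emeasure \<nu> (nb 1 s) \<le> emeasure \<nu> X"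
    using nb_subset sets.top[of \<nu>] by (intro emeasure_mono) auto
  ultimately show False using \<nu>_state[OF s] by simp
qed

text \<open>Each level \<open>k h\<close> is almost everywhere below or above \<open>u\<close>; the constant is the supremum of the levels
  below.\<close>

theorem superharmonic_unique:
  assumes u: "u \<in> borel_measurable MX" and fin: "AE p in \<nu>. u p < \<infinity>"
    and sup: "AE p in \<nu>. Lop u p \<le> ennreal (exp P) * u p"
  obtains \<kappa> where "\<kappa> \<ge> 0" "AE p in \<nu>. u p = ennreal (\<kappa> * h p)"
proof -
  have inX: "AE p in \<nu>. p \<in> X" using AE_space[of \<nu>] by simp
  define K where "K = {k. k \<ge> 0 \<and> (AE p in \<nu>. ennreal (k * h p) \<le> u p)}"
  have K0: "0 \<in> K" by (simp add: K_def)
  have down: "k' \<in> K" if "k \<in> K" "0 \<le> k'" "k' \<le> k" for k k'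
  proof -
    have "AE p in \<nu>. ennreal (k * h p) \<le> u p" using that by (simp add: K_def)
    then have "AE p in \<nu>. ennreal (k' * h p) \<le> u p"
      using inX
    proof eventually_elim
      case (elim p)
      have "ennreal (k' * h p) \<le> ennreal (k * h p)"
        using that h_pos[OF elim(2)] by (intro ennreal_leI mult_right_mono) auto
      then show ?case using elim(1) by (rule order_trans)
    qed
    then show ?thesis using that by (simp add: K_def)
  qed
  have bdd: "bdd_above K"
  proof (rule ccontr)
    assume "\<not> bdd_above K"
    then have "\<exists>k\<in>K. real j < k" for j :: nat unfolding bdd_above_def by (meson not_le)
    then have "real j \<in> K" for j using down by (meson less_imp_le of_nat_0_le_iff)
    then have "AE p in \<nu>. \<forall>j. ennreal (real j * h p) \<le> u p" unfolding AE_all_countable by (simp add: K_def)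
    then have "AE p in \<nu>. False"
      using fin inX
    proof eventually_elim
      case (elim p)
      obtain y where y: "u p = ennreal y" "y \<ge> 0" using elim(2) by (cases "u p") auto
      obtain j where j: "y / h p < real j" using reals_Archimedean2 by blast
      have "real j * h p \<le> y" using elim(1)[rule_format, of j] y by (simp add: ennreal_le_iff)
      then show ?case using j h_pos[OF elim(3)] by (simp add: field_simps)
    qed
    then show False using not_AE_False by blast
  qed
  define \<kappa> where "\<kappa> = Sup K"
  have \<kappa>0: "\<kappa> \<ge> 0" unfolding \<kappa>_def using K0 bdd by (rule cSup_upper)
  have lower: "AE p in \<nu>. ennreal (max 0 (\<kappa> - 1 / real (Suc j)) * h p) \<le> u p" for j
  proof (cases "\<kappa> - 1 / real (Suc j) \<le> 0")
    case True
    then show ?thesis by (simp add: max_def)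
  next
    case False
    have "\<kappa> - 1 / real (Suc j) < Sup K" by (simp add: \<kappa>_def)
    then obtain k where "k \<in> K" "\<kappa> - 1 / real (Suc j) < k" using K0 by (metis less_cSupE empty_iff)
    then have "max 0 (\<kappa> - 1 / real (Suc j)) \<in> K" using down[of k "max 0 (\<kappa> - 1 / real (Suc j))"] by (auto simp: K_def)
    then show ?thesis by (simp add: K_def)
  qed
  have upper: "AE p in \<nu>. u p < ennreal ((\<kappa> + 1 / real (Suc j)) * h p)" for j
  proof -
    have "\<kappa> + 1 / real (Suc j) \<notin> K"
    proof
      assume "\<kappa> + 1 / real (Suc j) \<in> K"
      then have "\<kappa> + 1 / real (Suc j) \<le> \<kappa>" unfolding \<kappa>_def using bdd by (rule cSup_upper)
      then show False by simp
    qed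
    moreover have "0 \<le> \<kappa> + 1 / real (Suc j)" using \<kappa>0 by simp
    ultimately show ?thesis using superharmonic_level[OF u sup, of "\<kappa> + 1 / real (Suc j)"] by (auto simp: K_def)
  qed
  have "AE p in \<nu>. \<forall>j. ennreal (max 0 (\<kappa> - 1 / real (Suc j)) * h p) \<le> u p \<and> u p < ennreal ((\<kappa> + 1 / real (Suc j)) * h p)"
    unfolding AE_all_countable using lower upper by (intro allI AE_conjI)
  then have "AE p in \<nu>. u p = ennreal (\<kappa> * h p)"
    using inX
  proof eventually_elim
    case (elim p)
    have hp: "h p > 0" using h_pos[OF elim(2)] .
    have "u p < ennreal ((\<kappa> + 1 / real (Suc 0)) * h p)" using elim(1) by blast
    then have "u p < \<infinity>" by (rule less_trans) simp
    then obtain y where y: "u p = ennreal y" "y \<ge> 0" by (cases "u p") auto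
    have b: "\<bar>y / h p - \<kappa>\<bar> \<le> 1 / real (Suc j)" for j
    proof -
      have "max 0 (\<kappa> - 1 / real (Suc j)) * h p \<le> y"
        using elim(1)[rule_format, of j] y by (simp add: ennreal_le_iff)
      moreover have "(\<kappa> - 1 / real (Suc j)) * h p \<le> max 0 (\<kappa> - 1 / real (Suc j)) * h p"
        using hp by (intro mult_right_mono) auto
      ultimately have "(\<kappa> - 1 / real (Suc j)) * h p \<le> y" by linarith
      moreover have "y < (\<kappa> + 1 / real (Suc j)) * h p"
        using elim(1)[rule_format, of j] y by (simp add: ennreal_less_iff)
      ultimately have "\<kappa> - 1 / real (Suc j) \<le> y / h p" "y / h p < \<kappa> + 1 / real (Suc j)"
        using hp by (auto simp: pos_le_divide_eq pos_divide_less_eq)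
      then show ?thesis by (simp add: abs_le_iff)
    qed
    have "(\<lambda>j. 1 / real (Suc j)) \<longlonglongrightarrow> 0" by (rule LIMSEQ_Suc[OF lim_1_over_n])
    then have "\<bar>y / h p - \<kappa>\<bar> \<le> 0" by (rule LIMSEQ_le_const) (use b in auto)
    then show ?case using y hp by (simp add: field_simps)
  qed
  then show ?thesis using that \<kappa>0 by blast
qed

section \<open>The equilibrium measure\<close>

text \<open>The dependence of the constant on the group coordinate is made explicit here, because it is what
  ties the growth of \<open>h\<close> and \<open>\<nu>\<close> along the fibres to \<open>c\<close>.\<close>

lemma m_le_\<nu>:
  obtains K where "K > 0" "\<And>r E. r \<in> X \<Longrightarrow> E \<in> sets MX \<Longrightarrow> E \<subseteq> nb 1 r \<Longrightarrow>
    emeasure m E \<le> ennreal (K * c (snd r)) * emeasure \<nu> E"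
proof -
  obtain s where s: "s \<in> X" using X_nonempty by blast
  obtain C where C: "C > 0" "\<And>n p q. p \<in> X \<Longrightarrow> q \<in> nb n p \<Longrightarrow> weight n q \<le> C * weight n p"
    using weight_distortion by blast
  obtain D where D: "D > 0"
    "\<And>p n. p \<in> X \<Longrightarrow> n \<ge> 1 \<Longrightarrow> emeasure m (nb n p) \<le> ennreal (D * weight_c n p)"
    by (rule m_nb_bounds) blast
  obtain B where B: "B > 0"
    "\<And>p E n. p \<in> X \<Longrightarrow> E \<in> sets MX \<Longrightarrow> E \<subseteq> nb 1 ((T ^^ n) p) \<Longrightarrow>
       ennreal (weight n p / B) * emeasure \<nu> E \<le> emeasure \<nu> {q \<in> nb (Suc n) p. (T ^^ n) q \<in> E}"
    by (rule cylinder_bounds) blast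
  obtain a where a: "emeasure \<nu> (nb 1 s) = ennreal a" "a > 0"
    using \<nu>_state[OF s] by (cases "emeasure \<nu> (nb 1 s)") auto
  define t where "t = c (snd (T s))"
  have t: "t > 0" using s snd_Tn_carrier[OF s, of 1] by (simp add: t_def)
  define K where "K = D * (C * weight 1 s) / t * B / a"
  have K: "K > 0" using C D B a t by (simp add: K_def)
  have "emeasure m E \<le> ennreal (K * c (snd r)) * emeasure \<nu> E"
    if r: "r \<in> X" and E: "E \<in> sets MX" "E \<subseteq> nb 1 r" for r E
  proof (rule comparison[OF sets_m sets_\<nu> _ _ _ _ E])
    have cr: "c (snd r) > 0" using r by (simp add: in_X)
    then show "K * c (snd r) > 0" using K by simp
    show "emeasure \<nu> (nb 1 r) < \<infinity>" using \<nu>_state[OF r] by simp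
    show "AE p in m. p \<in> nb 1 r \<longrightarrow> (\<exists>\<^sub>\<infinity>n. (T ^^ n) p \<in> nb 1 s)"
      using m_visits[OF s] by eventually_elim simp
    fix p n assume p: "p \<in> nb 1 r" "(T ^^ n) p \<in> nb 1 s"
    have pX: "p \<in> X" "snd p = snd r" using p by (auto simp: nb_def)
    have eq: "{q \<in> nb (Suc n) p. (T ^^ n) q \<in> nb 1 s} = nb (Suc n) p"
      using nb_Suc_visit[OF pX(1), of _ n n s] p(2) by blast
    have lo: "ennreal (weight n p / B) * ennreal a \<le> emeasure \<nu> (nb (Suc n) p)"
      using B(2)[OF pX(1) nb_sets, of 1 s n] nb_eq[OF p(2)] unfolding eq a(1) by simp
    define q where "q = (T ^^ n) p"
    have q: "q \<in> nb 1 s" using p by (simp add: q_def)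
    have sT: "c (snd (T q)) = t" using q by (simp add: nb_def snd_T t_def)
    have "weight_c (Suc n) p = weight n p * weight 1 q * (c (snd r) / t)"
      using weight_add[of n 1 p] sT by (simp add: weight_c_def q_def pX(2))
    also have "\<dots> \<le> weight n p * (C * weight 1 s) * (c (snd r) / t)"
      using C(2)[OF s q] cr t by (intro mult_right_mono mult_left_mono) auto
    finally have "D * weight_c (Suc n) p \<le> D * (weight n p * (C * weight 1 s) * (c (snd r) / t))"
      using D(1) by (intro mult_left_mono) auto
    also have "\<dots> = (K * c (snd r)) * (weight n p / B * a)"
      using B(1) a(2) by (simp add: K_def)
    finally have "ennreal (D * weight_c (Suc n) p) \<le> ennreal (K * c (snd r)) * (ennreal (weight n p / B) * ennreal a)"
      using K cr B(1) a(2) by (simp add: ennreal_mult[symmetric] ennreal_leI)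
    also have "\<dots> \<le> ennreal (K * c (snd r)) * emeasure \<nu> (nb (Suc n) p)" using lo by (intro mult_left_mono) auto
    finally show "emeasure m (nb (Suc n) p) \<le> ennreal (K * c (snd r)) * emeasure \<nu> (nb (Suc n) p)"
      using D(2)[OF pX(1), of "Suc n"] by simp
  qed
  with K show ?thesis using that by blast
qed

lemma absolutely_continuous_m: "absolutely_continuous \<nu> m"
  unfolding absolutely_continuous_def
proof
  obtain K where K: "K > 0" "\<And>r E. r \<in> X \<Longrightarrow> E \<in> sets MX \<Longrightarrow> E \<subseteq> nb 1 r \<Longrightarrow>
    emeasure m E \<le> ennreal (K * c (snd r)) * emeasure \<nu> E"
    using m_le_\<nu> by blast
  fix N assume N: "N \<in> null_sets \<nu>"
  then have Ns: "N \<in> sets MX" using null_setsD2[OF N] by (simp only: sets_\<nu>)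
  have "AE p in m. p \<in> nb 1 s \<longrightarrow> p \<notin> N" if s: "s \<in> X" for s
  proof -
    have "emeasure \<nu> (N \<inter> nb 1 s) = 0"
      by (rule emeasure_eq_0[OF null_setsD2[OF N] null_setsD1[OF N]]) blast
    then have "emeasure m (N \<inter> nb 1 s) = 0"
      using K(2)[OF s, of "N \<inter> nb 1 s"] Ns by simp
    then have "N \<inter> nb 1 s \<in> null_sets m" using Ns by (intro null_setsI) (simp_all add: sets_m)
    then have "AE p in m. p \<notin> N \<inter> nb 1 s" by (rule AE_not_in)
    then show ?thesis by eventually_elim blast
  qed
  then have "AE p in m. p \<notin> N" by (rule AE_states[OF sets_m])
  then show "N \<in> null_sets m" using Ns by (subst AE_iff_null_sets) (simp_all only: sets_m)
qed

lemma sigma_finite_m: "sigma_finite_measure m"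
proof -
  interpret \<mu>: prob_space \<mu> by (rule prob_\<mu>)
  interpret haar: sigma_finite_measure "haar G" by (rule sigma_finite_haar)
  interpret pair_sigma_finite \<mu> "haar G" ..
  show ?thesis ..
qed

text \<open>The density of the invariant measure \<open>m\<close> with respect to the conformal measure is harmonic.\<close>

theorem m_eq_density:
  obtains R where "R > 0" "m = density \<nu> (\<lambda>p. ennreal (R * h p))"
proof -
  interpret \<nu>: sigma_finite_measure \<nu> by (rule sigma_finite_\<nu>)
  define D where "D = RN_deriv \<nu> m"
  have Dm [measurable]: "D \<in> borel_measurable MX"
    using borel_measurable_RN_deriv[of \<nu> m] measurable_cong_sets[OF sets_\<nu> refl] by (simp add: D_def)
  have dens: "density \<nu> D = m"
    unfolding D_def by (intro \<nu>.density_RN_deriv absolutely_continuous_m) (simp add: sets_m sets_\<nu>)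
  have fin: "AE p in \<nu>. D p < \<infinity>"
    unfolding D_def using \<nu>.RN_deriv_finite[OF sigma_finite_m absolutely_continuous_m] 
    by (simp add: sets_m sets_\<nu> less_top)
  have mD: "emeasure m B = (\<integral>\<^sup>+p. D p * indicator B p \<partial>\<nu>)" if "B \<in> sets MX" for B
    unfolding dens[symmetric] using that by (intro emeasure_density) (auto simp: sets_\<nu>)
  have eP: "ennreal (exp (- P)) * ennreal (exp P) = 1"
    by (subst ennreal_mult''[symmetric]) (auto simp: exp_minus)
  have "AE p in \<nu>. ennreal (exp (- P)) * Lop D p = D p"
  proof (rule \<nu>.density_unique2)
    show "(\<lambda>p. ennreal (exp (- P)) * Lop D p) \<in> borel_measurable \<nu>" "D \<in> borel_measurable \<nu>" by measurable
    fix B assume "B \<in> sets \<nu>"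
    then have B [measurable]: "B \<in> sets MX" by (simp add: sets_\<nu>)
    have "(\<integral>\<^sup>+p. ennreal (exp (- P)) * Lop D p * indicator B p \<partial>\<nu>) = ennreal (exp (- P)) * (\<integral>\<^sup>+p. Lop D p * indicator B p \<partial>\<nu>)"
      by (simp add: mult.assoc nn_integral_cmult)
    also have "(\<integral>\<^sup>+p. Lop D p * indicator B p \<partial>\<nu>) = ennreal (exp P) * (\<integral>\<^sup>+p. D p * indicator B (T p) \<partial>\<nu>)"
      by (rule Lop_duality) measurable
    also have "ennreal (exp (- P)) * (ennreal (exp P) * (\<integral>\<^sup>+p. D p * indicator B (T p) \<partial>\<nu>)) = (\<integral>\<^sup>+p. D p * indicator B (T p) \<partial>\<nu>)"
      by (simp add: mult.assoc[symmetric] eP)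
    also have "\<dots> = (\<integral>\<^sup>+p. D p * indicator {p \<in> X. T p \<in> B} p \<partial>\<nu>)"
      by (intro nn_integral_cong) (auto simp: indicator_def)
    also have "\<dots> = emeasure m {p \<in> X. T p \<in> B}"
      using measurable_Tn_in[OF B, of 1] by (intro mD[symmetric]) simp
    also have "\<dots> = emeasure m B" by (rule m_invariant[OF B])
    finally show "(\<integral>\<^sup>+p. ennreal (exp (- P)) * Lop D p * indicator B p \<partial>\<nu>) = (\<integral>\<^sup>+p. D p * indicator B p \<partial>\<nu>)"
      unfolding mD[OF B] .
  qed
  then have "AE p in \<nu>. Lop D p \<le> ennreal (exp P) * D p"
  proof eventually_elim
    case (elim p)
    have "Lop D p = ennreal (exp P) * (ennreal (exp (- P)) * Lop D p)"
      using eP by (simp add: mult.assoc[symmetric] mult.commute[of "ennreal (exp P)"])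
    then show ?case using elim by simp
  qed
  then obtain R where R: "R \<ge> 0" "AE p in \<nu>. D p = ennreal (R * h p)"
    using superharmonic_unique[OF Dm fin] by blast
  have mR: "m = density \<nu> (\<lambda>p. ennreal (R * h p))"
    unfolding dens[symmetric] using R(2) by (intro density_cong) (auto, measurable)
  have "R \<noteq> 0"
  proof
    assume "R = 0"
    obtain s where s: "s \<in> X" using X_nonempty by blast
    have "emeasure m (nb 1 s) = 0"
      unfolding mR using \<open>R = 0\<close> by (subst emeasure_density) (auto simp: sets_\<nu>)
    then show False using quasi_conformal_finite(2)[OF quasi_conformal_m s] by simp
  qed
  then show ?thesis using that[of R] R(1) mR by simp
qed

lemma m_eq_integral:
  assumes "m = density \<nu> (\<lambda>p. ennreal (R * h p))" "B \<in> sets MX"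
  shows "emeasure m B = (\<integral>\<^sup>+p. ennreal (R * h p) * indicator B p \<partial>\<nu>)"
  by (subst assms(1), rule emeasure_density) (use assms(2) in \<open>auto simp: sets_\<nu>\<close>)

text \<open>Since \<open>m\<close> has density \<open>R h\<close>, by continuity \<open>R h > K c\<close> at one point would give \<open>m > K c \<nu>\<close> on a
  small cylinder.\<close>

lemma h_le_c:
  obtains K where "K > 0" "\<And>p. p \<in> X \<Longrightarrow> h p \<le> K * c (snd p)"
proof -
  obtain K where K: "K > 0" "\<And>r E. r \<in> X \<Longrightarrow> E \<in> sets MX \<Longrightarrow> E \<subseteq> nb 1 r \<Longrightarrow>
    emeasure m E \<le> ennreal (K * c (snd r)) * emeasure \<nu> E"
    using m_le_\<nu> by blast
  obtain R where R: "R > 0" "m = density \<nu> (\<lambda>p. ennreal (R * h p))" using m_eq_density by blast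
  have "h p \<le> (K / R) * c (snd p)" if p: "p \<in> X" for p
  proof (rule ccontr)
    assume "\<not> h p \<le> (K / R) * c (snd p)"
    define e where "e = (h p - (K / R) * c (snd p)) / 2"
    have e: "e > 0" using \<open>\<not> h p \<le> (K / R) * c (snd p)\<close> by (simp add: e_def)
    obtain n where n: "\<forall>q\<in>nb n p. \<bar>h q - h p\<bar> < e" using h_continuous[OF p e] by blast
    define E where "E = nb (Suc n) p"
    have Es: "E \<in> sets MX" "E \<subseteq> nb 1 p" "E \<subseteq> nb n p"
      using nb_mono[of 1 "Suc n" p] nb_mono[of n "Suc n" p] by (auto simp: E_def)
    have hq: "R * h q \<ge> K * c (snd p) + R * e" if "q \<in> E" for q
    proof -
      have "\<bar>h q - h p\<bar> < e" using n that Es(3) by blast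
      moreover have "h p = (K / R) * c (snd p) + 2 * e" unfolding e_def by (simp only: mult_2 field_sum_of_halves)
      ultimately have "h q \<ge> (K / R) * c (snd p) + e" by linarith
      then have "R * h q \<ge> R * ((K / R) * c (snd p) + e)" using R(1) by (intro mult_left_mono) auto
      then show ?thesis using R(1) by (simp add: distrib_left)
    qed
    obtain a where a: "emeasure \<nu> E = ennreal a" "a > 0"
      using \<nu>_nb_pos[OF p, of n] \<nu>_nb_finite[OF p, of n] unfolding E_def by (cases "emeasure \<nu> (nb (Suc n) p)") auto
    have cp: "c (snd p) > 0" using p by (simp add: in_X)
    have "ennreal (K * c (snd p) + R * e) * emeasure \<nu> E = (\<integral>\<^sup>+q. ennreal (K * c (snd p) + R * e) * indicator E q \<partial>\<nu>)"
      using Es by (intro nn_integral_cmult_indicator[symmetric]) (simp add: sets_\<nu>)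
    also have "\<dots> \<le> (\<integral>\<^sup>+q. ennreal (R * h q) * indicator E q \<partial>\<nu>)"
      using hq by (intro nn_integral_mono) (auto simp: indicator_def intro!: ennreal_leI)
    also have "\<dots> = emeasure m E" by (rule m_eq_integral[OF R(2) Es(1), symmetric])
    also have "\<dots> \<le> ennreal (K * c (snd p)) * emeasure \<nu> E" by (rule K(2)[OF p Es(1,2)])
    finally have "ennreal ((K * c (snd p) + R * e) * a) \<le> ennreal (K * c (snd p) * a)"
      unfolding a(1) by (simp only: ennreal_mult''[OF less_imp_le[OF a(2)]])
    then have "(K * c (snd p) + R * e) * a \<le> K * c (snd p) * a"
      by (subst (asm) ennreal_le_iff) (use K(1) cp a(2) in simp_all)
    then show False using mult_pos_pos[OF R(1) e] a(2) by simp
  qed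
  moreover have "K / R > 0" using K(1) R(1) by simp
  ultimately show ?thesis using that by blast
qed

text \<open>If \<open>c g < 1\<close>, the powers of \<open>g\<close> have values tending to \<open>0\<close>; if \<open>c g > 1\<close>, those of its inverse do.\<close>

lemma c_trivial_of_lower_bound:
  assumes "e > 0" "\<And>g. g \<in> carrier G \<Longrightarrow> e \<le> c g"
  shows "\<forall>g\<in>carrier G. c g = 1"
proof
  have pw: "c (g [^] n) = c g ^ n" if "g \<in> carrier G" for g and n :: nat
    using that by (induction n) (simp_all add: c_one c_mult mult.commute)
  have ge: "c g \<ge> 1" if g: "g \<in> carrier G" for g
  proof (rule ccontr)
    assume "\<not> c g \<ge> 1"
    then have "(\<lambda>n. c g ^ n) \<longlonglongrightarrow> 0" using c_pos[OF g] by (intro LIMSEQ_power_zero) auto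
    then have "\<forall>\<^sub>F n in sequentially. c g ^ n < e" using assms(1) by (rule order_tendstoD)
    then obtain n where "c g ^ n < e" by (auto simp: eventually_sequentially)
    then show False using assms(2)[of "g [^] n"] pw[OF g, of n] g by simp
  qed
  fix g assume g: "g \<in> carrier G"
  have "c g * c (inv g) = 1" using c_mult[of g "inv g"] g by (simp add: c_one)
  moreover have "c g * 1 \<le> c g * c (inv g)" using ge[of "inv g"] g c_pos[OF g, THEN less_imp_le] by (intro mult_left_mono) auto
  ultimately show "c g = 1" using ge[OF g] by simp
qed

end

section \<open>A superharmonic function on the base\<close>

lemma nn_integral_count_space_injection:
  fixes f :: "'b \<Rightarrow> ennreal" and g :: "'c \<Rightarrow> ennreal"
  assumes j: "inj_on j B" "j ` B \<subseteq> D" and le: "\<And>b. b \<in> B \<Longrightarrow> f b \<le> K * g (j b)"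
  shows "(\<integral>\<^sup>+b. f b \<partial>count_space B) \<le> K * (\<integral>\<^sup>+d. g d \<partial>count_space D)"
proof -
  have "(\<integral>\<^sup>+b. f b \<partial>count_space B) \<le> (\<integral>\<^sup>+b. K * g (j b) \<partial>count_space B)"
    using le by (intro nn_integral_mono) auto
  also have "\<dots> = K * (\<integral>\<^sup>+b. g (j b) \<partial>count_space B)" by (rule nn_integral_cmult) simp
  also have "(\<integral>\<^sup>+b. g (j b) \<partial>count_space B) = (\<integral>\<^sup>+d. g d \<partial>count_space (j ` B))"
    using j(1) by (intro nn_integral_bij_count_space) (simp add: bij_betw_def)
  also have "\<dots> = (\<integral>\<^sup>+d. g d * indicator (j ` B) d \<partial>count_space UNIV)"
    by (rule nn_integral_count_space_indicator)  simp
  also have "\<dots> \<le> (\<integral>\<^sup>+d. g d * indicator D d \<partial>count_space UNIV)"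
    using j(2) by (intro nn_integral_mono) (auto simp: indicator_def)
  also have "\<dots> = (\<integral>\<^sup>+d. g d \<partial>count_space D)"
    by (rule nn_integral_count_space_indicator[symmetric]) simp
  finally show ?thesis by (simp add: mult_left_mono)
qed

lemma cmult_liminf_le: "(c::ennreal) * liminf f \<le> liminf (\<lambda>n. c * f n)"
  unfolding liminf_SUP_INF SUP_mult_left_ennreal
  by (intro SUP_mono) (auto intro!: INF_greatest mult_left_mono INF_lower)

context group_extension_potential
begin

definition preimages :: "nat \<Rightarrow> nat \<Rightarrow> (nat \<Rightarrow> nat) \<Rightarrow> (nat \<Rightarrow> nat) set" where
  "preimages a n x = {y \<in> mshift I A. y 0 = a \<and> (left_shift ^^ n) y = x}"

text \<open>The \<open>n\<close>-th iterate of the base transfer operator on the indicator function of the cylinder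
  of \<open>a\<close>.\<close>

definition iter_op :: "nat \<Rightarrow> nat \<Rightarrow> (nat \<Rightarrow> nat) \<Rightarrow> ennreal" where
  "iter_op a n x = (\<integral>\<^sup>+y. ennreal (exp (birkhoff_sum n \<phi> y)) \<partial>count_space (preimages a n x))"

lemma Lop_eq_nn_integral: "Lop u p = (\<integral>\<^sup>+i. branch_term i u p \<partial>count_space UNIV)"
  by (simp add: Lop_def nn_integral_count_space_nat)

lemma Lop_iter_op:
  assumes p: "p \<in> X"
  shows "Lop (\<lambda>q. iter_op a n (fst q)) p = iter_op a (Suc n) (fst p)"
proof -
  define S where "S = {(i, y). p \<in> succ_set i \<and> y \<in> preimages a n (fst (prepend i p))}"
  define g where "g z = ennreal (exp (\<phi> (fst (prepend (fst z) p)) + birkhoff_sum n \<phi> (snd z)))" for z :: "nat \<times> (nat \<Rightarrow> nat)"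
  have term_eq: "branch_term i (\<lambda>q. iter_op a n (fst q)) p = (\<integral>\<^sup>+y. g (i, y) * indicator S (i, y) \<partial>count_space UNIV)" for i
  proof (cases "p \<in> succ_set i")
    case True
    have "branch_term i (\<lambda>q. iter_op a n (fst q)) p =
        (\<integral>\<^sup>+y. ennreal (exp (\<phi> (fst (prepend i p)))) * ennreal (exp (birkhoff_sum n \<phi> y)) \<partial>count_space (preimages a n (fst (prepend i p))))"
      using True by (simp add: branch_term_def iter_op_def nn_integral_cmult)
    also have "\<dots> = (\<integral>\<^sup>+y. g (i, y) \<partial>count_space (preimages a n (fst (prepend i p))))"
      by (simp add: g_def exp_add ennreal_mult')
    also have "\<dots> = (\<integral>\<^sup>+y. g (i, y) * indicator (preimages a n (fst (prepend i p))) y \<partial>count_space UNIV)"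
      by (rule nn_integral_count_space_indicator) simp
    also have "\<dots> = (\<integral>\<^sup>+y. g (i, y) * indicator S (i, y) \<partial>count_space UNIV)"
      using True by (intro nn_integral_cong) (auto simp: S_def indicator_def)
    finally show ?thesis .
  next
    case False
    then have "(i, y) \<notin> S" for y by (auto simp: S_def)
    then show ?thesis using False by (simp add: branch_term_def)
  qed
  have bij: "bij_betw snd S (preimages a (Suc n) (fst p))"
    unfolding bij_betw_def
  proof
    show "inj_on snd S"
    proof (rule inj_onI)
      fix z z' assume z: "z \<in> S" "z' \<in> S" "snd z = snd z'"
      have *: "fst w = snd w n" if w: "w \<in> S" for w
      proof -
        have "(left_shift ^^ n) (snd w) 0 = fst (prepend (fst w) p) 0"
          using w by (auto simp: S_def preimages_def)
        then show ?thesis by (simp add: left_shift_funpow)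
      qed
      show "z = z'" using *[OF z(1)] *[OF z(2)] z(3) by (simp add: prod_eq_iff)
    qed
    show "snd ` S = preimages a (Suc n) (fst p)"
    proof (intro subset_antisym subsetI)
      fix y assume "y \<in> snd ` S"
      then obtain i where y: "y \<in> mshift I A" "y 0 = a" "(left_shift ^^ n) y = fst (prepend i p)"
        by (auto simp: S_def preimages_def)
      have "(left_shift ^^ Suc n) y = fst p"
        by (rule ext) (simp add: y(3) left_shift_def)
      then show "y \<in> preimages a (Suc n) (fst p)" using y by (simp add: preimages_def)
    next
      fix y assume y: "y \<in> preimages a (Suc n) (fst p)"
      have ys: "y \<in> mshift I A" "y 0 = a" "(left_shift ^^ Suc n) y = fst p" using y unfolding preimages_def by blast+
      have yk: "y (Suc n + k) = fst p k" for k using ys(3) left_shift_funpow[of "Suc n" y k] by simp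
      have "y n \<in> I" "A (y n) (y (Suc n))" using ys(1) by (auto simp: mshift_def)
      then have "p \<in> succ_set (y n)" using p yk[of 0] by (simp add: succ_set_def)
      moreover have "(left_shift ^^ n) y = fst (prepend (y n) p)"
      proof
        fix k
        show "(left_shift ^^ n) y k = fst (prepend (y n) p) k"
          using yk by (cases k) (auto simp: left_shift_funpow)
      qed
      ultimately have "(y n, y) \<in> S" using ys by (simp add: S_def preimages_def)
      then show "y \<in> snd ` S" by (force intro: image_eqI[of _ _ "(y n, y)"])
    qed
  qed
  have gS: "g z = ennreal (exp (birkhoff_sum (Suc n) \<phi> (snd z)))" if "z \<in> S" for z
  proof -
    have "(left_shift ^^ n) (snd z) = fst (prepend (fst z) p)" using that by (auto simp: S_def preimages_def)
    then have "birkhoff_sum (Suc n) \<phi> (snd z) = \<phi> (fst (prepend (fst z) p)) + birkhoff_sum n \<phi> (snd z)"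
      by (simp add: birkhoff_sum_def)
    then show ?thesis by (simp add: g_def)
  qed
  have "Lop (\<lambda>q. iter_op a n (fst q)) p = (\<integral>\<^sup>+i. \<integral>\<^sup>+y. g (i, y) * indicator S (i, y) \<partial>count_space UNIV \<partial>count_space UNIV)"
    by (simp add: Lop_eq_nn_integral term_eq)
  also have "\<dots> = (\<integral>\<^sup>+z. g z * indicator S z \<partial>count_space UNIV)"
    by (rule nn_integral_fst_count_space[of "\<lambda>z. g z * indicator S z"])
  also have "\<dots> = (\<integral>\<^sup>+z. g z \<partial>count_space S)" by (rule nn_integral_count_space_indicator[symmetric]) simp
  also have "\<dots> = (\<integral>\<^sup>+z. ennreal (exp (birkhoff_sum (Suc n) \<phi> (snd z))) \<partial>count_space S)"
    using gS by (intro nn_integral_cong) simp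
  also have "\<dots> = (\<integral>\<^sup>+y. ennreal (exp (birkhoff_sum (Suc n) \<phi> y)) \<partial>count_space (preimages a (Suc n) (fst p)))"
    by (rule nn_integral_bij_count_space[OF bij])
  finally show ?thesis by (simp add: iter_op_def)
qed

lemma measurable_iter_op [measurable]: "(\<lambda>p. iter_op a n (fst p)) \<in> borel_measurable MX"
proof (induction n)
  case 0
  have "iter_op a 0 (fst p) = (if fst p 0 = a then 1 else 0)" if "p \<in> space MX" for p
  proof -
    have "preimages a 0 (fst p) = (if fst p 0 = a then {fst p} else {})"
      using that by (auto simp: preimages_def in_X)
    then show ?thesis by (simp add: iter_op_def nn_integral_count_space_finite)
  qed
  moreover have "(\<lambda>p. if fst p 0 = a then 1 else 0 :: ennreal) \<in> borel_measurable MX" by measurable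
  ultimately show ?case by (subst measurable_cong) auto
next
  case (Suc n)
  then have "Lop (\<lambda>q. iter_op a n (fst q)) \<in> borel_measurable MX" by (rule measurable_Lop)
  then show ?case by (subst measurable_cong[of _ _ "Lop (\<lambda>q. iter_op a n (fst q))"]) (simp_all add: Lop_iter_op)
qed

lemma base_path:
  assumes x: "x \<in> mshift I A" "x' \<in> mshift I A"
  obtains k\<^sub>0 where "\<And>k. k \<ge> k\<^sub>0 \<Longrightarrow> \<exists>z\<in>mshift I A. z 0 = x 0 \<and> (left_shift ^^ k) z = x'"
proof -
  define s t where "s = (x, \<one>)" and "t = (x', \<one>)"
  have st: "s \<in> X" "t \<in> X" using x by (auto simp: s_def t_def in_X)
  obtain k\<^sub>0 where k\<^sub>0: "\<And>k. k \<ge> k\<^sub>0 \<Longrightarrow> \<exists>r\<in>nb 1 s. (T ^^ k) r \<in> nb 1 t" using path[OF st] by blast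
  have "\<exists>z\<in>mshift I A. z 0 = x 0 \<and> (left_shift ^^ k) z = x'" if k: "k \<ge> k\<^sub>0" for k
  proof -
    obtain r where r: "r \<in> nb 1 s" "(T ^^ k) r \<in> nb 1 t" using k\<^sub>0[OF k] by blast
    have rX: "r \<in> X" using r nb_subset by blast
    obtain q where q: "q \<in> nb (Suc k) r" "(T ^^ k) q = t"
      using concatenate[OF rX, of t k] nb_sym[OF st(2) r(2)] by blast
    have "fst q \<in> mshift I A" "fst q 0 = x 0" using q(1) r(1) by (auto simp: nb_def s_def in_X)
    moreover have "(left_shift ^^ k) (fst q) = x'" using q(2) by (simp add: fst_Tn[symmetric] t_def)
    ultimately show ?thesis by blast
  qed
  then show ?thesis using that by blast
qed

text \<open>A Harnack inequality: prolonging an \<open>n\<close>-th preimage of \<open>x\<close> by a fixed path from the first letter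
  of \<open>x\<close> to \<open>x'\<close> gives an \<open>(n + k)\<close>-th preimage of \<open>x'\<close>.\<close>

lemma iter_op_harnack:
  assumes x: "x \<in> mshift I A" "x' \<in> mshift I A"
  obtains C k where "C > 0" "\<And>n. iter_op a n x \<le> ennreal C * iter_op a (n + k) x'"
proof -
  obtain k\<^sub>0 where "\<And>k. k \<ge> k\<^sub>0 \<Longrightarrow> \<exists>z\<in>mshift I A. z 0 = x 0 \<and> (left_shift ^^ k) z = x'"
    using base_path[OF x] by blast
  then obtain z where z: "z \<in> mshift I A" "z 0 = x 0" "(left_shift ^^ k\<^sub>0) z = x'" by blast
  obtain \<Delta> :: real where \<Delta>: "\<Delta> \<ge> 0"
    "\<And>n x y. x \<in> mshift I A \<Longrightarrow> y \<in> mshift I A \<Longrightarrow> (\<And>k. k < n \<Longrightarrow> x k = y k) \<Longrightarrow>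
       \<bar>birkhoff_sum n \<phi> x - birkhoff_sum n \<phi> y\<bar> \<le> \<Delta>"
    using bounded_distortion[OF hoelder] by blast
  define C where "C = exp (\<Delta> - birkhoff_sum k\<^sub>0 \<phi> z)"
  have "iter_op a n x \<le> ennreal C * iter_op a (n + k\<^sub>0) x'" for n
    unfolding iter_op_def
  proof (rule nn_integral_count_space_injection)
    define j where "j y = (\<lambda>i. if i < n then y i else z (i - n))" for y
    have jn: "(left_shift ^^ n) (j y) = z" for y by (rule ext) (simp add: left_shift_funpow j_def)
    have yn: "y (n + i) = x i" if "y \<in> preimages a n x" for y i
      using that left_shift_funpow[of n y i] by (simp add: preimages_def)
    show "inj_on j (preimages a n x)"
    proof (rule inj_onI)
      fix y y' assume y: "y \<in> preimages a n x" "y' \<in> preimages a n x" "j y = j y'"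
      show "y = y'"
      proof
        fix i
        show "y i = y' i"
        proof (cases "i < n")
          case True
          then show ?thesis using fun_cong[OF y(3), of i] by (simp add: j_def)
        next
          case False
          then show ?thesis using yn[OF y(1), of "i - n"] yn[OF y(2), of "i - n"] by simp
        qed
      qed
    qed
    have jm: "j y \<in> mshift I A" if y: "y \<in> preimages a n x" for y
    proof -
      have ym: "y \<in> mshift I A" using y by (simp add: preimages_def)
      have jy: "j y i = y i" if "i \<le> n" for i using that yn[OF y, of 0] z(2) by (auto simp: j_def)
      show ?thesis
        unfolding mshift_def
      proof (intro CollectI conjI allI)
        fix i
        show "j y i \<in> I" using ym z(1) by (auto simp: j_def mshift_def)
        show "A (j y i) (j y (Suc i))"
        proof (cases "i < n")
          case True
          then show ?thesis using ym jy[of i] jy[of "Suc i"] by (simp add: mshift_def)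
        next
          case False
          then have "Suc i - n = Suc (i - n)" by simp
          then show ?thesis using False z(1) by (simp add: j_def mshift_def)
        qed
      qed
    qed
    show "j ` preimages a n x \<subseteq> preimages a (n + k\<^sub>0) x'"
    proof (rule image_subsetI)
      fix y assume y: "y \<in> preimages a n x"
      have "(left_shift ^^ (n + k\<^sub>0)) (j y) = (left_shift ^^ k\<^sub>0) ((left_shift ^^ n) (j y))"
        by (simp add: add.commute[of n] funpow_add)
      then have "(left_shift ^^ (n + k\<^sub>0)) (j y) = x'" by (simp add: jn z(3))
      moreover have "j y 0 = a" using y yn[OF y, of 0] z(2) by (auto simp: j_def preimages_def)
      ultimately show "j y \<in> preimages a (n + k\<^sub>0) x'" using jm[OF y] by (simp add: preimages_def)
    qed
    fix y assume y: "y \<in> preimages a n x"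
    have "\<bar>birkhoff_sum n \<phi> y - birkhoff_sum n \<phi> (j y)\<bar> \<le> \<Delta>"
      using y jm[OF y] by (intro \<Delta>) (auto simp: j_def preimages_def)
    then have "birkhoff_sum n \<phi> y \<le> \<Delta> - birkhoff_sum k\<^sub>0 \<phi> z + birkhoff_sum (n + k\<^sub>0) \<phi> (j y)"
      by (simp add: birkhoff_sum_add jn)
    then have "exp (birkhoff_sum n \<phi> y) \<le> C * exp (birkhoff_sum (n + k\<^sub>0) \<phi> (j y))"
      unfolding C_def exp_add[symmetric] by simp
    then show "ennreal (exp (birkhoff_sum n \<phi> y)) \<le> ennreal C * ennreal (exp (birkhoff_sum (n + k\<^sub>0) \<phi> (j y)))"
      by (subst ennreal_mult''[symmetric]) (auto intro: ennreal_leI)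
  qed
  then show ?thesis using that[of C k\<^sub>0] by (simp add: C_def)
qed

lemma iter_op_le_partition_fun:
  obtains C where "C > 0"
    "\<And>n x. x \<in> mshift I A \<Longrightarrow> n \<ge> 1 \<Longrightarrow> iter_op (x 0) n x \<le> ennreal C * partition_fun I A \<phi> (x 0) n"
proof -
  obtain \<Delta> :: real where \<Delta>: "\<Delta> \<ge> 0"
    "\<And>n x y. x \<in> mshift I A \<Longrightarrow> y \<in> mshift I A \<Longrightarrow> (\<And>k. k < n \<Longrightarrow> x k = y k) \<Longrightarrow>
       \<bar>birkhoff_sum n \<phi> x - birkhoff_sum n \<phi> y\<bar> \<le> \<Delta>"
    using bounded_distortion[OF hoelder] by blast
  have "iter_op (x 0) n x \<le> ennreal (exp \<Delta>) * partition_fun I A \<phi> (x 0) n"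
    if x: "x \<in> mshift I A" and n: "n \<ge> 1" for n x
  proof -
    define D where "D = {z \<in> mshift I A. z 0 = x 0 \<and> (left_shift ^^ n) z = z}"
    have Dmod: "z i = z (i mod n)" if "z \<in> D" for z i
    proof (induction i rule: less_induct)
      case (less i)
      show ?case
      proof (cases "i < n")
        case False
        have "z i = (left_shift ^^ n) z (i - n)" using False by (simp add: left_shift_funpow)
        also have "\<dots> = z (i - n)" using that by (simp add: D_def)
        also have "\<dots> = z ((i - n) mod n)" using False n by (intro less) auto
        finally show ?thesis using False by (metis le_mod_geq not_less)
      qed simp
    qed
    have cnt: "countable D"
    proof (rule countable_image_inj_on)
      show "countable ((\<lambda>z. map z [0..<n]) ` D)" by simp
      show "inj_on (\<lambda>z. map z [0..<n]) D"
      proof (rule inj_onI, rule ext)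
        fix z z' i assume z: "z \<in> D" "z' \<in> D" "map z [0..<n] = map z' [0..<n]"
        have "z (i mod n) = z' (i mod n)" using z(3) n by (simp add: list_eq_iff_nth_eq)
        then show "z i = z' i" using Dmod[OF z(1), of i] Dmod[OF z(2), of i] by simp
      qed
    qed
    have "iter_op (x 0) n x \<le> ennreal (exp \<Delta>) * (\<integral>\<^sup>+z. ennreal (exp (birkhoff_sum n \<phi> z)) \<partial>count_space D)"
      unfolding iter_op_def
    proof (rule nn_integral_count_space_injection)
      define j :: "(nat \<Rightarrow> nat) \<Rightarrow> nat \<Rightarrow> nat" where "j y = (\<lambda>i. y (i mod n))" for y
      have yn: "y (n + i) = x i" if "y \<in> preimages (x 0) n x" for y i
        using that left_shift_funpow[of n y i] by (simp add: preimages_def)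
      show "inj_on j (preimages (x 0) n x)"
      proof (rule inj_onI)
        fix y y' assume y: "y \<in> preimages (x 0) n x" "y' \<in> preimages (x 0) n x" "j y = j y'"
        show "y = y'"
        proof
          fix i
          show "y i = y' i"
          proof (cases "i < n")
            case True
            then show ?thesis using fun_cong[OF y(3), of i] by (simp add: j_def)
          next
            case False
            then show ?thesis using yn[OF y(1), of "i - n"] yn[OF y(2), of "i - n"] by simp
          qed
        qed
      qed
      have jm: "j y \<in> mshift I A" if y: "y \<in> preimages (x 0) n x" for y
      proof -
        have ym: "y \<in> mshift I A" "y 0 = x 0" using y by (auto simp: preimages_def)
        show ?thesis
          unfolding mshift_def
        proof (intro CollectI conjI allI)
          fix i
          show "j y i \<in> I" using ym by (auto simp: j_def mshift_def)
          show "A (j y i) (j y (Suc i))"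
          proof (cases "Suc i mod n = 0")
            case True
            then have "Suc (i mod n) = n" using n by (simp add: mod_Suc split: if_splits)
            moreover have "y n = y 0" using yn[OF y, of 0] ym(2) by simp
            moreover have "A (y (i mod n)) (y (Suc (i mod n)))" using ym(1) unfolding mshift_def by blast
            ultimately show ?thesis using True by (simp add: j_def)
          next
            case False
            then have "Suc i mod n = Suc (i mod n)" by (simp add: mod_Suc split: if_splits)
            then show ?thesis using ym(1) by (simp add: j_def mshift_def)
          qed
        qed
      qed
      show "j ` preimages (x 0) n x \<subseteq> D"
      proof (rule image_subsetI)
        fix y assume y: "y \<in> preimages (x 0) n x"
        have "(left_shift ^^ n) (j y) = j y" by (rule ext) (simp add: left_shift_funpow j_def)
        moreover have "j y 0 = x 0" using y by (simp add: j_def preimages_def)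
        ultimately show "j y \<in> D" using jm[OF y] by (simp add: D_def)
      qed
      fix y assume y: "y \<in> preimages (x 0) n x"
      have "\<bar>birkhoff_sum n \<phi> y - birkhoff_sum n \<phi> (j y)\<bar> \<le> \<Delta>"
        using y jm[OF y] by (intro \<Delta>) (auto simp: j_def preimages_def)
      then have "exp (birkhoff_sum n \<phi> y) \<le> exp \<Delta> * exp (birkhoff_sum n \<phi> (j y))"
        unfolding exp_add[symmetric] by simp
      then show "ennreal (exp (birkhoff_sum n \<phi> y)) \<le> ennreal (exp \<Delta>) * ennreal (exp (birkhoff_sum n \<phi> (j y)))"
        by (subst ennreal_mult''[symmetric]) (auto intro: ennreal_leI)
    qed
    also have "\<dots> \<le> ennreal (exp \<Delta>) * partition_fun I A \<phi> (x 0) n"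
      unfolding partition_fun_def D_def[symmetric]
      by (intro mult_left_mono nn_integral_count_space_le_infsum cnt) simp
    finally show ?thesis .
  qed
  then show ?thesis using that[of "exp \<Delta>"] by simp
qed

lemma iter_op_pos:
  assumes x: "x \<in> mshift I A"
  obtains k\<^sub>0 where "\<And>k. k \<ge> k\<^sub>0 \<Longrightarrow> iter_op (x 0) k x > 0"
proof -
  obtain k\<^sub>0 where k\<^sub>0: "\<And>k. k \<ge> k\<^sub>0 \<Longrightarrow> \<exists>z\<in>mshift I A. z 0 = x 0 \<and> (left_shift ^^ k) z = x"
    using base_path[OF x x] by blast
  have "iter_op (x 0) k x > 0" if k: "k \<ge> k\<^sub>0" for k
  proof -
    obtain z where z: "z \<in> preimages (x 0) k x" using k\<^sub>0[OF k] unfolding preimages_def by blast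
    have "0 < ennreal (exp (birkhoff_sum k \<phi> z))" by simp
    also have "\<dots> \<le> iter_op (x 0) k x" unfolding iter_op_def by (rule nn_integral_ge_point[OF z])
    finally show ?thesis .
  qed
  then show ?thesis using that by blast
qed

lemma Lop_suminf:
  assumes "\<And>n. u n \<in> borel_measurable MX"
  shows "Lop (\<lambda>p. \<Sum>n. u n p) p = (\<Sum>n. Lop (u n) p)"
proof -
  have "branch_term i (\<lambda>p. \<Sum>n. u n p) p = (\<Sum>n. branch_term i (u n) p)" for i
    by (simp add: branch_term_def)
  then show ?thesis unfolding Lop_eq_nn_integral by (simp add: nn_integral_suminf)
qed

lemma Lop_liminf_le: "Lop (\<lambda>p. liminf (\<lambda>n. u n p)) p \<le> liminf (\<lambda>n. Lop (u n) p)"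
proof -
  have "branch_term i (\<lambda>p. liminf (\<lambda>n. u n p)) p \<le> liminf (\<lambda>n. branch_term i (u n) p)" for i
    using cmult_liminf_le[of "ennreal (exp (\<phi> (fst (prepend i p)))) * indicator (succ_set i) p" "\<lambda>n. u n (prepend i p)"]
    by (simp add: branch_term_def mult_ac)
  then have "Lop (\<lambda>p. liminf (\<lambda>n. u n p)) p \<le> (\<integral>\<^sup>+i. liminf (\<lambda>n. branch_term i (u n) p) \<partial>count_space UNIV)"
    unfolding Lop_eq_nn_integral by (intro nn_integral_mono) simp
  also have "\<dots> \<le> liminf (\<lambda>n. Lop (u n) p)"
    unfolding Lop_eq_nn_integral by (rule nn_integral_liminf) simp
  finally show ?thesis .
qed

text \<open>The function \<open>U\<close> is a tail of the Green function \<open>\<Sum>n. exp (- n s) iter_op a n\<close>, which converges for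
  \<open>s > P\<close>. Finitely many terms are dropped because small partition functions may be infinite.\<close>

lemma green_function:
  assumes x\<^sub>0: "x\<^sub>0 \<in> mshift I A" "x\<^sub>0 0 = (SOME a. a \<in> I)"
    and press: "gurevich_pressure I A \<phi> = ereal P" and s: "s > P"
  obtains U where "(\<lambda>p. U (fst p)) \<in> borel_measurable MX" "0 < U x\<^sub>0" "U x\<^sub>0 < \<infinity>"
    "\<And>p. p \<in> X \<Longrightarrow> Lop (\<lambda>q. U (fst q)) p \<le> ennreal (exp s) * U (fst p)"
    "\<And>x x' C k. x \<in> mshift I A \<Longrightarrow> x' \<in> mshift I A \<Longrightarrow> (\<And>n. iter_op (x\<^sub>0 0) n x \<le> ennreal C * iter_op (x\<^sub>0 0) (n + k) x') \<Longrightarrow>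
       C > 0 \<Longrightarrow> U x \<le> ennreal (C * exp (real k * s)) * U x'"
proof -
  define a where "a = x\<^sub>0 0"
  define q where "q = (P + s) / 2"
  have q: "P < q" "q < s" using s by (auto simp: q_def)
  have "limsup (\<lambda>n. ext_ln (partition_fun I A \<phi> a n) / ereal (real n)) < ereal q"
    using press q(1) unfolding gurevich_pressure_def Let_def a_def x\<^sub>0(2) by simp
  then obtain N\<^sub>0 where N\<^sub>0: "\<And>n. n \<ge> N\<^sub>0 \<Longrightarrow> partition_fun I A \<phi> a n \<le> ennreal (exp (real n * q))"
    using exp_bound_of_limsup by blast
  obtain D where D: "D > 0" "\<And>n. n \<ge> 1 \<Longrightarrow> iter_op a n x\<^sub>0 \<le> ennreal D * partition_fun I A \<phi> a n"
    unfolding a_def using iter_op_le_partition_fun x\<^sub>0(1) by metis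
  define N where "N = Suc N\<^sub>0"
  define t where "t x n = ennreal (exp (- real (n + N) * s)) * iter_op a (n + N) x" for x n
  define U where "U x = (\<Sum>n. t x n)" for x
  have "(\<lambda>p. U (fst p)) \<in> borel_measurable MX" unfolding U_def t_def by measurable
  moreover have "0 < U x\<^sub>0"
  proof -
    obtain k\<^sub>0 where "iter_op a (k\<^sub>0 + N) x\<^sub>0 > 0" using iter_op_pos[OF x\<^sub>0(1)] unfolding a_def by (metis le_add1)
    then have "0 < t x\<^sub>0 k\<^sub>0" by (simp add: t_def ennreal_zero_less_mult_iff)
    also have "\<dots> = sum (t x\<^sub>0) {k\<^sub>0}" by simp
    also have "\<dots> \<le> U x\<^sub>0" unfolding U_def by (intro sum_le_suminf) auto
    finally show ?thesis .
  qed
  moreover have "U x\<^sub>0 < \<infinity>"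
  proof -
    define r where "r = exp (q - s)"
    have r: "0 < r" "r < 1" using q by (auto simp: r_def)
    have "t x\<^sub>0 n \<le> ennreal (D * r ^ N * r ^ n)" for n
    proof -
      have "t x\<^sub>0 n \<le> ennreal (exp (- real (n + N) * s)) * (ennreal D * ennreal (exp (real (n + N) * q)))"
        unfolding t_def
      proof (intro mult_left_mono)
        have "iter_op a (n + N) x\<^sub>0 \<le> ennreal D * partition_fun I A \<phi> a (n + N)" by (intro D) (simp add: N_def)
        also have "\<dots> \<le> ennreal D * ennreal (exp (real (n + N) * q))"
          by (intro mult_left_mono N\<^sub>0) (auto simp: N_def)
        finally show "iter_op a (n + N) x\<^sub>0 \<le> ennreal D * ennreal (exp (real (n + N) * q))" .
      qed simp
      also have "\<dots> = ennreal (D * (exp (- real (n + N) * s) * exp (real (n + N) * q)))"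
        using D(1) by (simp add: ennreal_mult'[symmetric] mult_ac)
      also have "exp (- real (n + N) * s) * exp (real (n + N) * q) = r ^ (n + N)"
        by (simp add: r_def exp_of_nat_mult[symmetric] exp_add[symmetric] algebra_simps)
      finally show ?thesis by (simp add: power_add mult_ac)
    qed
    then have "U x\<^sub>0 \<le> (\<Sum>n. ennreal (D * r ^ N * r ^ n))" unfolding U_def by (intro suminf_le) auto
    also have "\<dots> = ennreal (D * r ^ N * (1 / (1 - r)))"
      using D r by (intro suminf_ennreal_eq sums_mult geometric_sums) auto
    finally show ?thesis by (simp add: order_le_less_trans)
  qed
  moreover have "Lop (\<lambda>p. U (fst p)) p \<le> ennreal (exp s) * U (fst p)" if p: "p \<in> X" for p
  proof -
    have "Lop (\<lambda>p. U (fst p)) p = (\<Sum>n. Lop (\<lambda>p. t (fst p) n) p)"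
      unfolding U_def by (rule Lop_suminf) (simp add: t_def)
    also have "\<dots> = (\<Sum>n. ennreal (exp s) * t (fst p) (n + 1))"
    proof (rule suminf_cong)
      fix n
      have "Lop (\<lambda>p. t (fst p) n) p = ennreal (exp (- real (n + N) * s)) * iter_op a (Suc (n + N)) (fst p)"
        unfolding t_def Lop_cmult using Lop_iter_op[OF p, of a "n + N"] by simp
      also have "exp (- real (n + N) * s) = exp s * exp (- real (n + 1 + N) * s)"
        by (simp add: exp_add[symmetric] algebra_simps)
      finally show "Lop (\<lambda>p. t (fst p) n) p = ennreal (exp s) * t (fst p) (n + 1)"
        by (simp add: t_def ennreal_mult' mult.assoc)
    qed
    also have "\<dots> = ennreal (exp s) * (\<Sum>n. t (fst p) (n + 1))" by simp
    also have "(\<Sum>n. t (fst p) (n + 1)) \<le> U (fst p)"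
      unfolding U_def using suminf_offset[of "t (fst p)" 1] by simp
    finally show ?thesis by (simp add: mult_left_mono)
  qed
  moreover have "U x \<le> ennreal (C * exp (real k * s)) * U x'"
    if C: "\<And>n. iter_op (x\<^sub>0 0) n x \<le> ennreal C * iter_op (x\<^sub>0 0) (n + k) x'" "C > 0" for x x' C k
  proof -
    have "t x n \<le> ennreal (C * exp (real k * s)) * t x' (n + k)" for n
    proof -
      have "t x n \<le> ennreal (exp (- real (n + N) * s)) * (ennreal C * iter_op a (n + N + k) x')"
        unfolding t_def a_def by (intro mult_left_mono C) simp
      also have "\<dots> = ennreal (C * exp (- real (n + N) * s)) * iter_op a (n + N + k) x'"
        using C(2) by (simp add: ennreal_mult' mult_ac)
      also have "exp (- real (n + N) * s) = exp (real k * s) * exp (- real (n + k + N) * s)"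
        by (simp add: exp_add[symmetric] algebra_simps)
      also have "ennreal (C * (exp (real k * s) * exp (- real (n + k + N) * s))) * iter_op a (n + N + k) x'
          = ennreal (C * exp (real k * s)) * t x' (n + k)"
        using C(2) by (simp add: t_def ennreal_mult' mult.assoc add.commute add.left_commute)
      finally show ?thesis .
    qed
    then have "U x \<le> (\<Sum>n. ennreal (C * exp (real k * s)) * t x' (n + k))" unfolding U_def by (intro suminf_le) auto
    also have "\<dots> = ennreal (C * exp (real k * s)) * (\<Sum>n. t x' (n + k))" by simp
    also have "(\<Sum>n. t x' (n + k)) \<le> U x'" unfolding U_def using suminf_offset[of "t x'" k] by simp
    finally show ?thesis by (simp add: mult_left_mono)
  qed
  ultimately show ?thesis using that[of U] by blast
qed

text \<open>The Green functions, normalised at the base point \<open>x\<^sub>0\<close>, are bounded above and below by the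
  Harnack inequality, uniformly for \<open>s\<close> near \<open>P\<close>. Their limit inferior for \<open>s \<rightarrow> P\<close> is superharmonic by
  Fatou's lemma.\<close>

lemma base_superharmonic:
  assumes x\<^sub>0: "x\<^sub>0 \<in> mshift I A" "x\<^sub>0 0 = (SOME a. a \<in> I)"
    and press: "gurevich_pressure I A \<phi> = ereal P"
  obtains u where "(\<lambda>p. u (fst p)) \<in> borel_measurable MX"
    "\<And>x. x \<in> mshift I A \<Longrightarrow> 0 < u x \<and> u x < \<infinity>"
    "\<And>p. p \<in> X \<Longrightarrow> Lop (\<lambda>q. u (fst q)) p \<le> ennreal (exp P) * u (fst p)"
proof -
  define s where "s j = P + 1 / real (Suc j)" for j
  have sP: "s j > P" for j by (simp add: s_def)
  have s_mono: "s j \<le> s i" if "i \<le> j" for i j using that by (simp add: s_def frac_le)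
  have sb: "\<bar>s j\<bar> \<le> \<bar>P\<bar> + 1" for j
  proof -
    have "1 / real (Suc j) \<le> 1" "0 \<le> 1 / real (Suc j)" by simp_all
    then show ?thesis unfolding s_def by linarith
  qed
  have "\<exists>U. (\<lambda>p. U (fst p)) \<in> borel_measurable MX \<and> 0 < U x\<^sub>0 \<and> U x\<^sub>0 < \<infinity> \<and>
    (\<forall>p\<in>X. Lop (\<lambda>q. U (fst q)) p \<le> ennreal (exp (s j)) * U (fst p)) \<and>
    (\<forall>x x' C k. x \<in> mshift I A \<longrightarrow> x' \<in> mshift I A \<longrightarrow> (\<forall>n. iter_op (x\<^sub>0 0) n x \<le> ennreal C * iter_op (x\<^sub>0 0) (n + k) x') \<longrightarrow>
       C > 0 \<longrightarrow> U x \<le> ennreal (C * exp (real k * s j)) * U x')" for j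
    by (rule green_function[OF x\<^sub>0 press sP[of j]]) blast
  then obtain U where U: "\<And>j. (\<lambda>p. U j (fst p)) \<in> borel_measurable MX" "\<And>j. 0 < U j x\<^sub>0" "\<And>j. U j x\<^sub>0 < \<infinity>"
    "\<And>j p. p \<in> X \<Longrightarrow> Lop (\<lambda>q. U j (fst q)) p \<le> ennreal (exp (s j)) * U j (fst p)"
    "\<And>j x x' C k. x \<in> mshift I A \<Longrightarrow> x' \<in> mshift I A \<Longrightarrow> (\<forall>n. iter_op (x\<^sub>0 0) n x \<le> ennreal C * iter_op (x\<^sub>0 0) (n + k) x') \<Longrightarrow>
       C > 0 \<Longrightarrow> U j x \<le> ennreal (C * exp (real k * s j)) * U j x'"
    by metis
  define v where "v j x = inverse (U j x\<^sub>0) * U j x" for j x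
  have iU: "inverse (U j x\<^sub>0) * U j x\<^sub>0 = 1" for j
  proof -
    have "U j x\<^sub>0 / U j x\<^sub>0 = 1" using U(2,3)[of j] by (intro ennreal_divide_self) auto
    then show ?thesis by (simp add: divide_ennreal_def mult.commute)
  qed
  have v_bound: "\<exists>B>0. \<forall>j. v j x \<le> ennreal B * v j x'" if x: "x \<in> mshift I A" "x' \<in> mshift I A" for x x'
  proof -
    obtain C k where C: "C > 0" "\<And>n. iter_op (x\<^sub>0 0) n x \<le> ennreal C * iter_op (x\<^sub>0 0) (n + k) x'"
      using iter_op_harnack[OF x, of "x\<^sub>0 0"] by blast
    define B where "B = C * exp (real k * (\<bar>P\<bar> + 1))"
    have "v j x \<le> ennreal B * v j x'" for j
    proof -
      have "s j \<le> \<bar>P\<bar> + 1" using sb[of j] by simp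
      then have "real k * s j \<le> real k * (\<bar>P\<bar> + 1)" by (intro mult_left_mono) simp_all
      then have "C * exp (real k * s j) \<le> B" using C(1) by (simp add: B_def)
      then have "ennreal (C * exp (real k * s j)) * U j x' \<le> ennreal B * U j x'"
        by (intro mult_right_mono ennreal_leI) simp_all
      then have "U j x \<le> ennreal B * U j x'" using U(5)[OF x, of C k j] C by (meson order_trans)
      then have "inverse (U j x\<^sub>0) * U j x \<le> inverse (U j x\<^sub>0) * (ennreal B * U j x')" by (intro mult_left_mono) simp_all
      then show ?thesis by (simp add: v_def mult.left_commute)
    qed
    moreover have "B > 0" using C(1) by (simp add: B_def)
    ultimately show ?thesis by blast
  qed
  define u where "u x = liminf (\<lambda>j. v j x)" for x
  have um: "(\<lambda>p. u (fst p)) \<in> borel_measurable MX"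
    unfolding u_def v_def using U(1) by measurable
  have pos: "0 < u x \<and> u x < \<infinity>" if x: "x \<in> mshift I A" for x
  proof
    obtain B where B: "B > 0" "\<And>j. v j x\<^sub>0 \<le> ennreal B * v j x" using v_bound[OF x\<^sub>0(1) x] by blast
    have "ennreal (1 / B) \<le> v j x" for j
    proof -
      have "ennreal (1 / B) * 1 \<le> ennreal (1 / B) * (ennreal B * v j x)"
        using B(2)[of j] iU[of j] by (intro mult_left_mono) (simp_all add: v_def)
      also have "\<dots> = v j x" using B(1) by (simp add: mult.assoc[symmetric] ennreal_mult'[symmetric])
      finally show ?thesis by simp
    qed
    then have "ennreal (1 / B) \<le> u x" unfolding u_def by (intro Liminf_bounded) simp
    moreover have "0 < ennreal (1 / B)" using B(1) by simp
    ultimately show "0 < u x" by (rule less_le_trans[rotated])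
    obtain B where B: "B > 0" "\<And>j. v j x \<le> ennreal B * v j x\<^sub>0" using v_bound[OF x x\<^sub>0(1)] by blast
    then have "v j x \<le> ennreal B" for j using iU[of j] B(2)[of j] by (simp add: v_def)
    then have "u x \<le> limsup (\<lambda>j. v j x)" "limsup (\<lambda>j. v j x) \<le> ennreal B"
      unfolding u_def by (intro Liminf_le_Limsup Limsup_bounded; simp)+
    then have "u x \<le> ennreal B" by (rule order_trans)
    then show "u x < \<infinity>" by (simp add: order_le_less_trans)
  qed
  have "Lop (\<lambda>q. u (fst q)) p \<le> ennreal (exp P) * u (fst p)" if p: "p \<in> X" for p
  proof -
    have Lv: "Lop (\<lambda>q. v j (fst q)) p \<le> ennreal (exp (s j)) * v j (fst p)" for j
      unfolding v_def Lop_cmult using mult_left_mono[OF U(4)[OF p, of j], of "inverse (U j x\<^sub>0)"]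
      by (simp add: mult.left_commute)
    have level: "ennreal (exp (- s J)) * Lop (\<lambda>q. u (fst q)) p \<le> u (fst p)" for J
    proof -
      have "ennreal (exp (- s J)) * Lop (\<lambda>q. u (fst q)) p \<le> ennreal (exp (- s J)) * liminf (\<lambda>j. Lop (\<lambda>q. v j (fst q)) p)"
        unfolding u_def by (intro mult_left_mono Lop_liminf_le) simp
      also have "\<dots> \<le> liminf (\<lambda>j. ennreal (exp (- s J)) * Lop (\<lambda>q. v j (fst q)) p)" by (rule cmult_liminf_le)
      also have "\<dots> \<le> u (fst p)"
        unfolding u_def
      proof (rule Liminf_mono)
        show "\<forall>\<^sub>F j in sequentially. ennreal (exp (- s J)) * Lop (\<lambda>q. v j (fst q)) p \<le> v j (fst p)"
          using eventually_ge_at_top[of J]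
        proof eventually_elim
          case (elim j)
          have "ennreal (exp (- s J)) * Lop (\<lambda>q. v j (fst q)) p \<le> ennreal (exp (- s J)) * (ennreal (exp (s j)) * v j (fst p))"
            using Lv by (intro mult_left_mono) simp_all
          also have "\<dots> = ennreal (exp (- s J) * exp (s j)) * v j (fst p)" by (simp add: ennreal_mult' mult.assoc)
          also have "\<dots> \<le> 1 * v j (fst p)"
          proof (rule mult_right_mono)
            have "exp (- s J) * exp (s j) \<le> 1" using s_mono[OF elim] by (simp add: exp_add[symmetric])
            then show "ennreal (exp (- s J) * exp (s j)) \<le> 1" by (simp add: ennreal_le_1)
          qed simp
          finally show ?case by simp
        qed
      qed
      finally show ?thesis .
    qed
    have ufin: "u (fst p) < \<infinity>" using pos p by (simp add: in_X)
    have "Lop (\<lambda>q. u (fst q)) p \<noteq> \<infinity>"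
    proof
      assume "Lop (\<lambda>q. u (fst q)) p = \<infinity>"
      then show False using level[of 0] ufin by (simp add: ennreal_mult_top top_unique)
    qed
    then obtain L where L: "Lop (\<lambda>q. u (fst q)) p = ennreal L" "L \<ge> 0"
      by (cases "Lop (\<lambda>q. u (fst q)) p") auto
    obtain w where w: "u (fst p) = ennreal w" "w \<ge> 0" using ufin by (cases "u (fst p)") auto
    have le: "exp (- s J) * L \<le> w" for J
      using level[of J] L w by (simp add: ennreal_mult'[symmetric])
    have "(\<lambda>J. exp (- s J) * L) \<longlonglongrightarrow> exp (- (P + 0)) * L"
      unfolding s_def by (intro tendsto_intros LIMSEQ_Suc[OF lim_1_over_n])
    then have "exp (- (P + 0)) * L \<le> w" by (rule LIMSEQ_le_const2) (use le in auto)
    then have "L \<le> exp P * w" by (simp add: exp_minus field_simps)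
    then show ?thesis unfolding L w by (simp add: ennreal_mult'[symmetric] ennreal_leI)
  qed
  then show ?thesis using that um pos by blast
qed

end

section \<open>The equivalences\<close>

context equilibrium
begin

lemma AE_m_of_AE_\<nu>:
  assumes "AE p in \<nu>. Q p" shows "AE p in m. Q p"
proof -
  obtain R where R: "m = density \<nu> (\<lambda>p. ennreal (R * h p))" using m_eq_density by blast
  have "AE p in density \<nu> (\<lambda>p. ennreal (R * h p)). Q p"
    by (subst AE_density) (use assms in auto)
  then show ?thesis by (simp only: R[symmetric])
qed

lemma c_trivial_of_h:
  assumes "x \<in> mshift I A" "\<And>g. g \<in> carrier G \<Longrightarrow> h (x, g) = h (x, \<one>)"
  shows "\<forall>g\<in>carrier G. c g = 1"
proof -
  obtain K where K: "K > 0" "\<And>p. p \<in> X \<Longrightarrow> h p \<le> K * c (snd p)" using h_le_c by blast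
  have "h (x, \<one>) / K \<le> c g" if g: "g \<in> carrier G" for g
    using K(2)[of "(x, g)"] assms(1) assms(2)[OF g] g K(1) by (simp add: in_X field_simps)
  moreover have "h (x, \<one>) / K > 0" using h_pos[of "(x, \<one>)"] assms(1) K(1) by (simp add: in_X)
  ultimately show ?thesis by (intro c_trivial_of_lower_bound)
qed

lemma continuous_eq_of_AE:
  assumes f: "\<And>p e. p \<in> X \<Longrightarrow> (e::real) > 0 \<Longrightarrow> \<exists>n. \<forall>q\<in>nb n p. \<bar>f q - f p\<bar> < e"
    and ae: "AE p in \<nu>. f p = 0" and p: "p \<in> X"
  shows "f p = 0"
proof (rule ccontr)
  assume "f p \<noteq> 0"
  then obtain n where n: "\<forall>q\<in>nb n p. \<bar>f q - f p\<bar> < \<bar>f p\<bar>" using f[OF p, of "\<bar>f p\<bar>"] by auto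
  have ne: "q \<notin> nb (Suc n) p" if "f q = 0" for q
  proof
    assume "q \<in> nb (Suc n) p"
    then have "q \<in> nb n p" using nb_mono[of n "Suc n" p] by auto
    then show False using n that by force
  qed
  have "AE q in \<nu>. q \<notin> nb (Suc n) p" using ae by eventually_elim (rule ne)
  then have "nb (Suc n) p \<in> null_sets \<nu>" using nb_sets by (subst AE_iff_null_sets) (simp_all add: sets_\<nu>)
  then show False using \<nu>_nb_pos[OF p, of n] by auto
qed

text \<open>A left translate of \<open>h\<close> is again harmonic, hence a multiple \<open>\<kappa> h\<close>. If \<open>h\<close> is bounded along the
  fibres, iteration of the translation gives \<open>\<kappa> \<le> 1\<close>.\<close>

lemma h_translation_le:
  assumes c1: "\<forall>g\<in>carrier G. c g = 1" and k: "k \<in> carrier G" and xg: "x \<in> mshift I A" "g \<in> carrier G"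
  shows "h (x, k \<otimes> g) \<le> h (x, g)"
proof -
  define tr where "tr p = (fst p, k \<otimes> snd p)" for p :: "(nat \<Rightarrow> nat) \<times> 'g"
  have trX: "tr p \<in> X" if "p \<in> X" for p using that k by (simp add: tr_def in_X)
  have nbtr: "tr q \<in> nb n (tr p)" if "q \<in> nb n p" for p q n
  proof -
    have "snd p \<in> carrier G" using that by (auto simp: nb_def in_X)
    then show ?thesis using that k by (simp add: tr_def nb_def in_X)
  qed
  have cont: "\<exists>n. \<forall>q\<in>nb n p. \<bar>h (tr q) - h (tr p)\<bar> < e" if "p \<in> X" "e > 0" for p e
    using h_continuous[OF trX[OF that(1)] that(2)] nbtr by blast
  have meas: "(\<lambda>p. h (tr p)) \<in> borel_measurable MX" by (rule continuous_measurable) (rule cont)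
  have Ltr: "Lop (\<lambda>p. ennreal (h (tr p))) p = ennreal (exp P) * ennreal (h (tr p))" if p: "p \<in> X" for p
  proof -
    have "branch_term i (\<lambda>p. ennreal (h (tr p))) p = branch_term i (\<lambda>p. ennreal (h p)) (tr p)" for i
    proof (cases "p \<in> succ_set i")
      case True
      then have i: "i \<in> I" by (simp add: succ_set_def)
      have "tr (prepend i p) = prepend i (tr p)"
        using p k i by (simp add: tr_def prepend_def in_X G.m_assoc)
      moreover have "tr p \<in> succ_set i" using True trX by (auto simp: succ_set_def tr_def)
      ultimately show ?thesis using True by (simp add: branch_term_def) (simp add: prepend_def tr_def)
    next
      case False
      then have "tr p \<notin> succ_set i" using p by (auto simp: succ_set_def tr_def)
      then show ?thesis using False by (simp add: branch_term_def)
    qed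
    then show ?thesis using h_eigen[OF trX[OF p]] by (simp add: Lop_def)
  qed
  have inX: "AE p in \<nu>. p \<in> X" using AE_space[of \<nu>] by simp
  have "AE p in \<nu>. Lop (\<lambda>p. ennreal (h (tr p))) p \<le> ennreal (exp P) * ennreal (h (tr p))"
    using inX by eventually_elim (simp add: Ltr)
  then obtain \<kappa> where \<kappa>: "\<kappa> \<ge> 0" "AE p in \<nu>. ennreal (h (tr p)) = ennreal (\<kappa> * h p)"
    using superharmonic_unique[of "\<lambda>p. ennreal (h (tr p))"] meas by auto
  have ae0: "AE p in \<nu>. h (tr p) - \<kappa> * h p = 0"
    using \<kappa>(2) inX
  proof eventually_elim
    case (elim p)
    then show ?case using h_pos[OF elim(2)] h_pos[OF trX[OF elim(2)]] \<kappa>(1) by simp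
  qed
  have eq: "h (tr p) = \<kappa> * h p" if p: "p \<in> X" for p
  proof -
    have "h (tr p) - \<kappa> * h p = 0"
    proof (rule continuous_eq_of_AE[OF _ ae0 p])
      fix p and e :: real assume pe: "p \<in> X" "e > 0"
      obtain n1 where n1: "\<forall>q\<in>nb n1 p. \<bar>h (tr q) - h (tr p)\<bar> < e / 2" using cont[OF pe(1), of "e / 2"] pe(2) by auto
      obtain n2 where n2: "\<forall>q\<in>nb n2 p. \<bar>h q - h p\<bar> < e / (2 * (\<kappa> + 1))"
        using h_continuous[OF pe(1), of "e / (2 * (\<kappa> + 1))"] pe(2) \<kappa>(1) by auto
      have "\<bar>(h (tr q) - \<kappa> * h q) - (h (tr p) - \<kappa> * h p)\<bar> < e" if q: "q \<in> nb (max n1 n2) p" for q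
      proof -
        have "q \<in> nb n1 p" "q \<in> nb n2 p"
          using q nb_mono[of n1 "max n1 n2" p] nb_mono[of n2 "max n1 n2" p] by auto
        then have 1: "\<bar>h (tr q) - h (tr p)\<bar> < e / 2" and 2: "\<bar>h q - h p\<bar> < e / (2 * (\<kappa> + 1))" using n1 n2 by auto
        have "\<kappa> * \<bar>h q - h p\<bar> \<le> (\<kappa> + 1) * (e / (2 * (\<kappa> + 1)))"
          using 2 \<kappa>(1) by (intro mult_mono) auto
        also have "\<dots> = e / 2" using \<kappa>(1) by (simp add: field_simps)
        finally have "\<bar>\<kappa> * h q - \<kappa> * h p\<bar> \<le> e / 2" using \<kappa>(1) by (simp add: abs_mult right_diff_distrib[symmetric])
        then show ?thesis using 1 by linarith
      qed
      then show "\<exists>n. \<forall>q\<in>nb n p. \<bar>(h (tr q) - \<kappa> * h q) - (h (tr p) - \<kappa> * h p)\<bar> < e" by blast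
    qed
    then show ?thesis by simp
  qed
  have pX: "(x, g) \<in> X" using xg by (simp add: in_X)
  have trn: "(tr ^^ n) (x, g) \<in> X \<and> h ((tr ^^ n) (x, g)) = \<kappa> ^ n * h (x, g)" for n
  proof (induction n)
    case (Suc n)
    then show ?case using trX[of "(tr ^^ n) (x, g)"] eq[of "(tr ^^ n) (x, g)"] by simp
  qed (use pX in simp)
  obtain K where K: "K > 0" "\<And>p. p \<in> X \<Longrightarrow> h p \<le> K * c (snd p)" using h_le_c by blast
  have "h p \<le> K" if "p \<in> X" for p using K(2)[OF that] c1 that by (simp add: in_X)
  then have bd: "\<kappa> ^ n * h (x, g) \<le> K" for n using trn[of n] by metis
  have "\<kappa> \<le> 1"
  proof (rule ccontr)
    assume "\<not> \<kappa> \<le> 1"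
    then obtain n where "K / h (x, g) < \<kappa> ^ n" using real_arch_pow[of \<kappa> "K / h (x, g)"] by auto
    then show False using bd[of n] h_pos[OF pX] by (simp add: field_simps)
  qed
  then have "\<kappa> * h (x, g) \<le> 1 * h (x, g)" using h_pos[OF pX] by (intro mult_right_mono) auto
  then show ?thesis using eq[OF pX] by (simp add: tr_def)
qed

lemma h_independent:
  assumes c1: "\<forall>g\<in>carrier G. c g = 1" and xg: "x \<in> mshift I A" "g \<in> carrier G" "g' \<in> carrier G"
  shows "h (x, g) = h (x, g')"
proof -
  have "h (x, k) \<le> h (x, k')" if k: "k \<in> carrier G" "k' \<in> carrier G" for k k'
  proof -
    have "k \<otimes> inv k' \<otimes> k' = k" using k by (simp add: G.m_assoc)
    then show ?thesis using h_translation_le[OF c1, of "k \<otimes> inv k'" x k'] k xg(1) by simp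
  qed
  then show ?thesis using xg by (simp add: order_antisym)
qed

text \<open>All states \<open>nb 1 (x, g)\<close> with a common first letter have the same \<open>m\<close>-measure, and for a product also
  the same \<open>\<nu>\<close>-measure, so that \<open>m \<le> K c \<nu>\<close> bounds \<open>c\<close> from below.\<close>

lemma c_trivial_of_product:
  assumes prod: "haar_product_measure I A G \<nu>"
  shows "\<forall>g\<in>carrier G. c g = 1"
proof -
  obtain \<mu>' where \<mu>': "sets \<mu>' = sets (borel_of (shift_topology I A))" "\<nu> = \<mu>' \<Otimes>\<^sub>M haar G"
    using prod by (auto simp: haar_product_measure_def)
  obtain K where K: "K > 0" "\<And>r E. r \<in> X \<Longrightarrow> E \<in> sets MX \<Longrightarrow> E \<subseteq> nb 1 r \<Longrightarrow>
    emeasure m E \<le> ennreal (K * c (snd r)) * emeasure \<nu> E"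
    using m_le_\<nu> by blast
  obtain s where s: "s \<in> X" using X_nonempty by blast
  define W where "W = cylinder I A (map (fst s) [0..<1])"
  have Ws: "W \<in> sets (borel_of (shift_topology I A))" unfolding W_def by (rule cylinder_sets)
  have nbW: "nb 1 (fst s, g) = W \<times> {g}" "(fst s, g) \<in> X" if "g \<in> carrier G" for g
    using nb_eq_Times[of "(fst s, g)" 1] that s by (simp_all add: in_X W_def)
  have mg: "emeasure m (nb 1 (fst s, g)) = emeasure \<mu> W" "emeasure \<nu> (nb 1 (fst s, g)) = emeasure \<mu>' W"
    if "g \<in> carrier G" for g
    using that Ws unfolding nbW(1)[OF that] by (subst \<mu>'(2) | simp add: product_slice sets_\<mu> \<mu>'(1))+
  obtain a where a: "emeasure \<mu> W = ennreal a" "a > 0"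
    using quasi_conformal_finite[OF quasi_conformal_m nbW(2)[OF G.one_closed]] mg(1)[OF G.one_closed]
    by (cases "emeasure \<mu> W") auto
  obtain b where b: "emeasure \<mu>' W = ennreal b" "b > 0"
    using \<nu>_state[OF nbW(2)[OF G.one_closed]] mg(2)[OF G.one_closed] by (cases "emeasure \<mu>' W") auto
  have "a / (K * b) \<le> c g" if g: "g \<in> carrier G" for g
  proof -
    have "ennreal a \<le> ennreal (K * c g) * ennreal b"
      using K(2)[OF nbW(2)[OF g] nb_sets subset_refl] mg[OF g] a(1) b(1) by simp
    also have "\<dots> = ennreal (K * c g * b)" using b(2) by (simp add: ennreal_mult'')
    finally have "a \<le> K * c g * b" using K(1) b(2) c_pos[OF g] by (subst (asm) ennreal_le_iff) simp_all
    then show ?thesis using K(1) b(2) by (simp add: field_simps)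
  qed
  moreover have "a / (K * b) > 0" using a b K(1) by simp
  ultimately show ?thesis by (intro c_trivial_of_lower_bound)
qed

text \<open>The measure \<open>\<nu>\<close> has density \<open>1 / (R h)\<close> with respect to \<open>m\<close>, and \<open>h\<close> is a function of the base point.\<close>

lemma product_of_c_trivial:
  assumes c1: "\<forall>g\<in>carrier G. c g = 1"
  shows "haar_product_measure I A G \<nu>"
proof -
  interpret \<mu>: prob_space \<mu> by (rule prob_\<mu>)
  interpret haar: sigma_finite_measure "haar G" by (rule sigma_finite_haar)
  obtain R where R: "R > 0" "m = density \<nu> (\<lambda>p. ennreal (R * h p))" using m_eq_density by blast
  define f where "f x = ennreal (1 / (R * h (x, \<one>)))" for x
  have "(\<lambda>x. (x, \<one>)) \<in> measurable \<mu> m" by (rule measurable_Pair2') simp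
  then have "(\<lambda>x. h (x, \<one>)) \<in> borel_measurable \<mu>"
    by (rule measurable_compose) (simp add: measurable_cong_sets[OF sets_m refl])
  then have fm: "f \<in> borel_measurable \<mu>" unfolding f_def by measurable
  define \<mu>' where "\<mu>' = density \<mu> f"
  have "sets \<mu>' = sets (borel_of (shift_topology I A))" by (simp add: \<mu>'_def sets_\<mu>)
  moreover have "sigma_finite_measure \<mu>'"
    unfolding \<mu>'_def by (subst \<mu>.sigma_finite_iff_density_finite'[OF fm]) (simp add: f_def)
  moreover have "\<nu> = \<mu>' \<Otimes>\<^sub>M haar G"
  proof -
    have h1: "density (haar G) (\<lambda>_. 1) = haar G" by (rule density_1)
    have "\<mu>' \<Otimes>\<^sub>M haar G = density \<mu> f \<Otimes>\<^sub>M density (haar G) (\<lambda>_. 1)" by (simp only: \<mu>'_def h1)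
    also have "\<dots> = density m (\<lambda>(x, g). f x * 1)"
      by (rule pair_measure_density) (simp_all add: fm h1 sigma_finite_haar)
    also have "\<dots> = density m (\<lambda>p. ennreal (1 / (R * h p)))"
    proof (rule density_cong)
      show "(\<lambda>(x, g). f x * 1) \<in> borel_measurable m" using fm by measurable
      show "(\<lambda>p. ennreal (1 / (R * h p))) \<in> borel_measurable m"
        unfolding measurable_cong_sets[OF sets_m refl] by measurable
      show "AE p in m. (case p of (x, g) \<Rightarrow> f x * 1) = ennreal (1 / (R * h p))"
      proof (rule AE_I2)
        fix p assume "p \<in> space m"
        then have "h (fst p, \<one>) = h (fst p, snd p)" by (intro h_independent[OF c1]) (simp_all add: space_m in_X)
        then show "(case p of (x, g) \<Rightarrow> f x * 1) = ennreal (1 / (R * h p))" by (simp add: f_def split_beta)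
      qed
    qed
    also have "\<dots> = density (density \<nu> (\<lambda>p. ennreal (R * h p))) (\<lambda>p. ennreal (1 / (R * h p)))" by (simp only: R(2))
    also have "\<dots> = density \<nu> (\<lambda>p. ennreal (R * h p) * ennreal (1 / (R * h p)))"
      by (rule density_density_eq) measurable
    also have "\<dots> = density \<nu> (\<lambda>_. 1)"
    proof (rule density_cong)
      show "AE p in \<nu>. ennreal (R * h p) * ennreal (1 / (R * h p)) = 1"
      proof (rule AE_I2)
        fix p assume "p \<in> space \<nu>"
        then have "h p \<noteq> 0" "0 \<le> R * h p" using R(1) h_pos[of p] by simp_all
        moreover from this have "(R * h p) * (1 / (R * h p)) = 1" using R(1) by simp
        ultimately have "(R * h p) * (1 / (R * h p)) = 1" "0 \<le> R * h p" by simp_all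
        then show "ennreal (R * h p) * ennreal (1 / (R * h p)) = 1"
          by (subst ennreal_mult'[symmetric]) simp_all
      qed
    qed measurable
    also have "\<dots> = \<nu>" by (rule density_1)
    finally show ?thesis ..
  qed
  ultimately show ?thesis unfolding haar_product_measure_def by blast
qed

lemma twisted_eq: "\<forall>g\<in>carrier G. c g = 1 \<Longrightarrow> x \<in> mshift I A \<Longrightarrow> twisted_potential \<Psi> c \<phi> x = \<phi> x"
  by (auto simp: twisted_potential_def mshift_def)

lemma gurevich_pressure_cong:
  assumes "\<And>x. x \<in> mshift I A \<Longrightarrow> f x = f' x"
  shows "gurevich_pressure I A f = gurevich_pressure I A f'"
proof -
  have "partition_fun I A f a n = partition_fun I A f' a n" for a n
    unfolding partition_fun_def using birkhoff_sum_cong[OF assms] by (intro infsum_cong) auto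
  then show ?thesis by (simp add: gurevich_pressure_def)
qed

lemma invariant_gibbs_measure_cong:
  assumes "\<And>x. x \<in> mshift I A \<Longrightarrow> f x = f' x" "invariant_gibbs_measure I A f \<mu>'"
  shows "invariant_gibbs_measure I A f' \<mu>'"
proof -
  have "birkhoff_sum n f x = birkhoff_sum n f' x" if "x \<in> cylinder I A w" for n x w
    using birkhoff_sum_cong[OF assms(1)] that by (auto simp: cylinder_def)
  moreover have "gurevich_pressure I A f' = gurevich_pressure I A f"
    by (rule gurevich_pressure_cong[symmetric]) (rule assms(1))
  ultimately show ?thesis using assms(2) unfolding invariant_gibbs_measure_def by simp
qed

text \<open>If \<open>\<mu>\<close> is the Gibbs measure of both \<open>\<phi>\<close> and \<open>\<phi>_c\<close>, then the \<open>n\<close>-th Birkhoff sums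
  of the two potentials differ by a multiple of \<open>n\<close> up to a bounded error. Mixing allows one to
  evaluate this at any fixed group element and at all large times.\<close>

lemma c_trivial_of_gibbs:
  assumes \<mu>': "invariant_gibbs_measure I A \<phi> \<mu>'" and eq: "is_equilibrium_measure h \<nu> (\<mu>' \<Otimes>\<^sub>M haar G)"
  shows "\<forall>g\<in>carrier G. c g = 1"
proof -
  interpret \<mu>: prob_space \<mu> by (rule prob_\<mu>)
  have s\<mu>': "sets \<mu>' = sets (borel_of (shift_topology I A))" and p\<mu>': "prob_space \<mu>'"
    using \<mu>' by (simp_all add: invariant_gibbs_measure_def)
  interpret \<mu>': prob_space \<mu>' by (rule p\<mu>')
  obtain t where t: "t > 0" "\<mu>' \<Otimes>\<^sub>M haar G = density \<nu> (\<lambda>p. ennreal (t * h p))"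
    using eq by (auto simp: is_equilibrium_measure_def)
  obtain R where R: "R > 0" "m = density \<nu> (\<lambda>p. ennreal (R * h p))" using m_eq_density by blast
  have scale: "emeasure \<mu>' B = ennreal (t / R) * emeasure \<mu> B" if B: "B \<in> sets (borel_of (shift_topology I A))" for B
  proof -
    have BX: "B \<times> {\<one>} \<in> sets MX"
      using B sets_product[OF sets_\<mu>] by (metis G.one_closed empty_subsetI insert_subset pair_measureI sets_\<mu> sets_count_space Pow_iff)
    have "emeasure \<mu>' B = emeasure (\<mu>' \<Otimes>\<^sub>M haar G) (B \<times> {\<one>})"
      using B by (intro product_slice[symmetric]) (simp_all add: s\<mu>')
    also have "\<dots> = (\<integral>\<^sup>+p. ennreal (t * h p) * indicator (B \<times> {\<one>}) p \<partial>\<nu>)"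
      unfolding t(2) using BX by (intro emeasure_density) (simp_all add: sets_\<nu>)
    also have "\<dots> = (\<integral>\<^sup>+p. ennreal (t / R) * (ennreal (R * h p) * indicator (B \<times> {\<one>}) p) \<partial>\<nu>)"
      using t(1) R(1) by (intro nn_integral_cong) (simp add: mult.assoc[symmetric] ennreal_mult'[symmetric])
    also have "\<dots> = ennreal (t / R) * (\<integral>\<^sup>+p. ennreal (R * h p) * indicator (B \<times> {\<one>}) p \<partial>\<nu>)"
      using BX by (intro nn_integral_cmult) (simp add: sets_\<nu>)
    also have "(\<integral>\<^sup>+p. ennreal (R * h p) * indicator (B \<times> {\<one>}) p \<partial>\<nu>) = emeasure m (B \<times> {\<one>})"
      by (rule m_eq_integral[OF R(2) BX, symmetric])
    also have "\<dots> = emeasure \<mu> B" using B by (intro product_slice) (simp_all add: sets_\<mu>)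
    finally show ?thesis .
  qed
  have "mshift I A \<in> sets (borel_of (shift_topology I A))"
    using sets.top[of "borel_of (shift_topology I A)"] by simp
  then have "emeasure \<mu>' (mshift I A) = ennreal (t / R) * emeasure \<mu> (mshift I A)" by (rule scale)
  then have "ennreal (t / R) = 1"
    using \<mu>.emeasure_space_1 \<mu>'.emeasure_space_1 sets_eq_imp_space_eq[OF s\<mu>'] by (simp add: space_\<mu>)
  then have same: "emeasure \<mu>' B = emeasure \<mu> B" if "B \<in> sets (borel_of (shift_topology I A))" for B
    using scale[OF that] by simp
  define P' where "P' = real_of_ereal (gurevich_pressure I A \<phi>)"
  obtain C where C: "C > 0" "\<And>n w x. n \<ge> 1 \<Longrightarrow> w \<in> words_of_length I A n \<Longrightarrow> x \<in> cylinder I A w \<Longrightarrow>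
     inverse C \<le> measure \<mu>' (cylinder I A w) * exp (- birkhoff_sum n \<phi> x + real n * P') \<and>
     measure \<mu>' (cylinder I A w) * exp (- birkhoff_sum n \<phi> x + real n * P') \<le> C"
    using \<mu>' unfolding invariant_gibbs_measure_def P'_def[symmetric] Let_def by blast
  obtain D where D: "D > 0"
    "\<And>p n. p \<in> X \<Longrightarrow> n \<ge> 1 \<Longrightarrow> ennreal (weight_c n p / D) \<le> emeasure m (nb n p)"
    "\<And>p n. p \<in> X \<Longrightarrow> n \<ge> 1 \<Longrightarrow> emeasure m (nb n p) \<le> ennreal (D * weight_c n p)"
    using m_nb_bounds by blast
  have bound: "\<bar>ln (c (snd ((T ^^ n) p))) - real n * (P' - P)\<bar> \<le> ln (C * D)"
    if p: "p \<in> X" "snd p = \<one>" and n: "n \<ge> 1" for p n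
  proof -
    define W where "W = cylinder I A (map (fst p) [0..<n])"
    define y where "y = measure \<mu> W"
    have "measure \<mu>' W = y"
      unfolding W_def y_def measure_def using same[OF cylinder_sets] by simp
    moreover have "map (fst p) [0..<n] \<in> words_of_length I A n"
      using p by (auto simp: words_of_length_def successively_conv_nth in_X mshift_def)
    moreover have "fst p \<in> cylinder I A (map (fst p) [0..<n])" using p by (auto simp: cylinder_def in_X)
    ultimately have y1: "inverse C \<le> y * exp (- birkhoff_sum n \<phi> (fst p) + real n * P')"
      "y * exp (- birkhoff_sum n \<phi> (fst p) + real n * P') \<le> C"
      using C(2)[OF n] by (auto simp: W_def)
    have ym: "emeasure m (nb n p) = ennreal y" using m_nb[OF p(1), of n] by (simp add: y_def W_def \<mu>.emeasure_eq_measure)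
    have y2: "weight_c n p / D \<le> y" "y \<le> D * weight_c n p"
      using D(2)[OF p(1) n] D(3)[OF p(1) n] D(1) weight_c_pos[OF p(1), of n] unfolding ym
      by (simp_all add: y_def)
    have ypos: "y > 0" using y2(1) D(1) weight_c_pos[OF p(1), of n] by (meson divide_pos_pos less_le_trans)
    define \<sigma> where "\<sigma> = birkhoff_sum n \<phi> (fst p)"
    define l where "l = ln (c (snd ((T ^^ n) p)))"
    have lw: "ln (weight_c n p) = \<sigma> - l - real n * P"
      unfolding weight_c_eq[OF p(1)] ln_exp birkhoff_twisted[OF p(1)] by (simp add: p(2) c_one \<sigma>_def l_def)
    have "ln (inverse C) \<le> ln (y * exp (- \<sigma> + real n * P'))" "ln (y * exp (- \<sigma> + real n * P')) \<le> ln C"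
      using y1 C(1) ypos unfolding \<sigma>_def by (subst ln_le_cancel_iff; simp)+
    then have 1: "- ln C \<le> ln y - \<sigma> + real n * P'" "ln y - \<sigma> + real n * P' \<le> ln C"
      using ypos C(1) by (simp_all add: ln_mult_pos ln_inverse)
    have "ln (weight_c n p / D) \<le> ln y" "ln y \<le> ln (D * weight_c n p)"
      using y2 ypos D(1) weight_c_pos[OF p(1), of n] by (subst ln_le_cancel_iff; simp)+
    then have 2: "\<sigma> - l - real n * P - ln D \<le> ln y" "ln y \<le> ln D + (\<sigma> - l - real n * P)"
      using D(1) weight_c_pos[OF p(1), of n] lw by (simp_all add: ln_mult_pos ln_div)
    have "ln (C * D) = ln C + ln D" using C(1) D(1) by (simp add: ln_mult_pos)
    moreover have "real n * (P' - P) = real n * P' - real n * P" by (simp add: right_diff_distrib)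
    ultimately show ?thesis unfolding l_def[symmetric] using 1 2 by linarith
  qed
  obtain s where s: "s \<in> X" using X_nonempty by blast
  define s\<^sub>1 where "s\<^sub>1 = (fst s, \<one>)"
  have s\<^sub>1: "s\<^sub>1 \<in> X" using s by (simp add: s\<^sub>1_def in_X)
  have reach: "\<exists>k\<^sub>0. \<forall>k\<ge>k\<^sub>0. \<bar>ln (c g) - real k * (P' - P)\<bar> \<le> ln (C * D)" if g: "g \<in> carrier G" for g
  proof -
    have "(fst s, g) \<in> X" using s g by (simp add: in_X)
    then obtain k\<^sub>0 where k\<^sub>0: "\<And>k. k \<ge> k\<^sub>0 \<Longrightarrow> \<exists>r\<in>nb 1 s\<^sub>1. (T ^^ k) r \<in> nb 1 (fst s, g)" using path[OF s\<^sub>1] by blast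
    have "\<bar>ln (c g) - real k * (P' - P)\<bar> \<le> ln (C * D)" if k: "k \<ge> Suc k\<^sub>0" for k
    proof -
      obtain r where r: "r \<in> nb 1 s\<^sub>1" "(T ^^ k) r \<in> nb 1 (fst s, g)" using k\<^sub>0[of k] k by auto
      have "r \<in> X" "snd r = \<one>" "snd ((T ^^ k) r) = g" using r by (auto simp: nb_def s\<^sub>1_def)
      then show ?thesis using bound[of r k] k by simp
    qed
    then show ?thesis by blast
  qed
  have PP: "P' = P"
  proof (rule ccontr)
    assume ne: "P' \<noteq> P"
    obtain k\<^sub>0 where k\<^sub>0: "\<And>k. k \<ge> k\<^sub>0 \<Longrightarrow> \<bar>ln (c \<one>) - real k * (P' - P)\<bar> \<le> ln (C * D)" using reach[OF G.one_closed] by blast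
    obtain k where k: "ln (C * D) / \<bar>P' - P\<bar> < real k" using reals_Archimedean2 by blast
    have "real k * \<bar>P' - P\<bar> \<le> real (max k k\<^sub>0) * \<bar>P' - P\<bar>" by (intro mult_right_mono) auto
    also have "\<dots> \<le> ln (C * D)" using k\<^sub>0[of "max k k\<^sub>0"] by (simp add: c_one abs_mult)
    finally show False using k ne by (simp add: field_simps)
  qed
  have "exp (- ln (C * D)) \<le> c g" if g: "g \<in> carrier G" for g
  proof -
    have "\<bar>ln (c g)\<bar> \<le> ln (C * D)" using reach[OF g] PP by auto
    then have "exp (- ln (C * D)) \<le> exp (ln (c g))" by simp
    then show ?thesis using c_pos[OF g] by simp
  qed
  then show ?thesis by (intro c_trivial_of_lower_bound[of "exp (- ln (C * D))"]) simp_all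
qed

text \<open>If the pressure of \<open>\<phi>\<close> on the base is \<open>P\<close>, the base carries a positive superharmonic function.
  Its lift to \<open>X\<close> is a multiple of \<open>h\<close>, so that \<open>h\<close> is constant along almost every fibre.\<close>

lemma c_trivial_of_pressure:
  assumes press: "gurevich_pressure I A \<phi> = ereal P"
    and letters: "\<And>i. i \<in> I \<Longrightarrow> \<exists>x\<in>mshift I A. x 0 = i"
  shows "\<forall>g\<in>carrier G. c g = 1"
proof -
  interpret \<mu>: prob_space \<mu> by (rule prob_\<mu>)
  interpret haar: sigma_finite_measure "haar G" by (rule sigma_finite_haar)
  interpret pair: pair_sigma_finite \<mu> "haar G" ..
  obtain p\<^sub>0 where "p\<^sub>0 \<in> X" using X_nonempty by blast
  then have "fst p\<^sub>0 0 \<in> I" by (rule letter_in_I)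
  then have "(SOME a. a \<in> I) \<in> I" by (rule someI)
  then obtain x\<^sub>0 where x\<^sub>0: "x\<^sub>0 \<in> mshift I A" "x\<^sub>0 0 = (SOME a. a \<in> I)" using letters by blast
  obtain u where u: "(\<lambda>p. u (fst p)) \<in> borel_measurable MX"
    "\<And>x. x \<in> mshift I A \<Longrightarrow> 0 < u x \<and> u x < \<infinity>"
    "\<And>p. p \<in> X \<Longrightarrow> Lop (\<lambda>q. u (fst q)) p \<le> ennreal (exp P) * u (fst p)"
    using base_superharmonic[OF x\<^sub>0 press] by blast
  have inX: "AE p in \<nu>. p \<in> X" using AE_space[of \<nu>] by simp
  have fin: "AE p in \<nu>. u (fst p) < \<infinity>" using inX by eventually_elim (use u(2) in \<open>simp add: in_X\<close>)
  have sup: "AE p in \<nu>. Lop (\<lambda>q. u (fst q)) p \<le> ennreal (exp P) * u (fst p)"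
    using inX by eventually_elim (rule u(3))
  obtain \<kappa> where \<kappa>: "\<kappa> \<ge> 0" "AE p in \<nu>. u (fst p) = ennreal (\<kappa> * h p)"
    using superharmonic_unique[OF u(1) fin sup] by blast
  have "AE p in m. u (fst p) = ennreal (\<kappa> * h p)" by (rule AE_m_of_AE_\<nu>[OF \<kappa>(2)])
  then have "AE x in \<mu>. AE g in haar G. u (fst (x, g)) = ennreal (\<kappa> * h (x, g))" by (rule pair.AE_pair)
  then have "AE x in \<mu>. \<forall>g\<in>carrier G. u x = ennreal (\<kappa> * h (x, g))" by (simp add: AE_count_space)
  then have "AE x in \<mu>. x \<in> mshift I A \<and> (\<forall>g\<in>carrier G. u x = ennreal (\<kappa> * h (x, g)))"
    using AE_space[of \<mu>] by eventually_elim (simp add: space_\<mu>)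
  then have "\<exists>x. x \<in> mshift I A \<and> (\<forall>g\<in>carrier G. u x = ennreal (\<kappa> * h (x, g)))"
    by (rule eventually_happens'[OF \<mu>.ae_filter_bot])
  then obtain x where x: "x \<in> mshift I A" "\<And>g. g \<in> carrier G \<Longrightarrow> u x = ennreal (\<kappa> * h (x, g))"
    by blast
  have "\<kappa> \<noteq> 0" using x(2)[OF G.one_closed] u(2)[OF x(1)] by auto
  have "h (x, g) = h (x, \<one>)" if g: "g \<in> carrier G" for g
  proof -
    have "ennreal (\<kappa> * h (x, g)) = ennreal (\<kappa> * h (x, \<one>))" using x(2)[OF g] x(2)[OF G.one_closed] by simp
    then show ?thesis
      using \<kappa>(1) \<open>\<kappa> \<noteq> 0\<close> h_pos[of "(x, g)"] h_pos[of "(x, \<one>)"] x(1) g by (simp add: in_X)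
  qed
  then show ?thesis by (rule c_trivial_of_h[OF x(1)])
qed

end

context group_extension_potential
begin

text \<open>A divergent real sum has the default value \<open>0\<close>, so a non-zero value of \<open>transfer_op\<close> certifies
  convergence.\<close>

lemma Lop_eq_transfer_op:
  assumes p: "p \<in> X" and pos: "\<And>q. q \<in> X \<Longrightarrow> u q \<ge> 0"
    and ne: "transfer_op X T (\<phi> \<circ> fst) u p \<noteq> 0"
  shows "Lop (\<lambda>q. ennreal (u q)) p = ennreal (transfer_op X T (\<phi> \<circ> fst) u p)"
proof -
  define B where "B = {q \<in> X. T q = p}"
  define f where "f q = exp (\<phi> (fst q)) * u q" for q
  have tr: "transfer_op X T (\<phi> \<circ> fst) u p = infsum f B"     unfolding transfer_op_def B_def by (intro infsum_cong) (simp add: f_def)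
  have f0: "f q \<ge> 0" if "q \<in> B" for q using that pos by (simp add: B_def f_def)
  have sm: "f summable_on B" using ne infsum_not_exists unfolding tr by blast
  define J where "J = {i. p \<in> succ_set i}"
  have bij: "bij_betw (\<lambda>i. prepend i p) J B"
  proof (rule bij_betw_byWitness[where f' = "\<lambda>q. fst q 0"])
    show "\<forall>i\<in>J. fst (prepend i p) 0 = i" by simp
    show "\<forall>q\<in>B. prepend (fst q 0) p = q" using prepend_T by (auto simp: B_def)
    show "(\<lambda>i. prepend i p) ` J \<subseteq> B" using p by (auto simp: J_def B_def succ_set_def prepend_X T_prepend)
    show "(\<lambda>q. fst q 0) ` B \<subseteq> J"
    proof (rule image_subsetI)
      fix q assume "q \<in> B"
      then have q: "q \<in> X" "T q = p" by (auto simp: B_def)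
      have "A (fst q 0) (fst q 1)" "fst p 0 = fst q 1" using q by (auto simp: in_X mshift_def fst_T left_shift_def)
      then show "fst q 0 \<in> J" using p letter_in_I[OF q(1)] by (simp add: J_def succ_set_def)
    qed
  qed
  have "Lop (\<lambda>q. ennreal (u q)) p = (\<integral>\<^sup>+i. branch_term i (\<lambda>q. ennreal (u q)) p \<partial>count_space UNIV)"
    by (rule Lop_eq_nn_integral)
  also have "\<dots> = (\<integral>\<^sup>+i. ennreal (f (prepend i p)) * indicator J i \<partial>count_space UNIV)"
    by (intro nn_integral_cong) (auto simp: branch_term_def f_def J_def indicator_def ennreal_mult')
  also have "\<dots> = (\<integral>\<^sup>+i. ennreal (f (prepend i p)) \<partial>count_space J)"
    by (rule nn_integral_count_space_indicator[symmetric]) simp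
  also have "\<dots> = (\<integral>\<^sup>+q. ennreal (f q) \<partial>count_space B)"
    by (rule nn_integral_bij_count_space[OF bij])
  also have "\<dots> = ennreal (infsum f B)"
  proof (rule antisym)
    have "countable B" using bij by (metis bij_betw_imp_surj_on countable_image uncountable_def countableI_type)
    then have "(\<integral>\<^sup>+q. ennreal (f q) \<partial>count_space B) \<le> infsum (\<lambda>q. ennreal (f q)) B"
      by (rule nn_integral_count_space_le_infsum)
    also have "\<dots> \<le> ennreal (infsum f B)"
    proof (rule infsum_le_finite_sums)
      show "(\<lambda>q. ennreal (f q)) summable_on B" by (rule nonneg_summable_on_complete) simp
      fix F assume F: "finite F" "F \<subseteq> B"
      have "(\<Sum>q\<in>F. ennreal (f q)) = ennreal (sum f F)" using F f0 by (intro sum_ennreal) auto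
      also have "\<dots> \<le> ennreal (infsum f B)" using F f0 sm by (intro ennreal_leI finite_sum_le_infsum) auto
      finally show "(\<Sum>q\<in>F. ennreal (f q)) \<le> ennreal (infsum f B)" .
    qed
    finally show "(\<integral>\<^sup>+q. ennreal (f q) \<partial>count_space B) \<le> ennreal (infsum f B)" .
    have "ennreal (infsum f B) = (SUP F\<in>{F. finite F \<and> F \<subseteq> B}. ennreal (sum f F))"
      using sm f0 by (rule infsum_nonneg_is_SUPREMUM_ennreal)
    also have "\<dots> \<le> (\<integral>\<^sup>+q. ennreal (f q) \<partial>count_space B)"
    proof (rule SUP_least)
      fix F assume "F \<in> {F. finite F \<and> F \<subseteq> B}"
      then have F: "finite F" "F \<subseteq> B" by auto
      have "ennreal (sum f F) = (\<Sum>q\<in>F. ennreal (f q))" using F f0 by (intro sum_ennreal[symmetric]) auto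
      also have "\<dots> = (\<integral>\<^sup>+q. ennreal (f q) \<partial>count_space F)" using F by (simp add: nn_integral_count_space_finite)
      also have "\<dots> \<le> 1 * (\<integral>\<^sup>+q. ennreal (f q) \<partial>count_space B)"
        by (rule nn_integral_count_space_injection[where j = "\<lambda>q. q"]) (use F in auto)
      finally show "ennreal (sum f F) \<le> (\<integral>\<^sup>+q. ennreal (f q) \<partial>count_space B)" by simp
    qed
    finally show "ennreal (infsum f B) \<le> (\<integral>\<^sup>+q. ennreal (f q) \<partial>count_space B)" .
  qed
  finally show ?thesis unfolding tr .
qed

end

theorem corollary1p3:
  fixes I :: "nat set" and A :: "nat \<Rightarrow> nat \<Rightarrow> bool"
    and G :: "('g, 'm) monoid_scheme"
    and \<Psi> :: "nat list \<Rightarrow> 'g"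
    and \<phi> :: "(nat \<Rightarrow> nat) \<Rightarrow> real"
    and c :: "'g \<Rightarrow> real"
    and h :: "(nat \<Rightarrow> nat) \<times> 'g \<Rightarrow> real"
    and \<nu> :: "((nat \<Rightarrow> nat) \<times> 'g) measure"
  assumes "finitely_primitive I A"
    and "group G" and "countable (carrier G)"
    and "semigroup_hom I G \<Psi>"
    and "ext_mixing I A G \<Psi>"
    and "hoelder_continuous I A \<phi>"
    and "ext_pressure I A G \<Psi> (\<phi> \<circ> fst) < \<infinity>"
    and "ext_recurrent I A G \<Psi> (\<phi> \<circ> fst)"
    and "conservative_twist I A G \<Psi> \<phi> c"
    and "positive_eigenfunction I A G \<Psi> (\<phi> \<circ> fst) h"
    and "conformal_measure I A G \<Psi> (\<phi> \<circ> fst) \<nu>"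
  shows
    "((\<forall>g\<in>carrier G. c g = 1) \<longleftrightarrow>
       ext_pressure I A G \<Psi> (\<phi> \<circ> fst) = gurevich_pressure I A \<phi>) \<and>
     ((\<forall>g\<in>carrier G. c g = 1) \<longleftrightarrow>
       (\<forall>x\<in>mshift I A. \<forall>g\<in>carrier G. \<forall>g'\<in>carrier G. h (x, g) = h (x, g'))) \<and>
     ((\<forall>g\<in>carrier G. c g = 1) \<longleftrightarrow> haar_product_measure I A G \<nu>) \<and>
     ((\<forall>g\<in>carrier G. c g = 1) \<longleftrightarrow>
       gurevich_pressure I A \<phi> < \<infinity> \<and>
       (\<exists>\<mu>. invariant_gibbs_measure I A \<phi> \<mu> \<and>
            is_equilibrium_measure h \<nu> (\<mu> \<Otimes>\<^sub>M haar G)))"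
proof -
  interpret group_extension I A G \<Psi>
    by (rule group_extension.intro) (fact assms(2,3,4))+
  have adm1: "[i] \<in> adm_words I A" if "i \<in> I" for i
    using that by (auto simp: adm_words_def words_of_length_def intro!: bexI[of _ 1])
  have nb1: "nb 1 s = ext_cylinder I A [fst s 0] (snd s)" if "s \<in> X" for s
    using that by (auto simp: nb_def ext_cylinder_def cylinder_def in_X)
  have cyl: "0 < emeasure \<nu> (ext_cylinder I A w g) \<and> emeasure \<nu> (ext_cylinder I A w g) < \<infinity>"
    if "w \<in> adm_words I A" "g \<in> carrier G" for w g
    using assms(11) that by (simp add: conformal_measure_def)
  have letters: "\<exists>x\<in>mshift I A. x 0 = i" if i: "i \<in> I" for i
  proof -
    have "ext_cylinder I A [i] \<one>\<^bsub>G\<^esub> \<noteq> {}" using cyl[OF adm1[OF i] G.one_closed] by auto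
    then show ?thesis by (auto simp: ext_cylinder_def cylinder_def)
  qed
  obtain \<mu> where \<mu>: "invariant_gibbs_measure I A (twisted_potential \<Psi> c \<phi>) \<mu>" "conservative T (\<mu> \<Otimes>\<^sub>M haar G)"
    and c: "c \<in> hom G pos_reals" and fin: "gurevich_pressure I A (twisted_potential \<Psi> c \<phi>) < \<infinity>"
    using assms(9) unfolding conservative_twist_def by blast
  define P where "P = real_of_ereal (gurevich_pressure I A (twisted_potential \<Psi> c \<phi>))"
  interpret gibbs_extension I A G \<Psi> \<phi> P c \<mu>
  proof unfold_locales
    show "hoelder_continuous I A \<phi>" by (rule assms(6))
    fix s t assume "s \<in> X" "t \<in> X"
    then show "\<exists>k\<^sub>0. \<forall>k\<ge>k\<^sub>0. \<exists>r\<in>nb 1 s. (T ^^ k) r \<in> nb 1 t"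
      using mixing_path[OF assms(5) letters] by metis
  qed (fact c \<mu> P_def)+
  have extP: "ext_pressure I A G \<Psi> (\<phi> \<circ> fst) = ereal P" by (rule ext_pressure_eq[OF letters])
  have twP: "gurevich_pressure I A (twisted_potential \<Psi> c \<phi>) = ereal P" by (rule twisted_pressure_eq[OF letters fin])
  have h: "\<And>p. p \<in> X \<Longrightarrow> h p > 0" "continuous_map (ext_topology I A G) euclideanreal h"
    "\<And>p. p \<in> X \<Longrightarrow> exp (- P) * transfer_op X T (\<phi> \<circ> fst) h p = h p"
    "\<And>w g. w \<in> adm_words I A \<Longrightarrow> g \<in> carrier G \<Longrightarrow> bounded (h ` ext_cylinder I A w g)"
    using assms(10) unfolding positive_eigenfunction_def extP real_of_ereal.simps by auto
  interpret equilibrium I A G \<Psi> \<phi> P c \<mu> \<nu> h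
  proof unfold_locales
    show "sets \<nu> = sets MX" using assms(11) by (simp add: conformal_measure_def)
    show "dual_eigenmeasure T (\<phi> \<circ> fst) (exp P) \<nu>" using assms(11) by (simp add: conformal_measure_def extP)
    show "0 < emeasure \<nu> (nb 1 s) \<and> emeasure \<nu> (nb 1 s) < \<infinity>" if "s \<in> X" for s
      unfolding nb1[OF that] using that by (intro cyl adm1 letter_in_I) (simp_all add: in_X)
    show "h p > 0" if "p \<in> X" for p using h(1)[OF that] .
    show "\<exists>n. \<forall>q\<in>nb n p. \<bar>h q - h p\<bar> < e" if p: "p \<in> X" and e: "e > 0" for p e
    proof -
      have "openin (ext_topology I A G) {q \<in> topspace (ext_topology I A G). h q \<in> ball (h p) e}"
        by (rule openin_continuous_map_preimage[OF h(2)]) simp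
      moreover have "p \<in> {q \<in> topspace (ext_topology I A G). h q \<in> ball (h p) e}" using p e by simp
      ultimately obtain n where "nb n p \<subseteq> {q \<in> topspace (ext_topology I A G). h q \<in> ball (h p) e}"
        unfolding openin_ext_topology by blast
      then have "\<forall>q\<in>nb n p. \<bar>h q - h p\<bar> < e" by (auto simp: dist_real_def abs_minus_commute)
      then show ?thesis ..
    qed
    show "Lop (\<lambda>q. ennreal (h q)) p = ennreal (exp P) * ennreal (h p)" if p: "p \<in> X" for p
    proof -
      have eq: "transfer_op X T (\<phi> \<circ> fst) h p = exp P * h p"
        using h(3)[OF p] by (simp add: exp_minus field_simps)
      have "Lop (\<lambda>q. ennreal (h q)) p = ennreal (transfer_op X T (\<phi> \<circ> fst) h p)"
        using h(1)[OF p] by (intro Lop_eq_transfer_op[OF p]) (simp_all add: eq h(1) less_imp_le)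
      then show ?thesis by (simp add: eq ennreal_mult')
    qed
    show "\<exists>B. \<forall>p\<in>nb 1 s. h p \<le> B" if s: "s \<in> X" for s
    proof -
      have "bounded (h ` nb 1 s)"
        unfolding nb1[OF s] using s by (intro h(4) adm1 letter_in_I) (simp_all add: in_X)
      then obtain B where "\<forall>y\<in>h ` nb 1 s. \<bar>y\<bar> \<le> B" unfolding bounded_iff by auto
      then have "\<forall>p\<in>nb 1 s. h p \<le> B" by (metis abs_ge_self imageI order_trans)
      then show ?thesis ..
    qed
  qed
  let ?c1 = "\<forall>g\<in>carrier G. c g = 1"
  have press: "gurevich_pressure I A \<phi> = ereal P" if "?c1"
    using gurevich_pressure_cong[OF twisted_eq[OF that]] twP by simp
  have "?c1 \<longleftrightarrow> ext_pressure I A G \<Psi> (\<phi> \<circ> fst) = gurevich_pressure I A \<phi>"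
    using press extP c_trivial_of_pressure[OF _ letters] by auto
  moreover have "?c1 \<longleftrightarrow> (\<forall>x\<in>mshift I A. \<forall>g\<in>carrier G. \<forall>g'\<in>carrier G. h (x, g) = h (x, g'))"
  proof
    assume *: "\<forall>x\<in>mshift I A. \<forall>g\<in>carrier G. \<forall>g'\<in>carrier G. h (x, g) = h (x, g')"
    obtain p where "p \<in> X" using X_nonempty by blast
    then have x: "fst p \<in> mshift I A" by (simp add: in_X)
    show ?c1 by (rule c_trivial_of_h[OF x]) (use * x in blast)
  qed (use h_independent in blast)
  moreover have "?c1 \<longleftrightarrow> haar_product_measure I A G \<nu>"
    using c_trivial_of_product product_of_c_trivial by blast
  moreover have "?c1 \<longleftrightarrow> gurevich_pressure I A \<phi> < \<infinity> \<and>
       (\<exists>\<mu>. invariant_gibbs_measure I A \<phi> \<mu> \<and> is_equilibrium_measure h \<nu> (\<mu> \<Otimes>\<^sub>M haar G))"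
  proof
    assume c1: ?c1
    have "invariant_gibbs_measure I A \<phi> \<mu>"
      by (rule invariant_gibbs_measure_cong[OF twisted_eq[OF c1] \<mu>(1)])
    moreover have "is_equilibrium_measure h \<nu> m"
      unfolding is_equilibrium_measure_def using m_eq_density by blast
    ultimately show "gurevich_pressure I A \<phi> < \<infinity> \<and>
       (\<exists>\<mu>. invariant_gibbs_measure I A \<phi> \<mu> \<and> is_equilibrium_measure h \<nu> (\<mu> \<Otimes>\<^sub>M haar G))"
      using press[OF c1] by auto
  qed (use c_trivial_of_gibbs in blast)
  ultimately show ?thesis by blast
qed

end
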